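(* In the bilinear saddle-point setting described in the context (assumptions (A1)–(A3), the ambient-smoothness condition, $\mathcal S\ne\varnothing$, and the fixed choice of $z^*$, $f'(x^* )$, $g'(y^* )$, $\xi$, $\zeta$), assume $\min\{\delta_x,\delta_y\}>0$, $\beta_x\delta_y\le\frac14$, $\beta_y\delta_x\le\frac14$, and that $\zeta=0$ if $\beta_x>0$ and $\xi=0$ if $\beta_y>0$. Let $$\Psi(z):=\|z-z^*\|_{\mathbf P}^2+12\,\mathrm D_f(x,x^* )+12\,\mathrm D_g(y,y^* ).$$ Given $z^0\in\mathcal Z$ and $\varepsilon\in(0,\Psi(z^0)]$, run the restarted Sliding Algorithm (described in the context) with $\Omega_s:=(3/4)^s\Psi(z^0)$ for $$S:=\left\lceil\frac{\log(\Psi(z^0)/\varepsilon)}{\log(4/3)}\right\rceil$$ restarts. Then the output $z^S$ satisfies $\Psi(z^S)\le\varepsilon$, and the total numbers of oracle evaluations over all restarts are as follows. (1) Evaluations of $f'$: $\mathcal O\big(\tilde H_x^{\frac2{1+3\nu_x}}\varepsilon^{\frac{\nu_x-1}{1+3\nu_x}}\big)$ if $0\le\nu_x<1$, and $\widetilde{\mathcal O}(\sqrt{\kappa_x})$ if $\nu_x=1$. (2) Evaluations of $g'$: $\mathcal O\big(\tilde H_y^{\frac2{1+3\nu_y}}\varepsilon^{\frac{\nu_y-1}{1+3\nu_y}}\big)$ if $0\le\nu_y<1$, and $\widetilde{\mathcal O}(\sqrt{\kappa_y})$ if $\nu_y=1$. (3) Products with $\mathbf B$ or $\mathbf B^\top$: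 $\widetilde{\mathcal O}(\sqrt{\kappa_{xy}})$. Here $\mathcal O$ is understood as $\varepsilon\downarrow0$ with the problem data and $z^0$ fixed, and $\widetilde{\mathcal O}$ hides logarithmic factors in $\Psi(z^0)/\varepsilon$.
   Context: Problem. $\min_{x\in\mathcal X}\max_{y\in\mathcal Y}F(x,y)=f(x)+\langle y,\mathbf Bx\rangle-g(y)$, with $\mathcal X\subseteq\mathbb R^{d_x}$, $\mathcal Y\subseteq\mathbb R^{d_y}$ nonempty, closed, convex, $\mathcal Z=\mathcal X\times\mathcal Y$, $\mathbf B\in\mathbb R^{d_y\times d_x}$; $\mathcal S$ is its set of saddle points; $\|\cdot\|$ is Euclidean. $\partial f,\partial g$ are subdifferentials in the ambient spaces $\mathbb R^{d_x},\mathbb R^{d_y}$; $f'(x)\in\partial f(x)$ and $g'(y)\in\partial g(y)$ are arbitrary subgradients, and conditions on them hold for every choice. $\lambda_{\min},\lambda_{\max},\lambda_{\min}^+$ are the smallest, largest and smallest positive eigenvalue ($\lambda_{\min}^+(0)=0$). (A1) $f:\mathbb R^{d_x}\to\mathbb R$ is convex and finite; on $\mathcal X$ it is $\mu_x$-strongly convex, $\mu_x\ge0$ ($f(x')\ge f(x)+\langle f'(x),x'-x\rangle+\frac{\mu_x}2\|x'-x\|^2$ for $x,x'\in\mathcal X$), and $\|f'(x)-f'(x')\|\le H_x\|x-x'\|^{\nu_x}$ for $x,x'\in\mathcal X$, with $0\le\nu_x\le1$, $H_x>0$ (right side $H_x$ if $\nu_x=0$). (A2) $g:\mathbb R^{d_y}\to\mathbb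 R$ satisfies the same on $\mathcal Y$ with $\mu_y\ge0$, $0\le\nu_y\le1$, $H_y>0$. (A3) $L_{xy}>0$, $\mu_{xy},\mu_{yx}\ge0$, $L_{xy}>\max\{\mu_{xy},\mu_{yx}\}$, $L_{xy}^2\ge\lambda_{\max}(\mathbf B^\top\mathbf B)$. Let $\mathsf R_x$: $\partial f(x)\subseteq\operatorname{range}(\mathbf B^\top)$ for all $x\in\mathcal X$; $\mathsf R_y$: $\partial g(y)\subseteq\operatorname{range}(\mathbf B)$ for all $y\in\mathcal Y$. Either $\mu_{xy}^2\le\lambda_{\min}(\mathbf B^\top\mathbf B)$, or $\mathsf R_x$ is invoked, meaning that $\mathsf R_x$ holds, $\mathcal X+\ker\mathbf B=\mathcal X$ and $\mu_{xy}^2\le\lambda_{\min}^+(\mathbf B^\top\mathbf B)$. Either $\mu_{yx}^2\le\lambda_{\min}(\mathbf B\mathbf B^\top)$, or $\mathsf R_y$ is invoked, meaning that $\mathsf R_y$ holds, $\mathcal Y+\ker\mathbf B^\top=\mathcal Y$ and $\mu_{yx}^2\le\lambda_{\min}^+(\mathbf B\mathbf B^\top)$. If $\mu_{xy}>0$ and $\mu_{yx}>0$ then $\mu_{xy}=\mu_{yx}$. Ambient smoothness: if $\nu_x=1$, $f$ is differentiable on $\mathbb R^{d_x}$ with $H_x$-Lipschitz gradient there; if $\nu_y=1$, $g$ is differentiable on $\mathbb R^{d_y}$ with $H_y$-Lipschitz gradient there. Constants. For tolerances $\delta_f,\delta_g$ (positive if the corresponding exponent is $<1$): $L_x=\big[\frac{1-\nu_x}{2(1+\nu_x)\delta_f}\big]^{\frac{1-\nu_x}{1+\nu_x}}H_x^{\frac2{1+\nu_x}}$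 if $\nu_x<1$, $L_x=H_x$ if $\nu_x=1$; $L_y$ likewise from $\delta_g,\nu_y,H_y$. $\beta_x=\mathbf 1_{\{\nu_y=1\}}/(4L_y)$, $\beta_y=\mathbf 1_{\{\nu_x=1\}}/(4L_x)$; $\delta_x=\mu_x+4\beta_x\mu_{xy}^2$, $\delta_y=\mu_y+4\beta_y\mu_{yx}^2$; $\kappa_x=L_x/\delta_x$, $\kappa_y=L_y/\delta_y$, $\kappa_{xy}=L_{xy}^2/(\delta_x\delta_y)$; $\tilde H_x=H_x\delta_x^{-(1+\nu_x)/2}$, $\tilde H_y=H_y\delta_y^{-(1+\nu_y)/2}$. $\mathbf P=\operatorname{diag}(\delta_x\mathbf I_{d_x},\delta_y\mathbf I_{d_y})$, $\|z\|_{\mathbf P}^2=\langle\mathbf Pz,z\rangle$. Reference point. $\mathcal S\neq\varnothing$ and $z^*=(x^*,y^* )\in\mathcal S$ is fixed (the same for all restarts) with $x^0-x^*\in\operatorname{range}(\mathbf B^\top)$ if $\mathsf R_x$ is invoked and $y^0-y^*\in\operatorname{range}(\mathbf B)$ if $\mathsf R_y$ is invoked, where $z^0=(x^0,y^0)$. Fixed are $f'(x^* )\in\partial f(x^* )$, $g'(y^* )\in\partial g(y^* )$ and $\xi\in N_{\mathcal X}(x^* )$, $\zeta\in N_{\mathcal Y}(y^* )$ (normal cones) with $f'(x^* )+\mathbf B^\top y^*+\xi=0$, $g'(y^* )-\mathbf Bx^*+\zeta=0$. $\mathrm D_f(x,x^* )=f(x)-f(x^* )-\langle f'(x^* ),x-x^*\rangle$,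 $\mathrm D_g(y,y^* )=g(y)-g(y^* )-\langle g'(y^* ),y-y^*\rangle$. One stage with input $z_{\mathrm{in}}=(x_{\mathrm{in}},y_{\mathrm{in}})$ and bound $\Omega_{\mathrm{in}}$. Components: $p_1(x,y)=f(x)$, $p_2(x,y)=g(y)$, $p_3(x,y)=\frac{\beta_x}2\|\mathbf Bx-g'(y_{\mathrm{in}})\|^2+\frac{\beta_y}2\|\mathbf B^\top y+f'(x_{\mathrm{in}})\|^2$; $Q_1=Q_2=0$, $Q_3(x,y)=(\mathbf B^\top y,-\mathbf Bx)$; constants $L_1=\kappa_x,L_2=\kappa_y,L_3=\kappa_{xy}$, $M_1=M_2=0$, $M_3=\sqrt{\kappa_{xy}}$; budgets $R_1=\max\{\tilde H_x^{2/(1+3\nu_x)}\Omega_{\mathrm{in}}^{(\nu_x-1)/(1+3\nu_x)},1\}$, $R_2$ likewise with $y$, $R_3=\max\{\sqrt{\kappa_{xy}},1\}$. The pairs are assigned to levels $1,2,3$ of the Sliding Algorithm below by a permutation $\pi$ with $R_{\pi(1)}\le R_{\pi(2)}\le R_{\pi(3)}$; the loop counts are $A_0=1$, $T_i=\max\{1,\lceil cR_{\pi(i)}/A_{i-1}\rceil\}$, $A_i=A_{i-1}T_i$ with a sufficiently large absolute constant $c\ge1$; the tolerances are $\delta_f=\Omega_{\mathrm{in}}/(384A_{\pi^{-1}(1)})$ if $\nu_x<1$, $\delta_f=0$ if $\nu_x=1$, and $\delta_g=\Omega_{\mathrm{in}}/(384A_{\pi^{-1}(2)})$ if $\nu_y<1$,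 $\delta_g=0$ if $\nu_y=1$. Restarted algorithm: for $s=0,\dots,S-1$, $z^{s+1}$ is the output of one stage with $z_{\mathrm{in}}=z^s$, $\Omega_{\mathrm{in}}=\Omega_s$. Sliding Algorithm (for $n$ pairs, written $(p_i,Q_i)$ for the pair at level $i$, with constants $L_i,M_i$). Oracle vectors $\tilde\nabla p_i$ are exact (sub)gradients; $\alpha_0=1$, $\alpha_{t+1}=2/(1+\sqrt{1+4/\alpha_t^2})$; $\eta^k_{\mathbf t}=L_k\prod_{\ell=1}^k\alpha_{t_\ell}+M_k\prod_{\ell=1}^k\alpha_{t_\ell}/\alpha_{T_\ell-1}$ for $\mathbf t=(t_1,\dots,t_k)$, $0\le t_\ell\le T_\ell-1$. Set $z^k_{(0,\dots,0)}=z_{\mathrm{in}}$ for $k=1,\dots,n$; output $z_{\mathrm{out}}=\mathrm{Rec}(0,\varnothing)$, where $\mathrm{Rec}(k,\mathbf t)$, $\mathbf t=(t_1,\dots,t_k)$, is: (a) If $k=n$, return $\operatorname{argmin}_{z\in\mathcal Z}\sum_{i=1}^n\{\langle\tilde\nabla p_i(w^i_{(t_1,\dots,t_i)})+Q_i(z^i_{(t_1,\dots,t_i)}),z\rangle+\tfrac12\eta^i_{(t_1,\dots,t_i)}\|z-z^i_{(t_1,\dots,t_i)}\|_{\mathbf P}^2\}$. (b) If $k<n$, set $\bar z^{k+1}_{(\mathbf t,0)}=z^{k+1}_{(\mathbf t,0)}$. For $j=0,\dots,T_{k+1}-1$, with $\mathbf t'=(\mathbf t,j)$, $\mathbf t''=(\mathbf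 t,j+1)$: $\tilde z^{k+1}_{\mathbf t'}=\mathrm{Rec}(k+1,\mathbf t')$; $\bar z^{k+1}_{\mathbf t''}=\alpha_j\tilde z^{k+1}_{\mathbf t'}+(1-\alpha_j)\bar z^{k+1}_{\mathbf t'}$; $z^{k+1}_{\mathbf t''}=\operatorname{argmin}_{z\in\mathcal Z}\{\langle Q_{k+1}(\tilde z^{k+1}_{\mathbf t'})-Q_{k+1}(z^{k+1}_{\mathbf t'}),z\rangle+\tfrac12\eta^{k+1}_{\mathbf t'}\|z-\tilde z^{k+1}_{\mathbf t'}\|_{\mathbf P}^2\}$; for $\ell=k+2,\dots,n$, $z^\ell_{(\mathbf t'',0,\dots,0)}=z^\ell_{(\mathbf t',T_{k+2},0,\dots,0)}$ (zero-padded to length $\ell$). Return $\bar z^{k+1}_{(\mathbf t,T_{k+1})}$. Here $w^i_{(t_1,\dots,t_i)}=(a_1\circ\cdots\circ a_i)(z^i_{(t_1,\dots,t_i)})$, $a_\ell(z)=\alpha_{t_\ell}z+(1-\alpha_{t_\ell})\bar z^\ell_{(t_1,\dots,t_\ell)}$; $\tilde\nabla p_i(w^i_{\mathbf t})$ and $Q_i(z^i_{\mathbf t})$ are computed once per multi-index of length $i$. Projections onto $\mathcal Z$ are exact and not counted. *)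

theory Defs
  imports "HOL-Analysis.Analysis" "HOL-Library.Landau_Symbols" "HOL-Library.Set_Algebras"
begin

section \<open>Convex analysis and spectra\<close>

definition subdifferential :: "('a::real_inner \<Rightarrow> real) \<Rightarrow> 'a \<Rightarrow> 'a set" where
  "subdifferential f x = {v. \<forall>u. f x + v \<bullet> (u - x) \<le> f u}"

definition normal_cone :: "'a::real_inner set \<Rightarrow> 'a \<Rightarrow> 'a set" where
  "normal_cone X x = {v. \<forall>u\<in>X. v \<bullet> (u - x) \<le> 0}"

definition eigvals :: "real^'n^'n \<Rightarrow> real set" where
  "eigvals A = {l. \<exists>v. v \<noteq> 0 \<and> A *v v = l *\<^sub>R v}"

definition lambda_min :: "real^'n^'n \<Rightarrow> real" where
  "lambda_min A = Min (eigvals A)"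

definition lambda_max :: "real^'n^'n \<Rightarrow> real" where
  "lambda_max A = Max (eigvals A)"

definition lambda_min_pos :: "real^'n^'n \<Rightarrow> real" where
  "lambda_min_pos A =
     (if {l \<in> eigvals A. l > 0} = {} then 0 else Min {l \<in> eigvals A. l > 0})"

text \<open>The case distinction is needed because \<open>0 powr 0 = 0\<close> in HOL.\<close>

definition holder_bound :: "real \<Rightarrow> real \<Rightarrow> real \<Rightarrow> real" where
  "holder_bound \<nu> H r = (if \<nu> = 0 then H else H * r powr \<nu>)"

definition convex_holder_on ::
  "'a::real_inner set \<Rightarrow> ('a \<Rightarrow> real) \<Rightarrow> real \<Rightarrow> real \<Rightarrow> real \<Rightarrow> bool" where
  "convex_holder_on X f \<mu> \<nu> H \<longleftrightarrow>
     convex_on UNIV f \<and> \<mu> \<ge> 0 \<and> 0 \<le> \<nu> \<and> \<nu> \<le> 1 \<and> H > 0 \<and>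
     (\<forall>x\<in>X. \<forall>x'\<in>X. \<forall>v\<in>subdifferential f x.
        f x' \<ge> f x + v \<bullet> (x' - x) + \<mu> / 2 * (norm (x' - x))\<^sup>2) \<and>
     (\<forall>x\<in>X. \<forall>x'\<in>X. \<forall>v\<in>subdifferential f x. \<forall>v'\<in>subdifferential f x'.
        norm (v - v') \<le> holder_bound \<nu> H (norm (x - x')))"

definition lipschitz_gradient :: "('a::real_inner \<Rightarrow> real) \<Rightarrow> real \<Rightarrow> bool" where
  "lipschitz_gradient f H \<longleftrightarrow>
     (\<exists>G. (\<forall>x. GDERIV f x :> G x) \<and> H-lipschitz_on UNIV G)"


section \<open>The bilinear saddle-point problem\<close>

record ('n, 'm) saddle_problem =
  set_X :: "(real^'n) set"
  set_Y :: "(real^'m) set"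
  fun_f :: "real^'n \<Rightarrow> real"
  fun_g :: "real^'m \<Rightarrow> real"
  mat_B :: "real^'n^'m"
  mu_x :: real
  mu_y :: real
  nu_x :: real
  nu_y :: real
  H_x :: real
  H_y :: real
  L_xy :: real
  mu_xy :: real
  mu_yx :: real

definition payoff :: "('n::finite, 'm::finite) saddle_problem \<Rightarrow> real^'n \<Rightarrow> real^'m \<Rightarrow> real" where
  "payoff p x y = fun_f p x + y \<bullet> (mat_B p *v x) - fun_g p y"

definition set_Z :: "('n::finite, 'm::finite) saddle_problem \<Rightarrow> ((real^'n) \<times> (real^'m)) set" where
  "set_Z p = set_X p \<times> set_Y p"

definition saddle_points ::
  "('n::finite, 'm::finite) saddle_problem \<Rightarrow> ((real^'n) \<times> (real^'m)) set" where
  "saddle_points p = {(x, y). x \<in> set_X p \<and> y \<in> set_Y p \<and>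
     (\<forall>y'\<in>set_Y p. payoff p x y' \<le> payoff p x y) \<and>
     (\<forall>x'\<in>set_X p. payoff p x y \<le> payoff p x' y)}"

definition domains_ok :: "('n::finite, 'm::finite) saddle_problem \<Rightarrow> bool" where
  "domains_ok p \<longleftrightarrow>
     set_X p \<noteq> {} \<and> closed (set_X p) \<and> convex (set_X p) \<and>
     set_Y p \<noteq> {} \<and> closed (set_Y p) \<and> convex (set_Y p)"

definition assumption_A1 :: "('n::finite, 'm::finite) saddle_problem \<Rightarrow> bool" where
  "assumption_A1 p \<longleftrightarrow> convex_holder_on (set_X p) (fun_f p) (mu_x p) (nu_x p) (H_x p)"

definition assumption_A2 :: "('n::finite, 'm::finite) saddle_problem \<Rightarrow> bool" where
  "assumption_A2 p \<longleftrightarrow> convex_holder_on (set_Y p) (fun_g p) (mu_y p) (nu_y p) (H_y p)"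

definition range_cond_x :: "('n::finite, 'm::finite) saddle_problem \<Rightarrow> bool" where
  "range_cond_x p \<longleftrightarrow>
     (\<forall>x\<in>set_X p. subdifferential (fun_f p) x \<subseteq> range (\<lambda>u. transpose (mat_B p) *v u))"

definition range_cond_y :: "('n::finite, 'm::finite) saddle_problem \<Rightarrow> bool" where
  "range_cond_y p \<longleftrightarrow>
     (\<forall>y\<in>set_Y p. subdifferential (fun_g p) y \<subseteq> range (\<lambda>u. mat_B p *v u))"

text \<open>The flags \<open>inv_x\<close> and \<open>inv_y\<close> record whether the range conditions are invoked;
  they reappear in the condition on the starting point below.\<close>

definition assumption_A3 :: "('n::finite, 'm::finite) saddle_problem \<Rightarrow> bool \<Rightarrow> bool \<Rightarrow> bool" where
  "assumption_A3 p inv_x inv_y \<longleftrightarrow>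
     L_xy p > 0 \<and> mu_xy p \<ge> 0 \<and> mu_yx p \<ge> 0 \<and> L_xy p > max (mu_xy p) (mu_yx p) \<and>
     (L_xy p)\<^sup>2 \<ge> lambda_max (transpose (mat_B p) ** mat_B p) \<and>
     (if inv_x
      then range_cond_x p \<and> set_X p + {u. mat_B p *v u = 0} = set_X p \<and>
           (mu_xy p)\<^sup>2 \<le> lambda_min_pos (transpose (mat_B p) ** mat_B p)
      else (mu_xy p)\<^sup>2 \<le> lambda_min (transpose (mat_B p) ** mat_B p)) \<and>
     (if inv_y
      then range_cond_y p \<and> set_Y p + {u. transpose (mat_B p) *v u = 0} = set_Y p \<and>
           (mu_yx p)\<^sup>2 \<le> lambda_min_pos (mat_B p ** transpose (mat_B p))
      else (mu_yx p)\<^sup>2 \<le> lambda_min (mat_B p ** transpose (mat_B p))) \<and>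
     (mu_xy p > 0 \<and> mu_yx p > 0 \<longrightarrow> mu_xy p = mu_yx p)"

definition ambient_smoothness :: "('n::finite, 'm::finite) saddle_problem \<Rightarrow> bool" where
  "ambient_smoothness p \<longleftrightarrow>
     (nu_x p = 1 \<longrightarrow> lipschitz_gradient (fun_f p) (H_x p)) \<and>
     (nu_y p = 1 \<longrightarrow> lipschitz_gradient (fun_g p) (H_y p))"


section \<open>Constants\<close>

text \<open>The constants \<open>L_x\<close>, \<open>L_y\<close> as functions of exponent, Hoelder constant and tolerance.
  For exponent 1 the tolerance is irrelevant, so \<open>beta_x\<close> and \<open>beta_y\<close>, which use \<open>L_y\<close> and
  \<open>L_x\<close> only in that case, do not depend on it.\<close>

definition smooth_const :: "real \<Rightarrow> real \<Rightarrow> real \<Rightarrow> real" where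
  "smooth_const \<nu> H tol =
     (if \<nu> < 1
      then ((1 - \<nu>) / (2 * (1 + \<nu>) * tol)) powr ((1 - \<nu>) / (1 + \<nu>)) * H powr (2 / (1 + \<nu>))
      else H)"

definition beta_x :: "('n::finite, 'm::finite) saddle_problem \<Rightarrow> real" where
  "beta_x p = (if nu_y p = 1 then 1 / (4 * smooth_const (nu_y p) (H_y p) 0) else 0)"

definition beta_y :: "('n::finite, 'm::finite) saddle_problem \<Rightarrow> real" where
  "beta_y p = (if nu_x p = 1 then 1 / (4 * smooth_const (nu_x p) (H_x p) 0) else 0)"

definition delta_x :: "('n::finite, 'm::finite) saddle_problem \<Rightarrow> real" where
  "delta_x p = mu_x p + 4 * beta_x p * (mu_xy p)\<^sup>2"

definition delta_y :: "('n::finite, 'm::finite) saddle_problem \<Rightarrow> real" where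
  "delta_y p = mu_y p + 4 * beta_y p * (mu_yx p)\<^sup>2"

definition kappa_x :: "('n::finite, 'm::finite) saddle_problem \<Rightarrow> real \<Rightarrow> real" where
  "kappa_x p tol = smooth_const (nu_x p) (H_x p) tol / delta_x p"

definition kappa_y :: "('n::finite, 'm::finite) saddle_problem \<Rightarrow> real \<Rightarrow> real" where
  "kappa_y p tol = smooth_const (nu_y p) (H_y p) tol / delta_y p"

definition kappa_xy :: "('n::finite, 'm::finite) saddle_problem \<Rightarrow> real" where
  "kappa_xy p = (L_xy p)\<^sup>2 / (delta_x p * delta_y p)"

definition Htilde_x :: "('n::finite, 'm::finite) saddle_problem \<Rightarrow> real" where
  "Htilde_x p = H_x p * delta_x p powr (- (1 + nu_x p) / 2)"

definition Htilde_y :: "('n::finite, 'm::finite) saddle_problem \<Rightarrow> real" where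
  "Htilde_y p = H_y p * delta_y p powr (- (1 + nu_y p) / 2)"

definition op_P :: "('n::finite, 'm::finite) saddle_problem \<Rightarrow> (real^'n) \<times> (real^'m) \<Rightarrow> (real^'n) \<times> (real^'m)"
  where "op_P p z = (delta_x p *\<^sub>R fst z, delta_y p *\<^sub>R snd z)"

definition sqnorm :: "('z::real_inner \<Rightarrow> 'z) \<Rightarrow> 'z \<Rightarrow> real" where
  "sqnorm P z = P z \<bullet> z"


section \<open>Reference point and merit function\<close>

record ('n, 'm) reference =
  x_star :: "real^'n"
  y_star :: "real^'m"
  f_star :: "real^'n"
  g_star :: "real^'m"
  xi :: "real^'n"
  zeta :: "real^'m"

definition reference_ok ::
  "('n::finite, 'm::finite) saddle_problem \<Rightarrow> bool \<Rightarrow> bool \<Rightarrow> ('n, 'm) reference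
   \<Rightarrow> (real^'n) \<times> (real^'m) \<Rightarrow> bool" where
  "reference_ok p inv_x inv_y r z0 \<longleftrightarrow>
     (x_star r, y_star r) \<in> saddle_points p \<and>
     (inv_x \<longrightarrow> fst z0 - x_star r \<in> range (\<lambda>u. transpose (mat_B p) *v u)) \<and>
     (inv_y \<longrightarrow> snd z0 - y_star r \<in> range (\<lambda>u. mat_B p *v u)) \<and>
     f_star r \<in> subdifferential (fun_f p) (x_star r) \<and>
     g_star r \<in> subdifferential (fun_g p) (y_star r) \<and>
     xi r \<in> normal_cone (set_X p) (x_star r) \<and>
     zeta r \<in> normal_cone (set_Y p) (y_star r) \<and>
     f_star r + transpose (mat_B p) *v y_star r + xi r = 0 \<and>
     g_star r - mat_B p *v x_star r + zeta r = 0"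

definition bregman :: "('a::real_inner \<Rightarrow> real) \<Rightarrow> 'a \<Rightarrow> 'a \<Rightarrow> 'a \<Rightarrow> real" where
  "bregman f v u x = f x - f u - v \<bullet> (x - u)"

definition Psi ::
  "('n::finite, 'm::finite) saddle_problem \<Rightarrow> ('n, 'm) reference \<Rightarrow> (real^'n) \<times> (real^'m) \<Rightarrow> real" where
  "Psi p r z = sqnorm (op_P p) (z - (x_star r, y_star r))
     + 12 * bregman (fun_f p) (f_star r) (x_star r) (fst z)
     + 12 * bregman (fun_g p) (g_star r) (y_star r) (snd z)"


section \<open>The Sliding Algorithm\<close>

primrec alpha :: "nat \<Rightarrow> real" where
  "alpha 0 = 1"
| "alpha (Suc t) = 2 / (1 + sqrt (1 + 4 / (alpha t)\<^sup>2))"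

text \<open>Multi-indices are lists; the superscript of an iterate is the length of its multi-index.
  The oracle \<open>grad\<close> is told the multi-index of the query, so that repeated queries at the same
  point may be answered by different subgradients.\<close>

record 'z level =
  grad :: "nat list \<Rightarrow> 'z \<Rightarrow> 'z"
  opQ :: "'z \<Rightarrow> 'z"
  const_L :: real
  const_M :: real
  loops :: nat

text \<open>Iterates \<open>zc\<close> and averages \<open>zb\<close> (the barred ones), the stored oracle vectors \<open>gv\<close> (at the
  search points) and operator values \<open>qv\<close> (at the iterates), and the numbers of evaluations of
  \<open>grad\<close> and \<open>opQ\<close> performed at each level.\<close>

record 'z run =
  zc :: "nat list \<Rightarrow> 'z"
  zb :: "nat list \<Rightarrow> 'z"
  gv :: "nat list \<Rightarrow> 'z"
  qv :: "nat list \<Rightarrow> 'z"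
  n_grad :: "nat \<Rightarrow> nat"
  n_op :: "nat \<Rightarrow> nat"

definition eta :: "(nat \<Rightarrow> 'z level) \<Rightarrow> nat list \<Rightarrow> real" where
  "eta lev t =
     const_L (lev (length t)) * (\<Prod>l=1..length t. alpha (t ! (l - 1))) +
     const_M (lev (length t)) *
       (\<Prod>l=1..length t. alpha (t ! (l - 1)) / alpha (loops (lev l) - 1))"

definition search_point ::
  "(nat list \<Rightarrow> 'z::real_inner) \<Rightarrow> nat list \<Rightarrow> 'z \<Rightarrow> 'z" where
  "search_point b t z =
     foldr (\<lambda>l v. alpha (t ! (l - 1)) *\<^sub>R v + (1 - alpha (t ! (l - 1))) *\<^sub>R b (take l t))
       [1..<Suc (length t)] z"

definition pad :: "nat \<Rightarrow> nat list \<Rightarrow> nat list" where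
  "pad l t = t @ replicate (l - length t) 0"

definition evaluate :: "(nat \<Rightarrow> 'z::real_inner level) \<Rightarrow> nat list \<Rightarrow> 'z run \<Rightarrow> 'z run" where
  "evaluate lev t \<sigma> = (let k = length t in
     \<sigma>\<lparr> gv := (gv \<sigma>)(t := grad (lev k) t (search_point (zb \<sigma>) t (zc \<sigma> t))),
        qv := (qv \<sigma>)(t := opQ (lev k) (zc \<sigma> t)),
        n_grad := (n_grad \<sigma>)(k := n_grad \<sigma> k + 1),
        n_op := (n_op \<sigma>)(k := n_op \<sigma> k + 1) \<rparr>)"

definition leaf ::
  "'z::real_inner set \<Rightarrow> ('z \<Rightarrow> 'z) \<Rightarrow> (nat \<Rightarrow> 'z level) \<Rightarrow> nat list \<Rightarrow> 'z run \<Rightarrow> 'z" where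
  "leaf Z P lev t \<sigma> = arg_min_on
     (\<lambda>z. \<Sum>i=1..length t.
        (gv \<sigma> (take i t) + qv \<sigma> (take i t)) \<bullet> z
        + 1/2 * eta lev (take i t) * sqnorm P (z - zc \<sigma> (take i t))) Z"

text \<open>Iteration \<open>j\<close> of the loop of \<open>Rec(k, t)\<close> with \<open>k = length t\<close>; the argument \<open>rc\<close> stands for
  \<open>Rec(k + 1, _)\<close>. The quantities that are computed once per multi-index are computed as soon as
  the iterate with that multi-index is available.\<close>

definition advance ::
  "nat \<Rightarrow> 'z::real_inner set \<Rightarrow> ('z \<Rightarrow> 'z) \<Rightarrow> (nat \<Rightarrow> 'z level)
   \<Rightarrow> (nat list \<Rightarrow> 'z run \<Rightarrow> 'z \<times> 'z run) \<Rightarrow> nat list \<Rightarrow> nat \<Rightarrow> 'z run \<Rightarrow> 'z run" where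
  "advance n Z P lev rc t j \<sigma> =
     (let k = length t; t1 = t @ [j]; t2 = t @ [j + 1];
          (v, \<sigma>1) = rc t1 (evaluate lev t1 \<sigma>);
          q = opQ (lev (k + 1)) v;
          \<sigma>2 = \<sigma>1\<lparr> zb := (zb \<sigma>1)(t2 := alpha j *\<^sub>R v + (1 - alpha j) *\<^sub>R zb \<sigma>1 t1),
                   zc := (zc \<sigma>1)(t2 := arg_min_on
                     (\<lambda>z. (q - qv \<sigma>1 t1) \<bullet> z + 1/2 * eta lev t1 * sqnorm P (z - v)) Z),
                   n_op := (n_op \<sigma>1)(k + 1 := n_op \<sigma>1 (k + 1) + 1) \<rparr>
      in \<sigma>2\<lparr> zc := fold (\<lambda>l h. h(pad l t2 := h (pad l (t1 @ [loops (lev (k + 2))]))))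
                     [k + 2..<Suc n] (zc \<sigma>2) \<rparr>)"

text \<open>\<open>slide_rec n Z P lev m t\<close> is \<open>Rec(n - m, t)\<close>, where \<open>length t = n - m\<close>.\<close>

primrec slide_rec ::
  "nat \<Rightarrow> 'z::real_inner set \<Rightarrow> ('z \<Rightarrow> 'z) \<Rightarrow> (nat \<Rightarrow> 'z level) \<Rightarrow> nat
   \<Rightarrow> nat list \<Rightarrow> 'z run \<Rightarrow> 'z \<times> 'z run" where
  "slide_rec n Z P lev 0 = (\<lambda>t \<sigma>. (leaf Z P lev t \<sigma>, \<sigma>))"
| "slide_rec n Z P lev (Suc m) = (\<lambda>t \<sigma>.
     let T = loops (lev (length t + 1));
         \<sigma>0 = \<sigma>\<lparr> zb := (zb \<sigma>)(t @ [0] := zc \<sigma> (t @ [0])) \<rparr>;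
         \<sigma>' = fold (advance n Z P lev (slide_rec n Z P lev m) t) [0..<T] \<sigma>0
     in (zb \<sigma>' (t @ [T]), \<sigma>'))"

definition start_run :: "'z \<Rightarrow> 'z run" where
  "start_run z_in =
     \<lparr> zc = (\<lambda>t. if set t \<subseteq> {0} then z_in else undefined),
       zb = (\<lambda>_. undefined), gv = (\<lambda>_. undefined), qv = (\<lambda>_. undefined),
       n_grad = (\<lambda>_. 0), n_op = (\<lambda>_. 0) \<rparr>"

definition sliding ::
  "nat \<Rightarrow> 'z::real_inner set \<Rightarrow> ('z \<Rightarrow> 'z) \<Rightarrow> (nat \<Rightarrow> 'z level) \<Rightarrow> 'z \<Rightarrow> 'z \<times> 'z run" where
  "sliding n Z P lev z_in = slide_rec n Z P lev n [] (start_run z_in)"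


section \<open>One stage\<close>

definition budget :: "('n::finite, 'm::finite) saddle_problem \<Rightarrow> real \<Rightarrow> nat \<Rightarrow> real" where
  "budget p \<Omega> i =
     (if i = 1 then max (Htilde_x p powr (2 / (1 + 3 * nu_x p))
                         * \<Omega> powr ((nu_x p - 1) / (1 + 3 * nu_x p))) 1
      else if i = 2 then max (Htilde_y p powr (2 / (1 + 3 * nu_y p))
                         * \<Omega> powr ((nu_y p - 1) / (1 + 3 * nu_y p))) 1
      else max (sqrt (kappa_xy p)) 1)"

definition sorting_perm :: "(nat \<Rightarrow> real) \<Rightarrow> (nat \<Rightarrow> nat) \<Rightarrow> bool" where
  "sorting_perm R \<pi> \<longleftrightarrow>
     \<pi> permutes {1, 2, 3} \<and> R (\<pi> 1) \<le> R (\<pi> 2) \<and> R (\<pi> 2) \<le> R (\<pi> 3)"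

text \<open>A value from which on the absolute constant \<open>c\<close> in the loop counts is large enough. It is
  given explicitly because an existentially quantified threshold in a theorem about
  \<open>real^'n\<close> and \<open>real^'m\<close> could depend on the dimensions.\<close>

definition c_min :: real where
  "c_min = 10 ^ 9"

definition loop_count :: "real \<Rightarrow> real \<Rightarrow> nat \<Rightarrow> nat" where
  "loop_count c R a = max 1 (nat \<lceil>c * R / real a\<rceil>)"

primrec cum_loops :: "real \<Rightarrow> (nat \<Rightarrow> real) \<Rightarrow> (nat \<Rightarrow> nat) \<Rightarrow> nat \<Rightarrow> nat" where
  "cum_loops c R \<pi> 0 = 1"
| "cum_loops c R \<pi> (Suc i) =
     cum_loops c R \<pi> i * loop_count c (R (\<pi> (Suc i))) (cum_loops c R \<pi> i)"

definition tolerance :: "real \<Rightarrow> real \<Rightarrow> nat \<Rightarrow> real" where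
  "tolerance \<nu> \<Omega> a = (if \<nu> < 1 then \<Omega> / (384 * real a) else 0)"

definition comp_p1 :: "('n::finite, 'm::finite) saddle_problem \<Rightarrow> (real^'n) \<times> (real^'m) \<Rightarrow> real" where
  "comp_p1 p z = fun_f p (fst z)"

definition comp_p2 :: "('n::finite, 'm::finite) saddle_problem \<Rightarrow> (real^'n) \<times> (real^'m) \<Rightarrow> real" where
  "comp_p2 p z = fun_g p (snd z)"

text \<open>The arguments \<open>v\<close> and \<open>w\<close> stand for the (sub)gradients of \<open>f\<close> and \<open>g\<close> at the stage input.\<close>

definition comp_p3 ::
  "('n::finite, 'm::finite) saddle_problem \<Rightarrow> real^'n \<Rightarrow> real^'m \<Rightarrow> (real^'n) \<times> (real^'m) \<Rightarrow> real" where
  "comp_p3 p v w z =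
     beta_x p / 2 * (norm (mat_B p *v fst z - w))\<^sup>2 +
     beta_y p / 2 * (norm (transpose (mat_B p) *v snd z + v))\<^sup>2"

definition grad_p3 ::
  "('n::finite, 'm::finite) saddle_problem \<Rightarrow> real^'n \<Rightarrow> real^'m
   \<Rightarrow> (real^'n) \<times> (real^'m) \<Rightarrow> (real^'n) \<times> (real^'m)" where
  "grad_p3 p v w z =
     (beta_x p *\<^sub>R (transpose (mat_B p) *v (mat_B p *v fst z - w)),
      beta_y p *\<^sub>R (mat_B p *v (transpose (mat_B p) *v snd z + v)))"

text \<open>The three pairs, with \<open>fo\<close> and \<open>go\<close> answering the subgradient queries for \<open>f\<close> and \<open>g\<close>; the
  subgradients at the stage input are queried with the empty multi-index. The argument \<open>T\<close> is
  the loop count of the level to which the pair is assigned.\<close>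

definition component ::
  "('n::finite, 'm::finite) saddle_problem \<Rightarrow> real \<Rightarrow> real
   \<Rightarrow> (nat list \<Rightarrow> real^'n \<Rightarrow> real^'n) \<Rightarrow> (nat list \<Rightarrow> real^'m \<Rightarrow> real^'m)
   \<Rightarrow> (real^'n) \<times> (real^'m) \<Rightarrow> nat \<Rightarrow> nat \<Rightarrow> ((real^'n) \<times> (real^'m)) level" where
  "component p tol_f tol_g fo go z_in T i =
     (if i = 1 then
        \<lparr> grad = (\<lambda>t z. (fo t (fst z), 0)), opQ = (\<lambda>z. 0),
          const_L = kappa_x p tol_f, const_M = 0, loops = T \<rparr>
      else if i = 2 then
        \<lparr> grad = (\<lambda>t z. (0, go t (snd z))), opQ = (\<lambda>z. 0),
          const_L = kappa_y p tol_g, const_M = 0, loops = T \<rparr>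
      else
        \<lparr> grad = (\<lambda>t z. grad_p3 p (fo [] (fst z_in)) (go [] (snd z_in)) z),
          opQ = (\<lambda>z. (transpose (mat_B p) *v snd z, - (mat_B p *v fst z))),
          const_L = kappa_xy p, const_M = sqrt (kappa_xy p), loops = T \<rparr>)"

definition stage ::
  "('n::finite, 'm::finite) saddle_problem \<Rightarrow> real \<Rightarrow> (nat \<Rightarrow> nat) \<Rightarrow> real
   \<Rightarrow> (nat list \<Rightarrow> real^'n \<Rightarrow> real^'n) \<Rightarrow> (nat list \<Rightarrow> real^'m \<Rightarrow> real^'m)
   \<Rightarrow> (real^'n) \<times> (real^'m) \<Rightarrow> ((real^'n) \<times> (real^'m)) \<times> ((real^'n) \<times> (real^'m)) run" where
  "stage p c \<pi> \<Omega> fo go z_in =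
     (let A = cum_loops c (budget p \<Omega>) \<pi>;
          tol_f = tolerance (nu_x p) \<Omega> (A (inv \<pi> 1));
          tol_g = tolerance (nu_y p) \<Omega> (A (inv \<pi> 2));
          lev = (\<lambda>i. component p tol_f tol_g fo go z_in
                       (loop_count c (budget p \<Omega> (\<pi> i)) (A (i - 1))) (\<pi> i))
      in sliding 3 (set_Z p) (op_P p) lev z_in)"

text \<open>The next three lemmas confirm that the oracle vectors in \<open>component\<close> are (sub)gradients.\<close>

lemma subgradient_comp_p1:
  "v \<in> subdifferential (fun_f p) (fst z) \<Longrightarrow> (v, 0) \<in> subdifferential (comp_p1 p) z"
  by (auto simp: subdifferential_def comp_p1_def inner_prod_def)

lemma subgradient_comp_p2:
  "w \<in> subdifferential (fun_g p) (snd z) \<Longrightarrow> (0, w) \<in> subdifferential (comp_p2 p) z"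
  by (auto simp: subdifferential_def comp_p2_def inner_prod_def)

lemma gradient_comp_p3: "GDERIV (comp_p3 p v w) z :> grad_p3 p v w z"
proof -
  have 1: "((\<lambda>z. mat_B p *v fst z - w) has_derivative (\<lambda>h. mat_B p *v fst h)) (at z)"
    by (auto intro!: derivative_eq_intros
        bounded_linear.has_derivative[OF matrix_vector_mul_bounded_linear])
  have 2: "((\<lambda>z. transpose (mat_B p) *v snd z + v) has_derivative
      (\<lambda>h. transpose (mat_B p) *v snd h)) (at z)"
    by (rule derivative_eq_intros refl
        bounded_linear.has_derivative[OF matrix_vector_mul_bounded_linear])+ simp
  have adj: "a \<bullet> (mat_B p *v b) = b \<bullet> (transpose (mat_B p) *v a)" for a b
    by (metis dot_lmul_matrix inner_commute transpose_matrix_vector)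
  have 3: "(comp_p3 p v w has_derivative (\<lambda>h.
      beta_x p * ((mat_B p *v fst z - w) \<bullet> (mat_B p *v fst h)) +
      beta_y p * ((transpose (mat_B p) *v snd z + v) \<bullet> (transpose (mat_B p) *v snd h)))) (at z)"
    unfolding comp_p3_def[abs_def] power2_norm_eq_inner
    by (rule derivative_eq_intros 1 2 refl)+ (simp add: inner_commute algebra_simps)
  show ?thesis
    unfolding gderiv_def grad_p3_def inner_prod_def
    by (rule has_derivative_eq_rhs[OF 3])
       (simp add: fun_eq_iff inner_commute adj[symmetric] del: transpose_matrix_vector,
        simp add: adj inner_commute)
qed


section \<open>The restarted algorithm and its oracle complexity\<close>

definition Omega :: "real \<Rightarrow> nat \<Rightarrow> real" where
  "Omega \<Psi>0 s = (3/4) ^ s * \<Psi>0"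

text \<open>The stage index is an additional argument of the permutation and of the oracles.\<close>

primrec restart_iter ::
  "('n::finite, 'm::finite) saddle_problem \<Rightarrow> real \<Rightarrow> (nat \<Rightarrow> nat \<Rightarrow> nat)
   \<Rightarrow> (nat \<Rightarrow> nat list \<Rightarrow> real^'n \<Rightarrow> real^'n) \<Rightarrow> (nat \<Rightarrow> nat list \<Rightarrow> real^'m \<Rightarrow> real^'m)
   \<Rightarrow> real \<Rightarrow> (real^'n) \<times> (real^'m) \<Rightarrow> nat \<Rightarrow> (real^'n) \<times> (real^'m)" where
  "restart_iter p c \<pi> fo go \<Psi>0 z0 0 = z0"
| "restart_iter p c \<pi> fo go \<Psi>0 z0 (Suc s) =
     fst (stage p c (\<pi> s) (Omega \<Psi>0 s) (fo s) (go s) (restart_iter p c \<pi> fo go \<Psi>0 z0 s))"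

definition stage_run ::
  "('n::finite, 'm::finite) saddle_problem \<Rightarrow> real \<Rightarrow> (nat \<Rightarrow> nat \<Rightarrow> nat)
   \<Rightarrow> (nat \<Rightarrow> nat list \<Rightarrow> real^'n \<Rightarrow> real^'n) \<Rightarrow> (nat \<Rightarrow> nat list \<Rightarrow> real^'m \<Rightarrow> real^'m)
   \<Rightarrow> real \<Rightarrow> (real^'n) \<times> (real^'m) \<Rightarrow> nat \<Rightarrow> ((real^'n) \<times> (real^'m)) run" where
  "stage_run p c \<pi> fo go \<Psi>0 z0 s =
     snd (stage p c (\<pi> s) (Omega \<Psi>0 s) (fo s) (go s) (restart_iter p c \<pi> fo go \<Psi>0 z0 s))"

definition num_restarts :: "real \<Rightarrow> real \<Rightarrow> nat" where
  "num_restarts \<Psi>0 \<epsilon> = nat \<lceil>ln (\<Psi>0 / \<epsilon>) / ln (4/3)\<rceil>"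

text \<open>Per stage, \<open>f'\<close> and \<open>g'\<close> are additionally evaluated once, at the stage input, to form the
  third pair.\<close>

definition f_evals ::
  "('n::finite, 'm::finite) saddle_problem \<Rightarrow> real \<Rightarrow> (nat \<Rightarrow> nat \<Rightarrow> nat)
   \<Rightarrow> (nat \<Rightarrow> nat list \<Rightarrow> real^'n \<Rightarrow> real^'n) \<Rightarrow> (nat \<Rightarrow> nat list \<Rightarrow> real^'m \<Rightarrow> real^'m)
   \<Rightarrow> real \<Rightarrow> (real^'n) \<times> (real^'m) \<Rightarrow> real \<Rightarrow> nat" where
  "f_evals p c \<pi> fo go \<Psi>0 z0 \<epsilon> =
     (\<Sum>s<num_restarts \<Psi>0 \<epsilon>. n_grad (stage_run p c \<pi> fo go \<Psi>0 z0 s) (inv (\<pi> s) 1) + 1)"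

definition g_evals ::
  "('n::finite, 'm::finite) saddle_problem \<Rightarrow> real \<Rightarrow> (nat \<Rightarrow> nat \<Rightarrow> nat)
   \<Rightarrow> (nat \<Rightarrow> nat list \<Rightarrow> real^'n \<Rightarrow> real^'n) \<Rightarrow> (nat \<Rightarrow> nat list \<Rightarrow> real^'m \<Rightarrow> real^'m)
   \<Rightarrow> real \<Rightarrow> (real^'n) \<times> (real^'m) \<Rightarrow> real \<Rightarrow> nat" where
  "g_evals p c \<pi> fo go \<Psi>0 z0 \<epsilon> =
     (\<Sum>s<num_restarts \<Psi>0 \<epsilon>. n_grad (stage_run p c \<pi> fo go \<Psi>0 z0 s) (inv (\<pi> s) 2) + 1)"

text \<open>Four products with \<open>B\<close> or its transpose in \<open>grad_p3\<close>, two in the operator of the third pair.\<close>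

definition B_products ::
  "('n::finite, 'm::finite) saddle_problem \<Rightarrow> real \<Rightarrow> (nat \<Rightarrow> nat \<Rightarrow> nat)
   \<Rightarrow> (nat \<Rightarrow> nat list \<Rightarrow> real^'n \<Rightarrow> real^'n) \<Rightarrow> (nat \<Rightarrow> nat list \<Rightarrow> real^'m \<Rightarrow> real^'m)
   \<Rightarrow> real \<Rightarrow> (real^'n) \<times> (real^'m) \<Rightarrow> real \<Rightarrow> nat" where
  "B_products p c \<pi> fo go \<Psi>0 z0 \<epsilon> =
     (\<Sum>s<num_restarts \<Psi>0 \<epsilon>. 4 * n_grad (stage_run p c \<pi> fo go \<Psi>0 z0 s) (inv (\<pi> s) 3)
                          + 2 * n_op (stage_run p c \<pi> fo go \<Psi>0 z0 s) (inv (\<pi> s) 3))"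

text \<open>Soft-O as \<open>\<epsilon>\<close> tends to 0 from above, hiding a power of \<open>ln (\<Psi>0 / \<epsilon>)\<close>.\<close>

definition soft_bigo :: "real \<Rightarrow> (real \<Rightarrow> real) \<Rightarrow> (real \<Rightarrow> real) set" where
  "soft_bigo \<Psi>0 h = {N. \<exists>k::nat. N \<in> O[at_right 0](\<lambda>\<epsilon>. h \<epsilon> * ln (\<Psi>0 / \<epsilon>) ^ k)}"

end

theory Submission
  imports Defs "HOL-Library.Sublist"
begin

text \<open>
  Everything rests on one inequality for the sliding algorithm, \<open>sliding_correct\<close>: for \<open>n\<close> pairs
  and every feasible \<open>u\<close>, the gap of the output is at most a weighted squared distance from the
  starting point to \<open>u\<close> plus the accumulated inexactness. The weight of a pair is about
  \<open>L / A\<^sup>2 + M / A\<close>, where \<open>A\<close> is the number of evaluations made of that pair, and the inexactness of a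
  Hoelder component is its tolerance times \<open>A\<close>. The proof is an induction over the recursion. Each
  loop is an accelerated gradient method whose proximal step is solved by the next loop: the smooth
  part telescopes by the recursion for \<open>alpha\<close> (\<open>accelerated_step\<close>), the operator part by the
  extragradient correction (\<open>extragradient_step\<close>), and the levels further inside are carried along
  by convexity, since an inner loop sees their components through an averaging map
  (\<open>level_gap_inner\<close>). The loop invariant \<open>loop_inv\<close> combines the three.

  With the saddle point as \<open>u\<close>, the gap contains the two Bregman distances and the increase of the
  third component. By cocoercivity of the gradients and the spectral bounds for \<open>B\<close>, this increase
  is at least a fixed fraction of the part of the squared distance that strong convexity does not
  supply, minus at most half of the Bregman distances at the stage input (\<open>p3_increase\<close>). The
  constants in \<open>Psi\<close> and \<open>c_min\<close> turn this into a contraction by 3/4 per stage (\<open>stage_contraction\<close>).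

  The bounds for \<open>B\<close> hold only in directions orthogonal to its kernel when a range condition is
  invoked. The iterates keep their errors in these directions: all oracle vectors lie there and the
  feasible sets are invariant along the kernels, so every proximal step stays in the affine space
  (\<open>quad_argmin_affine\<close>).

  For the cost, level \<open>i\<close> is evaluated \<open>A i\<close> times per stage, which sorting the budgets keeps within
  a constant multiple of the budget of its pair. Below exponent 1 the budgets grow geometrically from
  stage to stage, so the last stage dominates; otherwise they are bounded and the number of stages
  supplies the logarithm.
\<close>

section \<open>The step sizes\<close>

lemma alpha_pos: "alpha t > 0"
  by (induction t) (auto intro!: divide_pos_pos add_pos_nonneg)

lemma inverse_alpha_Suc: "1 / alpha (Suc t) = (1 + sqrt (1 + 4 * (1 / alpha t)\<^sup>2)) / 2"
  by (simp add: power_divide)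

text \<open>With \<open>a\<close> and \<open>b\<close> the reciprocals of two successive step sizes, \<open>b\<close> is the positive root of
  \<open>b\<^sup>2 - b = a\<^sup>2\<close>.\<close>

lemma alpha_recursion: "(1 - alpha (Suc t)) / (alpha (Suc t))\<^sup>2 = 1 / (alpha t)\<^sup>2"
proof -
  define a b where "a = 1 / alpha t" and "b = 1 / alpha (Suc t)"
  have "b = (1 + sqrt (1 + 4 * a\<^sup>2)) / 2"
    unfolding a_def b_def by (rule inverse_alpha_Suc)
  then have "2 * b - 1 = sqrt (1 + 4 * a\<^sup>2)" by simp
  then have "(2 * b - 1)\<^sup>2 = 1 + 4 * a\<^sup>2" by simp
  then have "b\<^sup>2 - b = a\<^sup>2" by (simp add: power2_eq_square algebra_simps)
  then show ?thesis
    using alpha_pos[of "Suc t"] unfolding a_def b_def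
    by (simp add: power_divide diff_divide_distrib power2_eq_square del: alpha.simps)
qed

lemma inverse_alpha_ge: "1 / alpha t \<ge> 1 + real t / 2"
proof (induction t)
  case (Suc t)
  have "sqrt (1 + 4 * (1 / alpha t)\<^sup>2) \<ge> 2 * (1 / alpha t)"
    by (rule real_le_rsqrt) (simp add: power2_eq_square)
  then have "1 / alpha (Suc t) \<ge> (1 + 2 * (1 / alpha t)) / 2"
    unfolding inverse_alpha_Suc by (intro divide_right_mono add_left_mono) auto
  moreover have "(1 + 2 * x) / 2 \<ge> 1 + (1 + real t) / 2" if "x \<ge> 1 + real t / 2" for x
    using that by (simp add: field_simps)
  ultimately show ?case using Suc.IH unfolding of_nat_Suc by (meson order.trans)
qed simp

lemma alpha_le_1: "alpha t \<le> 1"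
proof -
  have "1 \<le> 1 / alpha t" using inverse_alpha_ge[of t] by linarith
  then show ?thesis using alpha_pos[of t] by (simp add: le_divide_eq)
qed

lemma alpha_decreasing: "s \<le> t \<Longrightarrow> alpha t \<le> alpha s"
proof (induction t rule: dec_induct)
  case (step t)
  have "1 / alpha t \<le> (1 + sqrt (1 + 4 * (1 / alpha t)\<^sup>2)) / 2"
    using real_le_rsqrt[of "2 * (1 / alpha t)" "1 + 4 * (1 / alpha t)\<^sup>2"]
    by (simp add: power2_eq_square)
  then have "1 / alpha t \<le> 1 / alpha (Suc t)"
    unfolding inverse_alpha_Suc .
  then have "alpha (Suc t) \<le> alpha t"
    using alpha_pos[of t] alpha_pos[of "Suc t"] by (simp add: field_simps del: alpha.simps)
  with step show ?case by (simp del: alpha.simps)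
qed simp

lemma alpha_last_le: "T \<ge> 1 \<Longrightarrow> alpha (T - 1) \<le> 2 / real T"
  using inverse_alpha_ge[of "T - 1"] alpha_pos[of "T - 1"]
  by (simp add: field_simps of_nat_diff)

text \<open>Total weight of the first \<open>j\<close> iterations of a loop, in which iteration \<open>i\<close> has weight
  \<open>1 / alpha i\<close>: the recursion for \<open>alpha\<close> makes these weights add up to \<open>1 / (alpha (j - 1))\<^sup>2\<close>.\<close>

definition cum_weight :: "nat \<Rightarrow> real" where
  "cum_weight j = (if j = 0 then 0 else 1 / (alpha (j - 1))\<^sup>2)"

lemma cum_weight_Suc: "cum_weight (Suc j) = 1 / (alpha j)\<^sup>2"
  by (simp add: cum_weight_def)

lemma cum_weight_contract: "(1 - alpha j) / (alpha j)\<^sup>2 = cum_weight j"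
  by (cases j) (use alpha_recursion in \<open>auto simp: cum_weight_def simp del: alpha.simps(2)\<close>)


section \<open>Quadratic subproblems\<close>

locale metric_operator =
  fixes P :: "'z::euclidean_space \<Rightarrow> 'z"
  assumes linear_P: "linear P"
    and sym_P: "P a \<bullet> b = a \<bullet> P b"
    and pos_P: "\<exists>d>0. \<forall>a. d * (norm a)\<^sup>2 \<le> sqnorm P a"
begin

lemma sqnorm_nonneg: "sqnorm P a \<ge> 0"
  using pos_P by (metis mult_nonneg_nonneg order.trans zero_le_power2 less_imp_le)

lemma sqnorm_eq_0_iff: "sqnorm P a = 0 \<longleftrightarrow> a = 0"
proof
  assume a: "sqnorm P a = 0"
  obtain d where "d > 0" "d * (norm a)\<^sup>2 \<le> sqnorm P a" using pos_P by blast
  then have "(norm a)\<^sup>2 \<le> 0" using a by (simp add: mult_le_0_iff)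
  then show "a = 0" by simp
qed (simp add: sqnorm_def)

lemma sqnorm_add: "sqnorm P (a + b) = sqnorm P a + 2 * (P a \<bullet> b) + sqnorm P b"
  using sym_P[of a b]
  by (simp add: sqnorm_def linear_add[OF linear_P] inner_add inner_commute)

lemma sqnorm_scaleR: "sqnorm P (s *\<^sub>R a) = s\<^sup>2 * sqnorm P a"
  by (simp add: sqnorm_def linear_scale[OF linear_P] power2_eq_square)

lemma sqnorm_minus_commute: "sqnorm P (a - b) = sqnorm P (b - a)"
  using sqnorm_scaleR[of "-1" "a - b"] by simp

lemma sqnorm_diff: "sqnorm P (a - b) = sqnorm P a - 2 * (P a \<bullet> b) + sqnorm P b"
  using sqnorm_add[of a "- b"] sqnorm_scaleR[of "-1" b] by simp

lemma sqnorm_convex_combination: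
  "sqnorm P ((1 - s) *\<^sub>R a + s *\<^sub>R b) = (1 - s) * sqnorm P a + s * sqnorm P b
     - s * (1 - s) * sqnorm P (a - b)"
  by (simp add: sqnorm_add sqnorm_diff sqnorm_scaleR linear_scale[OF linear_P])
     (simp add: algebra_simps power2_eq_square)

definition quad :: "'i set \<Rightarrow> ('i \<Rightarrow> 'z) \<Rightarrow> ('i \<Rightarrow> real) \<Rightarrow> ('i \<Rightarrow> 'z) \<Rightarrow> 'z \<Rightarrow> real" where
  "quad I b h a z = (\<Sum>i\<in>I. b i \<bullet> z + 1/2 * h i * sqnorm P (z - a i))"

definition quad_grad :: "'i set \<Rightarrow> ('i \<Rightarrow> 'z) \<Rightarrow> ('i \<Rightarrow> real) \<Rightarrow> ('i \<Rightarrow> 'z) \<Rightarrow> 'z \<Rightarrow> 'z" where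
  "quad_grad I b h a z = (\<Sum>i\<in>I. b i + h i *\<^sub>R P (z - a i))"

text \<open>For a quadratic the second-order expansion is exact; convexity, growth and the optimality condition
  below are all read off from it.\<close>

lemma quad_expansion:
  "quad I b h a u = quad I b h a z + quad_grad I b h a z \<bullet> (u - z)
     + (\<Sum>i\<in>I. h i) / 2 * sqnorm P (u - z)"
proof -
  have "b i \<bullet> u + 1/2 * h i * sqnorm P (u - a i) = (b i \<bullet> z + 1/2 * h i * sqnorm P (z - a i))
      + (b i + h i *\<^sub>R P (z - a i)) \<bullet> (u - z) + h i * (1/2 * sqnorm P (u - z))" for i
  proof -
    have "u - a i = (z - a i) + (u - z)" by simp
    then have "sqnorm P (u - a i)
        = sqnorm P (z - a i) + 2 * (P (z - a i) \<bullet> (u - z)) + sqnorm P (u - z)"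
      using sqnorm_add by metis
    then have "1/2 * h i * sqnorm P (u - a i) = 1/2 * h i
        * (sqnorm P (z - a i) + 2 * (P (z - a i) \<bullet> (u - z)) + sqnorm P (u - z))"
      by simp
    then show ?thesis by (simp add: inner_add_left inner_diff_right algebra_simps)
  qed
  then have "quad I b h a u = (\<Sum>i\<in>I. (b i \<bullet> z + 1/2 * h i * sqnorm P (z - a i))
      + (b i + h i *\<^sub>R P (z - a i)) \<bullet> (u - z) + h i * (1/2 * sqnorm P (u - z)))"
    unfolding quad_def by (rule sum.cong[OF refl])
  also have "\<dots> = (\<Sum>i\<in>I. b i \<bullet> z + 1/2 * h i * sqnorm P (z - a i))
      + (\<Sum>i\<in>I. (b i + h i *\<^sub>R P (z - a i)) \<bullet> (u - z)) + (\<Sum>i\<in>I. h i * (1/2 * sqnorm P (u - z)))"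
    by (simp only: sum.distrib)
  also have "(\<Sum>i\<in>I. h i * (1/2 * sqnorm P (u - z))) = (\<Sum>i\<in>I. h i) / 2 * sqnorm P (u - z)"
    by (simp add: sum_distrib_right sum_divide_distrib)
  finally show ?thesis by (simp only: quad_def quad_grad_def inner_sum_left)
qed

text \<open>The minimizer exists by coercivity; in the optimality condition the quadratic growth of the
  objective survives as the term with \<open>sqnorm P (u - zs)\<close>.\<close>

lemma quad_argmin:
  fixes a b :: "'i \<Rightarrow> 'z"
  assumes Z: "closed Z" "convex Z" "Z \<noteq> {}" and h: "(\<Sum>i\<in>I. h i) > 0"
  defines "zs \<equiv> arg_min_on (quad I b h a) Z"
  shows "zs \<in> Z"
    and "u \<in> Z \<Longrightarrow> quad_grad I b h a zs \<bullet> (u - zs) \<ge> 0"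
    and "u \<in> Z \<Longrightarrow> quad I b h a zs + (\<Sum>i\<in>I. h i) / 2 * sqnorm P (u - zs) \<le> quad I b h a u"
proof -
  let ?q = "quad I b h a" and ?H = "\<Sum>i\<in>I. h i"
  obtain z0 where z0: "z0 \<in> Z" using Z by blast
  obtain d where d: "d > 0" "\<And>a. d * (norm a)\<^sup>2 \<le> sqnorm P a" using pos_P by blast
  define g where "g = quad_grad I b h a z0"
  (* Outside the ball of this radius the quadratic growth exceeds the linear term. *)
  define R where "R = 2 * norm g / (?H * d)"
  have R: "R \<ge> 0" using h d by (simp add: R_def)
  have cont: "continuous_on S ?q" for S
    unfolding quad_def sqnorm_def
    by (intro continuous_intros linear_continuous_on_compose[OF _ linear_P])
  have "compact (Z \<inter> cball z0 R)" using Z by (simp add: closed_Int_compact)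
  moreover have "Z \<inter> cball z0 R \<noteq> {}" using z0 R by auto
  ultimately obtain x where x: "x \<in> Z \<inter> cball z0 R" "\<And>y. y \<in> Z \<inter> cball z0 R \<Longrightarrow> ?q x \<le> ?q y"
    using continuous_attains_inf cont by metis
  have far: "?q z0 < ?q y" if "y \<notin> cball z0 R" for y
  proof -
    have y: "norm (y - z0) > R" using that by (simp add: dist_norm norm_minus_commute)
    have "?H / 2 * (d * (norm (y - z0))\<^sup>2) \<le> ?H / 2 * sqnorm P (y - z0)"
      using h d(2)[of "y - z0"] by (intro mult_left_mono) auto
    moreover have "- (norm g * norm (y - z0)) \<le> g \<bullet> (y - z0)"
      using Cauchy_Schwarz_ineq2[of g "y - z0"] by linarith
    moreover have "norm g * norm (y - z0) < ?H / 2 * (d * (norm (y - z0))\<^sup>2)"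
    proof -
      have "2 * norm g < ?H * d * norm (y - z0)"
        using y h d unfolding R_def by (simp add: field_simps)
      moreover have "norm (y - z0) > 0" using y R by linarith
      ultimately have "2 * norm g * norm (y - z0) < ?H * d * norm (y - z0) * norm (y - z0)"
        by (rule mult_strict_right_mono)
      then show ?thesis by (simp add: power2_eq_square)
    qed
    ultimately show ?thesis
      using quad_expansion[of I b h a y z0] unfolding g_def by linarith
  qed
  have "?q x \<le> ?q y" if "y \<in> Z" for y
    using x far[of y] that z0 R by (cases "y \<in> cball z0 R") (force, fastforce)
  then have "is_arg_min ?q (\<lambda>z. z \<in> Z) x"
    using x by (auto simp: is_arg_min_def not_less)
  then have zs: "is_arg_min ?q (\<lambda>z. z \<in> Z) zs"
    unfolding zs_def arg_min_on_def arg_min_def by (rule someI)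
  then show zsZ: "zs \<in> Z" by (simp add: is_arg_min_def)
  show grad: "quad_grad I b h a zs \<bullet> (u - zs) \<ge> 0" if u: "u \<in> Z" for u
  proof (rule ccontr)
    assume "\<not> ?thesis"
    then have neg: "quad_grad I b h a zs \<bullet> (u - zs) < 0" (is "?D < 0") by simp
    define q where "q = ?H / 2 * sqnorm P (u - zs)"
    have q: "q \<ge> 0" using h sqnorm_nonneg by (simp add: q_def)
    (* A step so short that the quadratic term cannot make up for the descent. *)
    define s where "s = min 1 (- ?D / (2 * (q + 1)))"
    have "- ?D / (2 * (q + 1)) > 0" using neg q by (intro divide_pos_pos) auto
    then have s: "0 < s" "s \<le> 1" by (auto simp: s_def)
    have "s * (2 * (q + 1)) \<le> - ?D"
    proof -
      have "s \<le> - ?D / (2 * (q + 1))" by (simp add: s_def)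
      then show ?thesis using q iffD1[OF pos_le_divide_eq[of "2 * (q + 1)" s "- ?D"]] by simp
    qed
    moreover have "s * q \<ge> 0" using s q by simp
    ultimately have "?D + s * q < 0" using s by (simp add: algebra_simps)
    then have "s * (?D + s * q) < 0" using s by (simp add: mult_pos_neg)
    moreover have "zs + s *\<^sub>R (u - zs) \<in> Z"
      using convexD_alt[OF Z(2) zsZ u, of s] s by (simp add: algebra_simps)
    then have "?q zs \<le> ?q (zs + s *\<^sub>R (u - zs))"
      using zs by (auto simp: is_arg_min_def not_less)
    moreover have "?q (zs + s *\<^sub>R (u - zs)) = ?q zs + s * (?D + s * q)"
      using quad_expansion[of I b h a "zs + s *\<^sub>R (u - zs)" zs]
      by (simp add: sqnorm_scaleR q_def ring_distribs power2_eq_square)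
    ultimately show False by linarith
  qed
  show "?q zs + ?H / 2 * sqnorm P (u - zs) \<le> ?q u" if "u \<in> Z"
    using grad[OF that] quad_expansion[of I b h a u zs] by simp
qed

text \<open>If the feasible set is invariant under translations orthogonal to a subspace \<open>V\<close> and all data
  lie along \<open>V\<close>, then the minimizer stays in the affine space \<open>z_ref + V\<close>: its component
  orthogonal to \<open>V\<close> could be removed, which would decrease the objective.\<close>

lemma quad_argmin_affine:
  assumes Z: "closed Z" "convex Z" "Z \<noteq> {}" and h: "(\<Sum>i\<in>I. h i) > 0"
    and V: "subspace V" "\<And>v. v \<in> V \<Longrightarrow> P v \<in> V"
    and ZV: "\<And>z w. z \<in> Z \<Longrightarrow> (\<And>v. v \<in> V \<Longrightarrow> v \<bullet> w = 0) \<Longrightarrow> z - w \<in> Z"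
    and data: "\<And>i. i \<in> I \<Longrightarrow> b i \<in> V" "\<And>i. i \<in> I \<Longrightarrow> a i - z_ref \<in> V"
  shows "arg_min_on (quad I b h a) Z - z_ref \<in> V"
proof -
  define zs where "zs = arg_min_on (quad I b h a) Z"
  obtain v w where v: "v \<in> span V" and w: "\<And>y. y \<in> span V \<Longrightarrow> orthogonal w y"
    and vw: "zs - z_ref = v + w"
    using orthogonal_subspace_decomp_exists[of V "zs - z_ref"] by blast
  have v: "v \<in> V" using v V by (simp add: span_eq_iff[THEN iffD2])
  have w: "y \<bullet> w = 0" if "y \<in> V" for y
    using w[OF span_base[OF that]] by (simp add: orthogonal_def inner_commute)
  have "zs - w \<in> Z"
    by (rule ZV) (use w quad_argmin(1)[OF Z h] in \<open>auto simp: zs_def\<close>)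
  then have "quad_grad I b h a zs \<bullet> (zs - w - zs) \<ge> 0"
    unfolding zs_def by (rule quad_argmin(2)[OF Z h])
  moreover have "quad_grad I b h a zs \<bullet> w = (\<Sum>i\<in>I. h i * sqnorm P w)"
    unfolding quad_grad_def inner_sum_left
  proof (rule sum.cong[OF refl])
    fix i assume i: "i \<in> I"
    have eq: "zs - a i = (v - (a i - z_ref)) + w" using vw by (simp add: algebra_simps)
    have "P (v - (a i - z_ref)) \<bullet> w = 0"
      using v data(2)[OF i] V subspace_diff w by blast
    then show "(b i + h i *\<^sub>R P (zs - a i)) \<bullet> w = h i * sqnorm P w"
      unfolding eq using w[OF data(1)[OF i]]
      by (simp only: linear_add[OF linear_P] inner_add_left inner_scaleR_left sqnorm_def) simp
  qed
  ultimately have "(\<Sum>i\<in>I. h i) * sqnorm P w \<le> 0"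
    by (simp add: sum_distrib_right)
  then have "sqnorm P w = 0"
    using h sqnorm_nonneg[of w] by (simp add: mult_le_0_iff)
  then have "w = 0" by (simp add: sqnorm_eq_0_iff)
  then show ?thesis using vw v by (simp add: zs_def)
qed

end

section \<open>Products of step sizes\<close>

definition aprod :: "nat list \<Rightarrow> real" where
  "aprod t = prod_list (map alpha t)"

lemma aprod_simps [simp]: "aprod [] = 1" "aprod (t @ [j]) = aprod t * alpha j"
  by (simp_all add: aprod_def)

lemma aprod_pos: "aprod t > 0"
  by (induction t) (auto simp: aprod_def alpha_pos)

lemma prod_alpha_nth: "(\<Prod>l=1..length t. alpha (t ! (l - 1))) = aprod t"
proof (induction t rule: rev_induct)
  case (snoc j t)
  have "(\<Prod>l=1..length t. alpha ((t @ [j]) ! (l - 1))) = (\<Prod>l=1..length t. alpha (t ! (l - 1)))"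
    by (rule prod.cong) (auto simp: nth_append)
  then show ?case using snoc by simp
qed simp

lemma search_point_Nil [simp]: "search_point b [] z = z"
  by (simp add: search_point_def)

lemma search_point_snoc:
  "search_point b (t @ [j]) z
     = search_point b t (alpha j *\<^sub>R z + (1 - alpha j) *\<^sub>R b (t @ [j]))"
  unfolding search_point_def
  by (auto simp: nth_append intro!: foldr_cong)

lemma search_point_cong:
  "(\<And>l. l \<in> {1..length t} \<Longrightarrow> b (take l t) = b' (take l t)) \<Longrightarrow>
     search_point b t z = search_point b' t z"
  unfolding search_point_def by (rule foldr_cong) auto

text \<open>A search point depends on the iterate only through nested averaging, so its displacements are
  scaled by the product of the step sizes. This is why the smoothness constant of an inner level is
  multiplied by that product.\<close>

lemma search_point_diff:
  "search_point b t u - search_point b t v = aprod t *\<^sub>R (u - v)"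
proof (induction t arbitrary: u v rule: rev_induct)
  case (snoc j t)
  show ?case unfolding search_point_snoc snoc
    by (simp add: scaleR_diff_right)
qed simp

lemma search_point_in:
  assumes "convex S" and "v \<in> S" and "\<And>l. l \<in> {1..length t} \<Longrightarrow> b (take l t) \<in> S"
  shows "search_point b t v \<in> S"
  using assms(2,3)
proof (induction t arbitrary: v rule: rev_induct)
  case (snoc j t)
  have "b (t @ [j]) \<in> S" using snoc.prems(2)[of "length t + 1"] by simp
  then have "alpha j *\<^sub>R v + (1 - alpha j) *\<^sub>R b (t @ [j]) \<in> S"
    using snoc.prems(1) assms(1) alpha_pos[of j] alpha_le_1[of j] by (auto intro!: convexD)
  moreover have "b (take l t) \<in> S" if "l \<in> {1..length t}" for l
    using snoc.prems(2)[of l] that by auto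
  ultimately show ?case unfolding search_point_snoc by (rule snoc.IH)
qed simp

lemma search_point_convex_combination:
  "search_point b t ((1 - s) *\<^sub>R u + s *\<^sub>R v)
     = (1 - s) *\<^sub>R search_point b t u + s *\<^sub>R search_point b t v"
proof -
  have "search_point b t ((1 - s) *\<^sub>R u + s *\<^sub>R v) - search_point b t u
      = s *\<^sub>R (search_point b t v - search_point b t u)"
    unfolding search_point_diff by (simp add: algebra_simps)
  then show ?thesis by (simp add: algebra_simps)
qed

section \<open>The sliding step\<close>

text \<open>The additive error \<open>err i\<close> in the upper bound for \<open>fn i\<close> lets a function with Hoelder continuous
  subgradients be treated as smooth. The subspace \<open>V\<close> contains all oracle vectors, and \<open>Z\<close> is invariant
  under translations orthogonal to it; the iterates then stay in \<open>z_ref + V\<close>. Taking \<open>V = UNIV\<close>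
  imposes no restriction.\<close>

locale sliding_problem = metric_operator P for P :: "'z::euclidean_space \<Rightarrow> 'z" +
  fixes n :: nat and Z V :: "'z set" and z_ref :: 'z
    and lev :: "nat \<Rightarrow> 'z level" and fn :: "nat \<Rightarrow> 'z \<Rightarrow> real" and err :: "nat \<Rightarrow> real"
  assumes n_pos: "n \<ge> 1" and closed_Z: "closed Z" and convex_Z: "convex Z"
    and subspace_V: "subspace V" and P_V: "v \<in> V \<Longrightarrow> P v \<in> V"
    and Z_translate: "z \<in> Z \<Longrightarrow> (\<And>v. v \<in> V \<Longrightarrow> v \<bullet> w = 0) \<Longrightarrow> z - w \<in> Z"
    and loops_ge_1: "i \<in> {1..n} \<Longrightarrow> loops (lev i) \<ge> 1"
    and L_pos: "i \<in> {1..n} \<Longrightarrow> const_L (lev i) > 0"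
    and M_nonneg: "i \<in> {1..n} \<Longrightarrow> const_M (lev i) \<ge> 0"
    and err_nonneg: "i \<in> {1..n} \<Longrightarrow> err i \<ge> 0"
    and fn_lower: "i \<in> {1..n} \<Longrightarrow> x \<in> Z \<Longrightarrow> y \<in> Z \<Longrightarrow>
      fn i x + grad (lev i) t x \<bullet> (y - x) \<le> fn i y"
    and fn_upper: "i \<in> {1..n} \<Longrightarrow> x \<in> Z \<Longrightarrow> y \<in> Z \<Longrightarrow>
      fn i y \<le> fn i x + grad (lev i) t x \<bullet> (y - x) + const_L (lev i) / 2 * sqnorm P (y - x) + err i"
    and grad_V: "i \<in> {1..n} \<Longrightarrow> x \<in> Z \<Longrightarrow> grad (lev i) t x \<in> V"
    and opQ_V: "i \<in> {1..n} \<Longrightarrow> opQ (lev i) x \<in> V"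
    and opQ_mono: "i \<in> {1..n} \<Longrightarrow> 0 \<le> (opQ (lev i) x - opQ (lev i) y) \<bullet> (x - y)"
    and opQ_lipschitz: "i \<in> {1..n} \<Longrightarrow> (opQ (lev i) x - opQ (lev i) y) \<bullet> w
      \<le> const_M (lev i) * sqrt (sqnorm P (x - y)) * sqrt (sqnorm P w)"
begin

text \<open>The lower bound at the convex combination itself, averaged over the two end points.\<close>

lemma convex_fn:
  assumes i: "i \<in> {1..n}"
  shows "convex_on Z (fn i)"
proof (rule convex_onI)
  fix s :: real and x y
  assume s: "0 < s" "s < 1" and xy: "x \<in> Z" "y \<in> Z"
  define w g where "w = (1 - s) *\<^sub>R x + s *\<^sub>R y" and "g = grad (lev i) [] w"
  have w: "w \<in> Z" unfolding w_def using s xy by (intro convexD_alt[OF convex_Z]) auto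
  have "(1 - s) * (fn i w + g \<bullet> (x - w)) \<le> (1 - s) * fn i x"
    unfolding g_def using s by (intro mult_left_mono fn_lower[OF i w xy(1)]) auto
  moreover have "s * (fn i w + g \<bullet> (y - w)) \<le> s * fn i y"
    unfolding g_def using s by (intro mult_left_mono fn_lower[OF i w xy(2)]) auto
  moreover have "(1 - s) *\<^sub>R (x - w) + s *\<^sub>R (y - w) = 0"
    by (simp add: w_def algebra_simps)
  then have "g \<bullet> ((1 - s) *\<^sub>R (x - w) + s *\<^sub>R (y - w)) = 0" by simp
  then have "(1 - s) * (g \<bullet> (x - w)) + s * (g \<bullet> (y - w)) = 0"
    by (simp only: inner_add_right inner_scaleR_right)
  ultimately show "fn i ((1 - s) *\<^sub>R x + s *\<^sub>R y) \<le> (1 - s) * fn i x + s * fn i y"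
    unfolding w_def[symmetric] by (simp add: ring_distribs)
qed (rule convex_Z)

definition W :: "'z set" where "W = {z \<in> Z. z - z_ref \<in> V}"

lemma W_Z: "z \<in> W \<Longrightarrow> z \<in> Z" by (simp add: W_def)

lemma convex_W: "convex W"
proof (rule convexI)
  fix x y :: 'z and a b :: real
  assume xy: "x \<in> W" "y \<in> W" and ab: "0 \<le> a" "0 \<le> b" "a + b = 1"
  have "a *\<^sub>R (x - z_ref) + b *\<^sub>R (y - z_ref) \<in> V"
    using xy by (intro subspace_add subspace_scale subspace_V) (auto simp: W_def)
  moreover have "a *\<^sub>R (x - z_ref) + b *\<^sub>R (y - z_ref) = a *\<^sub>R x + b *\<^sub>R y - (a + b) *\<^sub>R z_ref"
    by (simp add: algebra_simps)
  moreover have "a *\<^sub>R x + b *\<^sub>R y \<in> Z"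
    using xy ab by (intro convexD[OF convex_Z]) (auto simp: W_def)
  ultimately show "a *\<^sub>R x + b *\<^sub>R y \<in> W" using ab by (simp add: W_def)
qed

definition tau :: "nat \<Rightarrow> real" where "tau l = alpha (loops (lev l) - 1)"

lemma tau_pos: "tau l > 0" by (simp add: tau_def alpha_pos)

lemma eta_alt: "eta lev t = aprod t * (const_L (lev (length t))
    + const_M (lev (length t)) / (\<Prod>l=1..length t. tau l))"
  unfolding eta_def prod_dividef prod_alpha_nth tau_def[symmetric] by (simp add: algebra_simps)

text \<open>The multi-indices at which the recursion calls itself; within a loop the step size has not yet
  fallen below its last value \<open>tau\<close>.\<close>

definition index :: "nat list \<Rightarrow> bool" where
  "index t \<longleftrightarrow> length t \<le> n \<and> (\<forall>l<length t. t ! l < loops (lev (Suc l)))"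

lemma index_snoc:
  "index (t @ [j]) \<longleftrightarrow> index t \<and> length t < n \<and> j < loops (lev (Suc (length t)))"
  unfolding index_def by (auto simp: nth_append All_less_Suc)

lemma prod_tau_le_aprod: "index t \<Longrightarrow> (\<Prod>l=1..length t. tau l) \<le> aprod t"
proof (induction t rule: rev_induct)
  case (snoc j t)
  then have t: "index t" "j < loops (lev (Suc (length t)))" by (simp_all add: index_snoc)
  then have "tau (Suc (length t)) \<le> alpha j" unfolding tau_def by (intro alpha_decreasing) auto
  then have "(\<Prod>l=1..length t. tau l) * tau (Suc (length t)) \<le> aprod t * alpha j"
    using snoc.IH[OF t(1)] tau_pos aprod_pos[of t] by (intro mult_mono) (auto intro: less_imp_le)
  then show ?case by simp
qed simp

lemma eta_pos:
  assumes "t \<noteq> []" "length t \<le> n"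
  shows "eta lev t > 0"
proof -
  have i: "length t \<in> {1..n}" using assms by (cases t) auto
  have "(\<Prod>l=1..length t. tau l) > 0" using tau_pos by (simp add: prod_pos)
  then have "const_M (lev (length t)) / (\<Prod>l=1..length t. tau l) \<ge> 0"
    using M_nonneg[OF i] by (intro divide_nonneg_pos)
  then show ?thesis unfolding eta_alt using aprod_pos[of t] L_pos[OF i]
    by (intro mult_pos_pos add_pos_nonneg)
qed

text \<open>The step size splits into the part that pays for the smooth component and a part that
  dominates the Lipschitz constant of the operator.\<close>

lemma eta_dominates:
  assumes t: "index t" "t \<noteq> []"
  defines "L \<equiv> const_L (lev (length t))" and "M \<equiv> const_M (lev (length t))"
  shows "L * aprod t + M\<^sup>2 / eta lev t \<le> eta lev t"
proof -
  have len: "length t \<in> {1..n}" using t by (cases t) (auto simp: index_def)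
  then have L: "L > 0" and M: "M \<ge> 0" using L_pos M_nonneg by (auto simp: L_def M_def)
  have pp: "(\<Prod>l=1..length t. tau l) > 0" using tau_pos by (simp add: prod_pos)
  define b where "b = M * (aprod t / (\<Prod>l=1..length t. tau l))"
  have "1 \<le> aprod t / (\<Prod>l=1..length t. tau l)"
    using prod_tau_le_aprod[OF t(1)] pp by simp
  then have b: "M \<le> b" unfolding b_def using M mult_left_mono[of 1 "aprod t / (\<Prod>l=1..length t. tau l)" M]
    by (simp only: mult_1_right)
  have e: "eta lev t = L * aprod t + b"
    unfolding eta_alt b_def L_def M_def by (simp add: algebra_simps)
  have "L * aprod t > 0" using L aprod_pos by simp
  then have "M \<le> eta lev t" and epos: "eta lev t > 0" using b e M by linarith+
  then have "M * M \<le> M * eta lev t" using M by (intro mult_left_mono)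
  then have "M\<^sup>2 / eta lev t \<le> M" using epos by (simp add: power2_eq_square divide_le_eq)
  then show ?thesis using b e by linarith
qed

text \<open>The optimality condition of a proximal step in its three-point form.\<close>

lemma prox_step:
  fixes b a :: 'z
  assumes h: "h > 0" and ne: "Z \<noteq> {}"
  defines "zs \<equiv> arg_min_on (\<lambda>z. b \<bullet> z + 1/2 * h * sqnorm P (z - a)) Z"
  shows "zs \<in> Z"
    and "u \<in> Z \<Longrightarrow> b \<bullet> (zs - u) + h / 2 * (sqnorm P (zs - a) + sqnorm P (zs - u) - sqnorm P (a - u)) \<le> 0"
    and "b \<in> V \<Longrightarrow> a - z_ref \<in> V \<Longrightarrow> zs \<in> W"
proof -
  have q: "(\<lambda>z. b \<bullet> z + 1/2 * h * sqnorm P (z - a)) = quad {()} (\<lambda>_. b) (\<lambda>_. h) (\<lambda>_. a)"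
    by (simp add: quad_def fun_eq_iff)
  have h': "(\<Sum>i\<in>{()}. h) > 0" using h by simp
  show zs: "zs \<in> Z"
    unfolding zs_def q by (rule quad_argmin(1)[OF closed_Z convex_Z ne]) (use h' in simp)
  show "b \<bullet> (zs - u) + h / 2 * (sqnorm P (zs - a) + sqnorm P (zs - u) - sqnorm P (a - u)) \<le> 0"
    if "u \<in> Z"
  proof -
    have "quad {()} (\<lambda>_. b) (\<lambda>_. h) (\<lambda>_. a) zs + (\<Sum>i\<in>{()}. h) / 2 * sqnorm P (u - zs)
        \<le> quad {()} (\<lambda>_. b) (\<lambda>_. h) (\<lambda>_. a) u"
      unfolding zs_def q by (rule quad_argmin(3)[OF closed_Z convex_Z ne _ that]) (use h' in simp)
    then have "b \<bullet> zs + h / 2 * sqnorm P (zs - a) + h / 2 * sqnorm P (u - zs)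
        \<le> b \<bullet> u + h / 2 * sqnorm P (u - a)"
      by (simp add: quad_def)
    then show ?thesis
      by (simp add: inner_diff_right ring_distribs sqnorm_minus_commute[of u])
  qed
  show "zs \<in> W" if "b \<in> V" "a - z_ref \<in> V"
  proof -
    have "zs - z_ref \<in> V"
      unfolding zs_def q
    proof (rule quad_argmin_affine[OF closed_Z convex_Z ne h' subspace_V P_V])
      show "z - w \<in> Z" if "z \<in> Z" "\<And>v. v \<in> V \<Longrightarrow> v \<bullet> w = 0" for z w
        using that by (rule Z_translate)
    qed (use that in auto)
    then show ?thesis using zs by (simp add: W_def)
  qed
qed

text \<open>One accelerated gradient step on the function \<open>z \<mapsto> fn i (A z) / \<omega>\<close>, where \<open>A\<close> is an affine
  contraction with ratio \<open>\<omega>\<close>: the smoothness constant shrinks to \<open>L \<omega>\<close>, the inexactness grows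
  to \<open>err i / \<omega>\<close>.\<close>

lemma accelerated_step:
  fixes t :: "nat list" and zj :: 'z
  assumes i: "i \<in> {1..n}" and \<omega>: "\<omega> > 0" and \<alpha>: "0 < \<alpha>" "\<alpha> \<le> 1"
    and A: "\<And>z. z \<in> Z \<Longrightarrow> A z \<in> Z" "\<And>y z. A y - A z = \<omega> *\<^sub>R (y - z)"
    and mem: "xb \<in> Z" "zj \<in> Z" "v \<in> Z" "u \<in> Z"
  defines "xb' \<equiv> \<alpha> *\<^sub>R v + (1 - \<alpha>) *\<^sub>R xb"
    and "g \<equiv> grad (lev i) t (A (\<alpha> *\<^sub>R zj + (1 - \<alpha>) *\<^sub>R xb))"
  shows "(fn i (A xb') - (1 - \<alpha>) * fn i (A xb) - \<alpha> * fn i (A u)) / (\<omega> * \<alpha>)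
    \<le> g \<bullet> (v - u) + const_L (lev i) * \<omega> * \<alpha> / 2 * sqnorm P (v - zj) + err i / (\<omega> * \<alpha>)"
proof -
  define w where "w = A (\<alpha> *\<^sub>R zj + (1 - \<alpha>) *\<^sub>R xb)"
  have Z: "w \<in> Z" "A xb' \<in> Z" "A xb \<in> Z" "A u \<in> Z"
    unfolding w_def xb'_def using mem \<alpha> by (auto intro!: A(1) convexD[OF convex_Z])
  have up: "fn i (A xb') \<le> fn i w + g \<bullet> (A xb' - w) + const_L (lev i) / 2 * sqnorm P (A xb' - w) + err i"
    unfolding g_def w_def[symmetric] by (rule fn_upper[OF i Z(1,2)])
  have lo1: "(1 - \<alpha>) * (fn i w + g \<bullet> (A xb - w)) \<le> (1 - \<alpha>) * fn i (A xb)"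
    unfolding g_def w_def[symmetric] using \<alpha> by (intro mult_left_mono fn_lower[OF i Z(1,3)]) auto
  have lo2: "\<alpha> * (fn i w + g \<bullet> (A u - w)) \<le> \<alpha> * fn i (A u)"
    unfolding g_def w_def[symmetric] using \<alpha> by (intro mult_left_mono fn_lower[OF i Z(1,4)]) auto
  have "A xb' - w = (\<omega> * \<alpha>) *\<^sub>R (v - zj)"
    unfolding w_def A(2) xb'_def by (simp add: algebra_simps)
  then have sq: "sqnorm P (A xb' - w) = (\<omega> * \<alpha>)\<^sup>2 * sqnorm P (v - zj)"
    by (simp add: sqnorm_scaleR)
  have lin: "g \<bullet> (A xb' - w) - (1 - \<alpha>) * (g \<bullet> (A xb - w)) - \<alpha> * (g \<bullet> (A u - w))
      = (\<omega> * \<alpha>) * (g \<bullet> (v - u))"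
  proof -
    have "A xb' - w - (1 - \<alpha>) *\<^sub>R (A xb - w) - \<alpha> *\<^sub>R (A u - w)
        = (1 - \<alpha>) *\<^sub>R (A xb' - A xb) + \<alpha> *\<^sub>R (A xb' - A u)"
      by (simp add: algebra_simps)
    also have "\<dots> = (\<omega> * \<alpha>) *\<^sub>R (v - u)"
      unfolding A(2) xb'_def by (simp add: algebra_simps)
    finally have "g \<bullet> (A xb' - w - (1 - \<alpha>) *\<^sub>R (A xb - w) - \<alpha> *\<^sub>R (A u - w)) = g \<bullet> ((\<omega> * \<alpha>) *\<^sub>R (v - u))"
      by (rule arg_cong)
    then show ?thesis by (simp add: inner_diff_right)
  qed
  have "fn i (A xb') - (1 - \<alpha>) * fn i (A xb) - \<alpha> * fn i (A u)
      \<le> (\<omega> * \<alpha>) * (g \<bullet> (v - u)) + const_L (lev i) / 2 * ((\<omega> * \<alpha>)\<^sup>2 * sqnorm P (v - zj)) + err i"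
    using up lo1 lo2 lin unfolding sq by (simp add: ring_distribs)
  also have "\<dots> = (g \<bullet> (v - u) + const_L (lev i) * \<omega> * \<alpha> / 2 * sqnorm P (v - zj)
      + err i / (\<omega> * \<alpha>)) * (\<omega> * \<alpha>)"
    using \<omega> \<alpha> by (simp add: field_simps power2_eq_square)
  finally show ?thesis using \<omega> \<alpha> by (simp add: pos_divide_le_eq)
qed

text \<open>The extragradient correction replaces the operator value at the old iterate by the one at the
  new point \<open>v\<close>; the Lipschitz term is absorbed by Young's inequality.\<close>

lemma extragradient_step:
  fixes zj :: 'z
  assumes i: "i \<in> {1..n}" and \<eta>: "\<eta> > 0" and mem: "v \<in> Z" "u \<in> Z"
  defines "q \<equiv> opQ (lev i) zj"
  defines "z' \<equiv> arg_min_on (\<lambda>z. (opQ (lev i) v - q) \<bullet> z + 1/2 * \<eta> * sqnorm P (z - v)) Z"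
  shows "opQ (lev i) u \<bullet> (v - u) + \<eta> / 2 * (sqnorm P (z' - u) - sqnorm P (v - u))
    \<le> q \<bullet> (v - u) + (const_M (lev i))\<^sup>2 / \<eta> / 2 * sqnorm P (v - zj)"
proof -
  let ?d = "opQ (lev i) v - q" and ?M = "const_M (lev i)"
  have ne: "Z \<noteq> {}" using mem by blast
  have prox: "?d \<bullet> (z' - u) + \<eta> / 2 * (sqnorm P (z' - v) + sqnorm P (z' - u) - sqnorm P (v - u)) \<le> 0"
    unfolding z'_def by (rule prox_step(2)[OF \<eta> ne mem(2)])
  have mono: "0 \<le> (opQ (lev i) v - opQ (lev i) u) \<bullet> (v - u)" by (rule opQ_mono[OF i])
  define a b where "a = sqrt (sqnorm P (v - zj))" and "b = sqrt (sqnorm P (v - z'))"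
  have ab: "a\<^sup>2 = sqnorm P (v - zj)" "b\<^sup>2 = sqnorm P (z' - v)"
    by (simp_all add: a_def b_def sqnorm_nonneg sqnorm_minus_commute)
  have "?d \<bullet> (v - z') \<le> ?M * a * b"
    unfolding q_def a_def b_def by (rule opQ_lipschitz[OF i])
  also have "\<dots> \<le> ?M\<^sup>2 / \<eta> / 2 * a\<^sup>2 + \<eta> / 2 * b\<^sup>2"
  proof -
    have "0 \<le> (?M * a - \<eta> * b)\<^sup>2" by simp
    then have "?M * a * b * (2 * \<eta>) \<le> ?M\<^sup>2 * a\<^sup>2 + \<eta>\<^sup>2 * b\<^sup>2"
      by (simp add: power2_eq_square algebra_simps)
    then have "?M * a * b \<le> (?M\<^sup>2 * a\<^sup>2 + \<eta>\<^sup>2 * b\<^sup>2) / (2 * \<eta>)"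
      using \<eta> by (simp add: pos_le_divide_eq)
    also have "\<dots> = ?M\<^sup>2 / \<eta> / 2 * a\<^sup>2 + \<eta> / 2 * b\<^sup>2"
      using \<eta> by (simp add: field_simps power2_eq_square)
    finally show ?thesis .
  qed
  finally have "?d \<bullet> (v - z') \<le> ?M\<^sup>2 / \<eta> / 2 * sqnorm P (v - zj) + \<eta> / 2 * sqnorm P (z' - v)"
    by (simp only: ab)
  with prox mono show ?thesis by (simp add: inner_diff_left inner_diff_right algebra_simps)
qed

end

section \<open>The recursion\<close>

text \<open>The frame condition of the recursion: a call at \<open>t\<close> writes only at proper extensions of \<open>t\<close>.\<close>

definition unchanged_outside :: "nat list \<Rightarrow> 'z run \<Rightarrow> 'z run \<Rightarrow> bool" where
  "unchanged_outside t st st' \<longleftrightarrow> (\<forall>s. \<not> strict_prefix t s \<longrightarrow>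
     zc st' s = zc st s \<and> zb st' s = zb st s \<and> gv st' s = gv st s \<and> qv st' s = qv st s)"

lemma unchanged_outside_refl: "unchanged_outside t st st"
  by (simp add: unchanged_outside_def)

lemma unchanged_outside_trans:
  "unchanged_outside t st st' \<Longrightarrow> unchanged_outside t st' st'' \<Longrightarrow> unchanged_outside t st st''"
  by (simp add: unchanged_outside_def)

lemma unchanged_outside_prefix:
  "unchanged_outside t' st st' \<Longrightarrow> prefix t t' \<Longrightarrow> unchanged_outside t st st'"
  unfolding unchanged_outside_def by (meson prefix_order.le_less_trans)

lemma unchanged_outside_take:
  assumes "unchanged_outside t st st'"
  shows "zc st' (take l t) = zc st (take l t)" "zb st' (take l t) = zb st (take l t)"
    "gv st' (take l t) = gv st (take l t)" "qv st' (take l t) = qv st (take l t)"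
proof -
  have "\<not> strict_prefix t (take l t)"
    using prefix_order.less_le_not_le take_is_prefix by blast
  then show "zc st' (take l t) = zc st (take l t)" "zb st' (take l t) = zb st (take l t)"
    "gv st' (take l t) = gv st (take l t)" "qv st' (take l t) = qv st (take l t)"
    using assms by (simp_all add: unchanged_outside_def)
qed

lemma length_pad: "length t \<le> l \<Longrightarrow> length (pad l t) = l"
  by (simp add: pad_def)

lemma pad_length [simp]: "pad (length t) t = t"
  by (simp add: pad_def)

lemma pad_snoc_0: "l > length t \<Longrightarrow> pad l (t @ [0]) = pad l t"
  by (auto simp: pad_def replicate_Suc[symmetric] Suc_diff_Suc simp del: replicate_Suc)

lemma strict_prefix_pad: "strict_prefix t s \<Longrightarrow> strict_prefix t (pad l s)"
  unfolding pad_def by (simp add: prefix_order.less_le_trans)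

text \<open>The iterates are handed over to the next multi-index one level at a time; since no target is also
  a source, this amounts to copying all of them at once.\<close>

lemma fold_copy:
  fixes h :: "'k \<Rightarrow> 'v"
  assumes "distinct ls" "inj_on K (set ls)" "\<And>l l'. l \<in> set ls \<Longrightarrow> l' \<in> set ls \<Longrightarrow> K l \<noteq> S l'"
  shows "l \<in> set ls \<Longrightarrow> fold (\<lambda>l h. h(K l := h (S l))) ls h (K l) = h (S l)"
    and "s \<notin> K ` set ls \<Longrightarrow> fold (\<lambda>l h. h(K l := h (S l))) ls h s = h s"
proof -
  have out: "s \<notin> K ` set ls \<Longrightarrow> fold (\<lambda>l h. h(K l := h (S l))) ls h s = h s" for ls h s
    by (induction ls arbitrary: h) auto
  then show "s \<notin> K ` set ls \<Longrightarrow> fold (\<lambda>l h. h(K l := h (S l))) ls h s = h s" .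
  show "l \<in> set ls \<Longrightarrow> fold (\<lambda>l h. h(K l := h (S l))) ls h (K l) = h (S l)"
    using assms
  proof (induction ls arbitrary: h)
    case (Cons a ls)
    show ?case
    proof (cases "l = a")
      case True
      then have "K l \<notin> K ` set ls" using Cons.prems by auto
      then show ?thesis using out[of "K l" ls "h(K a := h (S a))"] True
        by (simp del: fun_upd_apply add: fun_upd_same)
    next
      case False
      then have l: "l \<in> set ls" using Cons.prems by simp
      have "fold (\<lambda>l h. h(K l := h (S l))) ls (h(K a := h (S a))) (K l) = (h(K a := h (S a))) (S l)"
        using Cons.prems l by (intro Cons.IH) auto
      also have "\<dots> = h (S l)" using Cons.prems(4)[of a l] l by auto
      finally show ?thesis by (simp del: fun_upd_apply)
    qed
  qed simp
qed

context sliding_problem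
begin

definition prox_term :: "'z run \<Rightarrow> nat list \<Rightarrow> 'z \<Rightarrow> 'z \<Rightarrow> real" where
  "prox_term st s u v = (gv st s + qv st s) \<bullet> (v - u) + eta lev s / 2 *
     (sqnorm P (v - zc st s) + sqnorm P (v - u) - sqnorm P (zc st s - u))"

text \<open>What the levels up to \<open>length t\<close>, whose data are fixed while \<open>Rec\<close> runs at \<open>t\<close>, contribute to
  the inequality satisfied by the result \<open>v\<close>: the left-hand side of the optimality condition of
  the innermost subproblem.\<close>

definition outer_terms :: "'z run \<Rightarrow> nat list \<Rightarrow> 'z \<Rightarrow> 'z \<Rightarrow> real" where
  "outer_terms st t u v = (\<Sum>i=1..length t. prox_term st (take i t) u v)"

text \<open>The gap of a level inside \<open>t\<close>. Its component is seen through the search-point map and is rescaled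
  so that its subgradients keep their size.\<close>

definition level_gap :: "(nat list \<Rightarrow> 'z) \<Rightarrow> nat list \<Rightarrow> 'z \<Rightarrow> nat \<Rightarrow> 'z \<Rightarrow> real" where
  "level_gap b t u i v = (fn i (search_point b t v) - fn i (search_point b t u)) / aprod t
     + opQ (lev i) u \<bullet> (v - u)"

definition gap :: "'z run \<Rightarrow> nat list \<Rightarrow> 'z \<Rightarrow> 'z \<Rightarrow> real" where
  "gap st t u v = outer_terms st t u v + (\<Sum>i=Suc (length t)..n. level_gap (zb st) t u i v)"

text \<open>The weight of the squared distances of level \<open>i\<close> in the guarantee of a call at \<open>t\<close>. Every loop
  in between divides the smooth part by its total weight, which is the reciprocal of the square of
  \<open>tau\<close>, but the operator part only by the square root of that weight.\<close>

definition coef :: "nat list \<Rightarrow> nat \<Rightarrow> real" where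
  "coef t i = aprod t * (const_L (lev i) * (\<Prod>l=Suc (length t)..i. tau l)\<^sup>2
     + const_M (lev i) * (\<Prod>l=Suc (length t)..i. tau l) / (\<Prod>l=1..length t. tau l))"

text \<open>The errors accumulate over all inner iterations; \<open>iter_inexactness\<close> is the share of one iteration
  of the outermost of these loops.\<close>

definition inexactness :: "nat list \<Rightarrow> nat \<Rightarrow> real" where
  "inexactness t i = err i / aprod t * (\<Prod>l=Suc (length t)..i. real (loops (lev l)))"

definition iter_inexactness :: "nat list \<Rightarrow> nat \<Rightarrow> real" where
  "iter_inexactness t i = err i / aprod t * (\<Prod>l=Suc (Suc (length t))..i. real (loops (lev l)))"

definition dist_change :: "'z run \<Rightarrow> nat list \<Rightarrow> 'z run \<Rightarrow> nat list \<Rightarrow> 'z \<Rightarrow> nat \<Rightarrow> real" where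
  "dist_change st t st' t' u i = sqnorm P (zc st' (pad i t') - u) - sqnorm P (zc st (pad i t) - u)"

definition rec_pre :: "'z run \<Rightarrow> nat list \<Rightarrow> bool" where
  "rec_pre st t \<longleftrightarrow> index t \<and>
     (\<forall>l\<in>{1..length t}. zc st (take l t) \<in> W \<and> zb st (take l t) \<in> W \<and>
        gv st (take l t) \<in> V \<and> qv st (take l t) \<in> V) \<and>
     (\<forall>l\<in>{Suc (length t)..n}. zc st (pad l t) \<in> W)"

text \<open>The guarantee of a call of \<open>Rec\<close> at \<open>t\<close>. The iterates of the inner levels are not reset
  between calls, which is why the distances at entry and exit both appear: they telescope.\<close>

definition rec_post :: "'z run \<Rightarrow> nat list \<Rightarrow> 'z \<Rightarrow> 'z run \<Rightarrow> bool" where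
  "rec_post st t v st' \<longleftrightarrow> unchanged_outside t st st' \<and> v \<in> W \<and>
     (\<forall>l\<in>{Suc (length t)..n}. zc st' (pad l (t @ [loops (lev (Suc (length t)))])) \<in> W) \<and>
     (\<forall>u\<in>Z. gap st t u v + (\<Sum>i=Suc (length t)..n. coef t i / 2 *
        dist_change st t st' (t @ [loops (lev (Suc (length t)))]) u i - inexactness t i) \<le> 0)"

text \<open>The gap at \<open>t\<close> reads the state only at prefixes of \<open>t\<close>, which a call at \<open>t\<close> leaves alone.\<close>

lemma gap_unchanged: "unchanged_outside t st st' \<Longrightarrow> gap st' t u v = gap st t u v"
proof -
  assume u: "unchanged_outside t st st'"
  have "search_point (zb st') t z = search_point (zb st) t z" for z
    by (rule search_point_cong) (simp add: unchanged_outside_take[OF u])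
  then show ?thesis
    by (simp add: gap_def outer_terms_def prox_term_def level_gap_def unchanged_outside_take[OF u])
qed

text \<open>At the innermost level no gap remains, and the guarantee is the optimality condition of the
  subproblem, of which \<open>outer_terms\<close> collects the summands.\<close>

lemma rec_post_leaf:
  assumes pre: "rec_pre st t" and t: "length t = n"
  shows "rec_post st t (leaf Z P lev t st) st"
proof -
  define I b h a where "I = {1..length t}" and "b = (\<lambda>i. gv st (take i t) + qv st (take i t))"
    and "h = (\<lambda>i. eta lev (take i t))" and "a = (\<lambda>i. zc st (take i t))"
  define v where "v = leaf Z P lev t st"
  have v: "v = arg_min_on (quad I b h a) Z"
    unfolding v_def leaf_def quad_def[abs_def] I_def b_def h_def a_def ..
  have n: "n \<in> {1..length t}" using n_pos t by simp
  then have ne: "Z \<noteq> {}" using pre W_Z unfolding rec_pre_def by blast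
  have "h i > 0" if "i \<in> I" for i
    unfolding h_def using that t by (intro eta_pos) (auto simp: I_def)
  then have h: "(\<Sum>i\<in>I. h i) > 0" using n by (intro sum_pos) (auto simp: I_def)
  have "v \<in> Z" unfolding v by (rule quad_argmin(1)[OF closed_Z convex_Z ne h])
  moreover have "v - z_ref \<in> V"
    unfolding v
  proof (rule quad_argmin_affine[OF closed_Z convex_Z ne h subspace_V P_V])
    show "z - w \<in> Z" if "z \<in> Z" "\<And>v. v \<in> V \<Longrightarrow> v \<bullet> w = 0" for z w
      using that by (rule Z_translate)
    show "b i \<in> V" "a i - z_ref \<in> V" if "i \<in> I" for i
      using pre that subspace_add[OF subspace_V] unfolding rec_pre_def I_def b_def a_def W_def by auto
  qed
  ultimately have vW: "v \<in> W" by (simp add: W_def)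
  have "outer_terms st t u v \<le> 0" if "u \<in> Z" for u
  proof -
    have "quad I b h a v + (\<Sum>i\<in>I. h i) / 2 * sqnorm P (u - v) \<le> quad I b h a u"
      unfolding v by (rule quad_argmin(3)[OF closed_Z convex_Z ne h that])
    moreover have "outer_terms st t u v
        = quad I b h a v + (\<Sum>i\<in>I. h i) / 2 * sqnorm P (u - v) - quad I b h a u"
      unfolding outer_terms_def prox_term_def quad_def sum_divide_distrib sum_distrib_right
        sum.distrib[symmetric] sum_subtractf[symmetric] I_def b_def h_def a_def
      by (rule sum.cong[OF refl])
        (simp add: inner_diff_right ring_distribs sqnorm_minus_commute[of u])
    ultimately show ?thesis by simp
  qed
  then show ?thesis
    unfolding v_def[symmetric] rec_post_def gap_def using vW t
    by (simp add: unchanged_outside_refl)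
qed

text \<open>Convexity in \<open>v\<close> lets the average of the inner results inherit their bounds.\<close>

lemma prox_term_convex:
  assumes eta: "eta lev s > 0" and \<alpha>: "0 \<le> \<alpha>" "\<alpha> \<le> 1"
  shows "prox_term st s u (\<alpha> *\<^sub>R v + (1 - \<alpha>) *\<^sub>R x)
    \<le> \<alpha> * prox_term st s u v + (1 - \<alpha>) * prox_term st s u x"
proof -
  define e b a y where "e = eta lev s / 2" and "b = gv st s + qv st s" and "a = zc st s" and "y = \<alpha> *\<^sub>R v + (1 - \<alpha>) *\<^sub>R x"
  have "e > 0" using eta by (simp add: e_def)
  have sq: "sqnorm P (y - c) \<le> \<alpha> * sqnorm P (v - c) + (1 - \<alpha>) * sqnorm P (x - c)" for c
  proof -
    have "y - c = (1 - \<alpha>) *\<^sub>R (x - c) + \<alpha> *\<^sub>R (v - c)"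
      unfolding y_def by (simp add: algebra_simps)
    then have "sqnorm P (y - c) = (1 - \<alpha>) * sqnorm P (x - c) + \<alpha> * sqnorm P (v - c)
        - \<alpha> * (1 - \<alpha>) * sqnorm P ((x - c) - (v - c))"
      by (simp only: sqnorm_convex_combination)
    moreover have "\<alpha> * (1 - \<alpha>) * sqnorm P ((x - c) - (v - c)) \<ge> 0"
      using \<alpha> sqnorm_nonneg by simp
    ultimately show ?thesis by linarith
  qed
  define Q where "Q w = sqnorm P (w - a) + sqnorm P (w - u) - sqnorm P (a - u)" for w
  have "Q y \<le> \<alpha> * Q v + (1 - \<alpha>) * Q x"
    using sq[of a] sq[of u] by (simp add: Q_def algebra_simps)
  then have "e * Q y \<le> e * (\<alpha> * Q v + (1 - \<alpha>) * Q x)"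
    using \<open>e > 0\<close> by (intro mult_left_mono) auto
  moreover have "b \<bullet> (y - u) = \<alpha> * (b \<bullet> (v - u)) + (1 - \<alpha>) * (b \<bullet> (x - u))"
    unfolding y_def by (simp add: inner_diff_right inner_add_right algebra_simps)
  ultimately have "b \<bullet> (y - u) + e * Q y
      \<le> \<alpha> * (b \<bullet> (v - u) + e * Q v) + (1 - \<alpha>) * (b \<bullet> (x - u) + e * Q x)"
    by (simp add: algebra_simps)
  then show ?thesis
    by (simp only: prox_term_def Q_def e_def a_def b_def y_def)
qed

lemma outer_terms_convex:
  assumes "index t" and \<alpha>: "0 \<le> \<alpha>" "\<alpha> \<le> 1"
  shows "outer_terms st t u (\<alpha> *\<^sub>R v + (1 - \<alpha>) *\<^sub>R x)
    \<le> \<alpha> * outer_terms st t u v + (1 - \<alpha>) * outer_terms st t u x"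
  unfolding outer_terms_def sum_distrib_left sum.distrib[symmetric]
  using assms by (intro sum_mono prox_term_convex eta_pos) (auto simp: index_def)

text \<open>Levels further inside see the search points through one more averaging step; convexity
  turns their gap relative to \<open>t @ [j]\<close> into an increment of the gap relative to \<open>t\<close>.\<close>

lemma level_gap_inner:
  assumes i: "i \<in> {1..n}" and b: "\<And>l. l \<in> {1..length t} \<Longrightarrow> b (take l t) \<in> Z"
    and mem: "u \<in> Z" "v \<in> Z" "b (t @ [j]) \<in> Z"
  shows "level_gap b t u i (alpha j *\<^sub>R v + (1 - alpha j) *\<^sub>R b (t @ [j]))
     - (1 - alpha j) * level_gap b t u i (b (t @ [j])) \<le> alpha j * level_gap b (t @ [j]) u i v"
proof -
  define \<alpha> x A \<omega> where "\<alpha> = alpha j" and "x = b (t @ [j])" and "A = search_point b t" and "\<omega> = aprod t"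
  have \<alpha>: "0 < \<alpha>" "\<alpha> \<le> 1" and \<omega>: "\<omega> > 0"
    by (simp_all add: \<alpha>_def \<omega>_def alpha_pos alpha_le_1 aprod_pos)
  have A: "A z \<in> Z" if "z \<in> Z" for z
    unfolding A_def using that b by (intro search_point_in convex_Z)
  have "fn i ((1 - \<alpha>) *\<^sub>R A x + \<alpha> *\<^sub>R A u) \<le> (1 - \<alpha>) * fn i (A x) + \<alpha> * fn i (A u)"
    using \<alpha> mem A unfolding x_def by (intro convex_onD[OF convex_fn[OF i]]) auto
  moreover have "A (\<alpha> *\<^sub>R u + (1 - \<alpha>) *\<^sub>R x) = (1 - \<alpha>) *\<^sub>R A x + \<alpha> *\<^sub>R A u"
    using search_point_convex_combination[of b t \<alpha> x u] by (simp add: A_def add.commute)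
  ultimately have cv: "fn i (A (\<alpha> *\<^sub>R u + (1 - \<alpha>) *\<^sub>R x)) \<le> (1 - \<alpha>) * fn i (A x) + \<alpha> * fn i (A u)"
    by simp
  let ?y = "\<alpha> *\<^sub>R v + (1 - \<alpha>) *\<^sub>R x"
  have "level_gap b t u i ?y - (1 - \<alpha>) * level_gap b t u i x
     = (fn i (A ?y) - (1 - \<alpha>) * fn i (A x) - \<alpha> * fn i (A u)) / \<omega> + \<alpha> * (opQ (lev i) u \<bullet> (v - u))"
    unfolding level_gap_def A_def[symmetric] \<omega>_def[symmetric] using \<omega>
    by (simp add: field_simps inner_diff_right inner_add_right)
  also have "\<dots> \<le> (fn i (A ?y) - fn i (A (\<alpha> *\<^sub>R u + (1 - \<alpha>) *\<^sub>R x))) / \<omega> + \<alpha> * (opQ (lev i) u \<bullet> (v - u))"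
    using cv \<omega> by (intro add_right_mono divide_right_mono) auto
  also have "\<dots> = \<alpha> * level_gap b (t @ [j]) u i v"
    unfolding level_gap_def search_point_snoc aprod_simps \<alpha>_def[symmetric] x_def[symmetric]
      A_def[symmetric] \<omega>_def[symmetric] using \<omega> \<alpha> by (simp add: field_simps)
  finally show ?thesis by (simp add: \<alpha>_def x_def)
qed

text \<open>The level whose loop is running: the gradient inequality and the extragradient inequality are
  added, and their two terms in the squared distance of \<open>v\<close> and \<open>zj\<close> are paid for by the one that
  the proximal term provides.\<close>

lemma level_gap_current:
  assumes t: "index (t @ [j])" and b: "\<And>l. l \<in> {1..length t} \<Longrightarrow> b (take l t) \<in> Z"
    and mem: "u \<in> Z" "v \<in> Z" "b (t @ [j]) \<in> Z" "zj \<in> Z"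
  defines "i \<equiv> Suc (length t)" and "\<eta> \<equiv> eta lev (t @ [j])"
  defines "g \<equiv> grad (lev i) (t @ [j]) (search_point b (t @ [j]) zj)" and "q \<equiv> opQ (lev i) zj"
  defines "z' \<equiv> arg_min_on (\<lambda>z. (opQ (lev i) v - q) \<bullet> z + 1/2 * \<eta> * sqnorm P (z - v)) Z"
  shows "level_gap b t u i (alpha j *\<^sub>R v + (1 - alpha j) *\<^sub>R b (t @ [j]))
     - (1 - alpha j) * level_gap b t u i (b (t @ [j]))
     \<le> alpha j * ((g + q) \<bullet> (v - u)
         + \<eta> / 2 * (sqnorm P (v - zj) + sqnorm P (v - u) - sqnorm P (zj - u))
         - \<eta> / 2 * (sqnorm P (z' - u) - sqnorm P (zj - u)) + err i / (aprod t * alpha j))"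
proof -
  define \<alpha> x A \<omega> where "\<alpha> = alpha j" and "x = b (t @ [j])" and "A = search_point b t" and "\<omega> = aprod t"
  have \<alpha>: "0 < \<alpha>" "\<alpha> \<le> 1" and \<omega>: "\<omega> > 0"
    by (simp_all add: \<alpha>_def \<omega>_def alpha_pos alpha_le_1 aprod_pos)
  have i: "i \<in> {1..n}" using t by (auto simp: index_def i_def)
  have \<eta>: "\<eta> > 0" unfolding \<eta>_def using t by (intro eta_pos) (auto simp: index_def)
  have A: "A z \<in> Z" if "z \<in> Z" for z
    unfolding A_def using that b by (intro search_point_in convex_Z)
  let ?y = "\<alpha> *\<^sub>R v + (1 - \<alpha>) *\<^sub>R x"
  let ?L = "const_L (lev i)" and ?M = "const_M (lev i)"
  define X where "X = (fn i (A ?y) - (1 - \<alpha>) * fn i (A x) - \<alpha> * fn i (A u)) / (\<omega> * \<alpha>)"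
  have g: "g = grad (lev i) (t @ [j]) (A (\<alpha> *\<^sub>R zj + (1 - \<alpha>) *\<^sub>R x))"
    unfolding g_def search_point_snoc A_def \<alpha>_def x_def ..
  have 1: "X \<le> g \<bullet> (v - u) + ?L * \<omega> * \<alpha> / 2 * sqnorm P (v - zj) + err i / (\<omega> * \<alpha>)"
    unfolding X_def g
    by (rule accelerated_step[OF i \<omega> \<alpha> A]) (use mem in \<open>auto simp: A_def \<omega>_def search_point_diff x_def\<close>)
  have 2: "opQ (lev i) u \<bullet> (v - u) + \<eta> / 2 * (sqnorm P (z' - u) - sqnorm P (v - u))
      \<le> q \<bullet> (v - u) + ?M\<^sup>2 / \<eta> / 2 * sqnorm P (v - zj)"
    unfolding z'_def q_def by (rule extragradient_step[OF i \<eta> mem(2,1)])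
  have "?L * \<omega> * \<alpha> + ?M\<^sup>2 / \<eta> \<le> \<eta>"
    using eta_dominates[OF t] by (simp add: i_def \<eta>_def \<omega>_def \<alpha>_def mult.assoc)
  then have "(?L * \<omega> * \<alpha> + ?M\<^sup>2 / \<eta>) / 2 * sqnorm P (v - zj) \<le> \<eta> / 2 * sqnorm P (v - zj)"
    using sqnorm_nonneg by (intro mult_right_mono divide_right_mono) auto
  then have 3: "?L * \<omega> * \<alpha> / 2 * sqnorm P (v - zj) + ?M\<^sup>2 / \<eta> / 2 * sqnorm P (v - zj)
      \<le> \<eta> / 2 * sqnorm P (v - zj)"
    by (simp add: ring_distribs add_divide_distrib)
  have "level_gap b t u i ?y - (1 - \<alpha>) * level_gap b t u i x = \<alpha> * (X + opQ (lev i) u \<bullet> (v - u))"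
    unfolding level_gap_def A_def[symmetric] \<omega>_def[symmetric] X_def using \<omega> \<alpha>
    by (simp add: field_simps inner_diff_right inner_add_right)
  also have "\<dots> \<le> \<alpha> * ((g + q) \<bullet> (v - u)
         + \<eta> / 2 * (sqnorm P (v - zj) + sqnorm P (v - u) - sqnorm P (zj - u))
         - \<eta> / 2 * (sqnorm P (z' - u) - sqnorm P (zj - u)) + err i / (\<omega> * \<alpha>))"
    using 1 2 3 \<alpha> by (intro mult_left_mono) (simp_all add: ring_distribs inner_add_left)
  finally show ?thesis by (simp add: \<alpha>_def x_def \<omega>_def)
qed

text \<open>The distances telescope over a loop because their weights do not depend on \<open>j\<close>.\<close>

lemma coef_snoc:
  assumes "Suc (length t) \<le> i"
  shows "coef (t @ [j]) i / alpha j = coef t i / (tau (Suc (length t)))\<^sup>2"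
proof -
  have p: "(\<Prod>l=Suc (length t)..i. tau l) = tau (Suc (length t)) * (\<Prod>l=Suc (Suc (length t))..i. tau l)"
    using assms by (simp add: prod.atLeast_Suc_atMost)
  show ?thesis
    using tau_pos[of "Suc (length t)"] alpha_pos[of j]
    unfolding coef_def p by (simp add: field_simps power2_eq_square)
qed

lemma coef_eta: "coef (t @ [j]) (Suc (length t)) = eta lev (t @ [j])"
  unfolding coef_def eta_alt by simp

lemma inexactness_snoc:
  "inexactness (t @ [j]) i / alpha j = iter_inexactness t i / (alpha j)\<^sup>2"
  by (simp add: inexactness_def iter_inexactness_def power2_eq_square)

lemma strict_prefix_snoc: "strict_prefix t (t @ [j])"
  by (simp add: strict_prefix_def)

lemma inner_level_sum:
  "length t < n \<Longrightarrow> (\<Sum>i=Suc (length t)..n. f i) = f (Suc (length t)) + (\<Sum>i=Suc (Suc (length t))..n. f i)"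
  by (rule sum.atLeast_Suc_atMost) simp

text \<open>The loop invariant: after \<open>j\<close> iterations the average has the guarantee that \<open>rec_post\<close>
  demands of the result, with the total weight of these iterations in front.\<close>

definition loop_inv :: "'z run \<Rightarrow> nat list \<Rightarrow> nat \<Rightarrow> 'z run \<Rightarrow> bool" where
  "loop_inv st t j st' \<longleftrightarrow> unchanged_outside t st st' \<and> zb st' (t @ [j]) \<in> W \<and>
     (\<forall>l\<in>{Suc (length t)..n}. zc st' (pad l (t @ [j])) \<in> W) \<and>
     (\<forall>u\<in>Z. cum_weight j * gap st t u (zb st' (t @ [j])) + (\<Sum>i=Suc (length t)..n.
        coef t i / (tau (Suc (length t)))\<^sup>2 / 2 *
          dist_change st t st' (t @ [j]) u i
        - iter_inexactness t i
          * (\<Sum>s<j. 1 / (alpha s)\<^sup>2)) \<le> 0)"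

lemma advance_effect:
  fixes st :: "'z run"
  assumes rc: "rc (t @ [j]) (evaluate lev (t @ [j]) st) = (v, st1)"
  defines "t1 \<equiv> t @ [j]" and "t2 \<equiv> t @ [j + 1]" and "st' \<equiv> advance n Z P lev rc t j st"
  shows "zb st' = (zb st1)(t2 := alpha j *\<^sub>R v + (1 - alpha j) *\<^sub>R zb st1 t1)"
    and "gv st' = gv st1" and "qv st' = qv st1"
    and "zc st' t2 = arg_min_on (\<lambda>z. (opQ (lev (Suc (length t))) v - qv st1 t1) \<bullet> z
           + 1/2 * eta lev t1 * sqnorm P (z - v)) Z"
    and "l \<in> {Suc (Suc (length t))..n} \<Longrightarrow>
           zc st' (pad l t2) = zc st1 (pad l (t1 @ [loops (lev (Suc (Suc (length t))))]))"
    and "\<not> strict_prefix t s \<Longrightarrow> zc st' s = zc st1 s"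
proof -
  let ?T = "loops (lev (Suc (Suc (length t))))"
  define zc2 where "zc2 = (zc st1)(t2 := arg_min_on (\<lambda>z. (opQ (lev (Suc (length t))) v - qv st1 t1) \<bullet> z
           + 1/2 * eta lev t1 * sqnorm P (z - v)) Z)"
  define ls where "ls = [Suc (Suc (length t))..<Suc n]"
  define K S where "K = (\<lambda>l. pad l t2)" and "S = (\<lambda>l. pad l (t1 @ [?T]))"
  have zc: "zc st' = fold (\<lambda>l h. h(K l := h (S l))) ls zc2"
    unfolding st'_def advance_def Let_def zc2_def K_def S_def ls_def t1_def t2_def using rc by simp
  show "zb st' = (zb st1)(t2 := alpha j *\<^sub>R v + (1 - alpha j) *\<^sub>R zb st1 t1)"
    "gv st' = gv st1" "qv st' = qv st1"
    unfolding st'_def advance_def Let_def t1_def t2_def using rc by simp_all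
  have len: "length (K l) = l" "length (S l) = l" if "l \<in> set ls" for l
  proof -
    have "Suc (Suc (length t)) \<le> l" using that by (auto simp: ls_def)
    then have le: "length t2 \<le> l" "length (t1 @ [?T]) \<le> l" by (simp_all add: t1_def t2_def)
    show "length (K l) = l" unfolding K_def by (rule length_pad[OF le(1)])
    show "length (S l) = l" unfolding S_def by (rule length_pad[OF le(2)])
  qed
  have dist: "distinct ls" by (simp add: ls_def)
  have inj: "inj_on K (set ls)"
  proof (rule inj_onI)
    fix l l' assume l: "l \<in> set ls" "l' \<in> set ls" "K l = K l'"
    have "length (K l) = length (K l')" using l(3) by simp
    then show "l = l'" unfolding len(1)[OF l(1)] len(1)[OF l(2)] .
  qed
  have KS: "K l \<noteq> S l'" for l l'
  proof -
    have "K l ! length t = j + 1" "S l' ! length t = j"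
      by (simp_all add: K_def S_def t1_def t2_def pad_def nth_append)
    then show ?thesis by auto
  qed
  note fc = fold_copy[where K = K and S = S and ls = ls, OF dist inj KS]
  have short: "w \<noteq> t2" if "l \<in> set ls" "length w = l" for w l
    using that by (auto simp: ls_def t2_def)
  have t2: "t2 \<notin> K ` set ls" using short len(1) by blast
  show "zc st' t2 = arg_min_on (\<lambda>z. (opQ (lev (Suc (length t))) v - qv st1 t1) \<bullet> z
           + 1/2 * eta lev t1 * sqnorm P (z - v)) Z"
    unfolding zc fc(2)[OF t2] by (simp add: zc2_def)
  show "zc st' (pad l t2) = zc st1 (pad l (t1 @ [?T]))" if "l \<in> {Suc (Suc (length t))..n}"
  proof -
    have l: "l \<in> set ls" using that by (auto simp: ls_def)
    have "S l \<noteq> t2" using short[OF l len(2)[OF l]] .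
    then have "zc2 (S l) = zc st1 (S l)" unfolding zc2_def by (rule fun_upd_other)
    then show ?thesis using fc(1)[OF l, of zc2] unfolding zc K_def S_def by (rule trans[rotated])
  qed
  show "zc st' s = zc st1 s" if s: "\<not> strict_prefix t s"
  proof -
    have "strict_prefix t t2" unfolding t2_def by (rule strict_prefix_snoc)
    then have "s \<notin> K ` set ls" "s \<noteq> t2"
      using s strict_prefix_pad unfolding K_def by blast+
    then show ?thesis unfolding zc by (simp add: fc(2) zc2_def)
  qed
qed

text \<open>The guarantee of the inner call, weighted by \<open>1 / alpha j\<close>, is the increment of the invariant. Level
  by level, \<open>K0\<close>, \<open>K1\<close> and \<open>K2\<close> compare the gap at the new average \<open>y\<close> with the gap at the old
  average \<open>x\<close>.\<close>

lemma loop_step: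
  assumes pre: "rec_pre st0 t" and len: "length t < n" and j: "j < loops (lev (Suc (length t)))"
    and inv: "loop_inv st0 t j st"
    and rc: "\<And>st. rec_pre st (t @ [j]) \<Longrightarrow> rec_post st (t @ [j]) (fst (rc (t @ [j]) st)) (snd (rc (t @ [j]) st))"
  shows "loop_inv st0 t (Suc j) (advance n Z P lev rc t j st)"
proof -
  define k where "k = Suc (length t)"
  define t1 t2 where "t1 = t @ [j]" and "t2 = t @ [j + 1]"
  define ste where "ste = evaluate lev t1 st"
  define v st1 where "v = fst (rc t1 ste)" and "st1 = snd (rc t1 ste)"
  define st' where "st' = advance n Z P lev rc t j st"
  define x zj where "x = zb st t1" and "zj = zc st t1"
  define g q where "g = grad (lev k) t1 (search_point (zb st) t1 zj)" and "q = opQ (lev k) zj"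
  define \<alpha> \<eta> where "\<alpha> = alpha j" and "\<eta> = eta lev t1"
  have kn: "k \<in> {1..n}" and lt1: "length t1 = k" "length t2 = k"
    using len by (auto simp: k_def t1_def t2_def)
  have idx: "index t1"
    using pre j len by (simp add: rec_pre_def t1_def index_snoc)
  have inv_u: "unchanged_outside t st0 st" and xW: "x \<in> W"
    and zcW: "\<And>l. l \<in> {k..n} \<Longrightarrow> zc st (pad l t1) \<in> W"
    using inv by (auto simp: loop_inv_def x_def t1_def k_def)
  have zjW: "zj \<in> W" using zcW[of k] kn pad_length[of t1] by (simp add: zj_def lt1)
  have outer: "zc st (take l t) \<in> W" "zb st (take l t) \<in> W" "gv st (take l t) \<in> V" "qv st (take l t) \<in> V"
    if "l \<in> {1..length t}" for l
    using pre that by (auto simp: rec_pre_def unchanged_outside_take[OF inv_u])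
  have ev: "zc ste = zc st" "zb ste = zb st" "gv ste = (gv st)(t1 := g)" "qv ste = (qv st)(t1 := q)"
    by (simp_all add: ste_def evaluate_def Let_def g_def q_def zj_def lt1)
  have ue: "unchanged_outside t st ste"
    unfolding unchanged_outside_def ev using strict_prefix_snoc[of t j] by (auto simp: t1_def)
  have take_t1: "take l t1 = (if l = k then t1 else take l t)" if "l \<in> {1..k}" for l
    using that by (auto simp: t1_def k_def)
  have spZ: "search_point (zb st) t1 zj \<in> Z"
    using outer(2) xW zjW W_Z by (intro search_point_in convex_Z) (auto simp: lt1 take_t1 x_def k_def)
  have gqV: "g \<in> V" "q \<in> V"
    unfolding g_def q_def using grad_V[OF kn spZ] opQ_V[OF kn] by auto
  have pre1: "rec_pre ste t1"
    unfolding rec_pre_def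
  proof (intro conjI ballI)
    fix l assume "l \<in> {1..length t1}"
    then have l: "l \<in> {1..k}" by (simp add: lt1)
    have lt: "l \<in> {1..length t}" "take l t \<noteq> t1" if "l \<noteq> k"
    proof -
      show "l \<in> {1..length t}" using l that by (auto simp: k_def)
      have "length (take l t) < length t1" unfolding lt1 k_def by simp
      then show "take l t \<noteq> t1" by blast
    qed
    show "zc ste (take l t1) \<in> W" "zb ste (take l t1) \<in> W" "gv ste (take l t1) \<in> V" "qv ste (take l t1) \<in> V"
      unfolding take_t1[OF l] ev using lt outer[of l] xW zjW gqV
      by (cases "l = k"; simp add: x_def zj_def)+
  next
    fix l assume "l \<in> {Suc (length t1)..n}"
    then show "zc ste (pad l t1) \<in> W" using zcW by (simp add: lt1 ev)
  qed (rule idx)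
  define T2 where "T2 = loops (lev (Suc k))"
  have post: "rec_post ste t1 v st1"
    using rc[folded t1_def, OF pre1] by (simp add: v_def st1_def)
  then have u1: "unchanged_outside t1 ste st1" and vW: "v \<in> W"
    and W1: "\<And>l. l \<in> {Suc k..n} \<Longrightarrow> zc st1 (pad l (t1 @ [T2])) \<in> W"
    and ineq: "\<And>u. u \<in> Z \<Longrightarrow> gap ste t1 u v + (\<Sum>i=Suc k..n. coef t1 i / 2 *
        dist_change ste t1 st1 (t1 @ [T2]) u i - inexactness t1 i) \<le> 0"
    by (auto simp: rec_post_def lt1 T2_def ev)
  have "\<not> strict_prefix t1 t1" by simp
  then have s1: "zb st1 t1 = x" "qv st1 t1 = q"
    using u1 by (auto simp: unchanged_outside_def ev x_def)
  have "rc (t @ [j]) (evaluate lev (t @ [j]) st) = (v, st1)"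
    by (simp add: v_def st1_def ste_def t1_def)
  note eff = advance_effect[where rc = rc, OF this, folded t1_def t2_def st'_def k_def T2_def]
  define y z' where "y = \<alpha> *\<^sub>R v + (1 - \<alpha>) *\<^sub>R x"
    and "z' = arg_min_on (\<lambda>z. (opQ (lev k) v - q) \<bullet> z + 1/2 * \<eta> * sqnorm P (z - v)) Z"
  have zb': "zb st' t2 = y" unfolding eff(1) by (simp add: y_def s1 \<alpha>_def)
  have zc': "zc st' t2 = z'" unfolding eff(4) z'_def s1 \<eta>_def ..
  have \<alpha>: "0 < \<alpha>" "\<alpha> \<le> 1" by (simp_all add: \<alpha>_def alpha_pos alpha_le_1)
  have \<eta>: "\<eta> > 0" unfolding \<eta>_def using kn by (intro eta_pos) (auto simp: t1_def k_def)
  have yW: "y \<in> W" unfolding y_def using \<alpha> vW xW by (intro convexD[OF convex_W]) auto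
  have z'W: "z' \<in> W"
    unfolding z'_def
  proof (rule prox_step(3)[OF \<eta>])
    show "opQ (lev k) v - q \<in> V" using opQ_V[OF kn] gqV subspace_diff[OF subspace_V] by blast
  qed (use vW in \<open>auto simp: W_def\<close>)
  have u2: "unchanged_outside t st1 st'"
    unfolding unchanged_outside_def
  proof (intro allI impI conjI)
    fix s assume s: "\<not> strict_prefix t s"
    then have "s \<noteq> t2" using strict_prefix_snoc[of t "j + 1"] unfolding t2_def by blast
    then show "zb st' s = zb st1 s" unfolding eff(1) by simp
    show "zc st' s = zc st1 s" by (rule eff(6)[OF s])
  qed (simp_all only: eff(2,3))
  have "prefix t t1" by (simp add: t1_def)
  then have u: "unchanged_outside t st0 st'"
    using unchanged_outside_trans[OF inv_u unchanged_outside_trans[OF ue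
        unchanged_outside_trans[OF unchanged_outside_prefix[OF u1] u2]]] by blast
  have pads: "zc st' (pad l t2) = (if l = k then z' else zc st1 (pad l (t1 @ [T2])))" if "l \<in> {k..n}" for l
  proof (cases "l = k")
    case True
    then show ?thesis using zc' pad_length[of t2] by (simp add: lt1)
  next
    case False
    then have "l \<in> {Suc k..n}" using that by auto
    from eff(5)[OF this] show ?thesis using False by (simp add: T2_def)
  qed
  have padsW: "zc st' (pad l t2) \<in> W" if "l \<in> {k..n}" for l
  proof (cases "l = k")
    case False
    then have "l \<in> {Suc k..n}" using that by auto
    then show ?thesis using pads[OF that] W1 False by simp
  qed (use pads[OF that] z'W in simp)
  have key: "cum_weight (Suc j) * gap st0 t u y + (\<Sum>i=k..n. coef t i / (tau k)\<^sup>2 / 2 *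
          dist_change st0 t st' t2 u i
        - iter_inexactness t i * (\<Sum>s<Suc j. 1 / (alpha s)\<^sup>2)) \<le> 0"
    if uZ: "u \<in> Z" for u
  proof -
    define d where "d = dist_change st t1 st' t2 u"
    let ?w = "\<lambda>i. coef t i / (tau k)\<^sup>2 / 2"
    let ?I = "\<Sum>i=k..n. coef t1 i / 2 * d i - inexactness t1 i"
    define E where "E = (g + q) \<bullet> (v - u) + \<eta> / 2 * (sqnorm P (v - zj) + sqnorm P (v - u) - sqnorm P (zj - u))"
    define G where "G = level_gap (zb st) t u"
    have gap0: "gap st0 t u w = outer_terms st t u w + G k w + (\<Sum>i=Suc k..n. G i w)" for w
      using gap_unchanged[OF inv_u, of u w, symmetric] inner_level_sum[OF len, of "\<lambda>i. G i w"]
      by (simp add: gap_def G_def k_def)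
    have out1: "outer_terms ste t1 u v = outer_terms st t u v + E"
    proof -
      have "outer_terms ste t1 u v = (\<Sum>i=1..length t. prox_term ste (take i t1) u v) + prox_term ste t1 u v"
        unfolding outer_terms_def lt1 unfolding k_def by (simp add: t1_def)
      moreover have "prox_term ste t1 u v = E"
        by (simp add: prox_term_def E_def ev zj_def \<eta>_def)
      moreover have "(\<Sum>i=1..length t. prox_term ste (take i t1) u v) = outer_terms st t u v"
        unfolding outer_terms_def
      proof (rule sum.cong[OF refl])
        fix i assume "i \<in> {1..length t}"
        then have t: "take i t1 = take i t" by (simp add: t1_def)
        have "length (take i t) < length t1" unfolding lt1 k_def by simp
        then have "take i t \<noteq> t1" by blast
        then show "prox_term ste (take i t1) u v = prox_term st (take i t) u v"
          unfolding t prox_term_def ev by simp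
      qed
      ultimately show ?thesis by simp
    qed
    have gape: "gap ste t1 u v = outer_terms st t u v + E + (\<Sum>i=Suc k..n. level_gap (zb st) t1 u i v)"
      unfolding gap_def out1 by (simp add: lt1 ev)
    have K0: "outer_terms st t u y - (1 - \<alpha>) * outer_terms st t u x \<le> \<alpha> * outer_terms st t u v"
      using outer_terms_convex[of t \<alpha> st u v x] \<alpha> pre unfolding y_def rec_pre_def by simp
    have bZ: "zb st (take l t) \<in> Z" if "l \<in> {1..length t}" for l
      using outer(2)[OF that] W_Z by blast
    have K1: "(\<Sum>i=Suc k..n. G i y) - (1 - \<alpha>) * (\<Sum>i=Suc k..n. G i x)
        \<le> \<alpha> * (\<Sum>i=Suc k..n. level_gap (zb st) t1 u i v)"
      unfolding sum_distrib_left sum_subtractf[symmetric]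
    proof (rule sum_mono)
      fix i assume "i \<in> {Suc k..n}"
      then have "i \<in> {1..n}" by auto
      then show "G i y - (1 - \<alpha>) * G i x \<le> \<alpha> * level_gap (zb st) t1 u i v"
        unfolding G_def y_def \<alpha>_def x_def t1_def
        by (rule level_gap_inner) (use bZ uZ vW xW W_Z in \<open>auto simp: x_def t1_def\<close>)
    qed
    have K2: "G k y - (1 - \<alpha>) * G k x
        \<le> \<alpha> * (E - \<eta> / 2 * (sqnorm P (z' - u) - sqnorm P (zj - u)) + err k / (aprod t * \<alpha>))"
      unfolding G_def y_def E_def z'_def g_def q_def \<eta>_def \<alpha>_def x_def k_def t1_def
      by (rule level_gap_current) (use idx bZ uZ vW xW zjW W_Z in \<open>auto simp: x_def t1_def\<close>)
    have dk: "d k = sqnorm P (z' - u) - sqnorm P (zj - u)"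
      using pads[of k] kn pad_length[of t1] by (simp add: d_def dist_change_def zj_def lt1)
    have ck: "coef t1 k / 2 * d k - inexactness t1 k
        = \<eta> / 2 * (sqnorm P (z' - u) - sqnorm P (zj - u)) - err k / (aprod t * \<alpha>)"
    proof -
      have "coef t1 k = \<eta>" unfolding t1_def k_def coef_eta \<eta>_def ..
      moreover have "inexactness t1 k = err k / (aprod t * \<alpha>)"
        by (simp add: inexactness_def t1_def k_def \<alpha>_def)
      ultimately show ?thesis by (simp only: dk)
    qed
    have sum_k: "(\<Sum>i=k..n. f i) = f k + (\<Sum>i=Suc k..n. f i)" for f :: "nat \<Rightarrow> real"
      using inner_level_sum[OF len, of f] by (simp add: k_def)
    have "gap ste t1 u v + (\<Sum>i=Suc k..n. coef t1 i / 2 * d i - inexactness t1 i) \<le> 0"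
    proof -
      have "(\<Sum>i=Suc k..n. coef t1 i / 2 * d i - inexactness t1 i) = (\<Sum>i=Suc k..n. coef t1 i / 2 *
        dist_change ste t1 st1 (t1 @ [T2]) u i - inexactness t1 i)"
        by (rule sum.cong[OF refl]) (simp add: d_def dist_change_def pads ev)
      then show ?thesis using ineq[OF uZ] by simp
    qed
    then have R: "gap ste t1 u v - \<eta> / 2 * (sqnorm P (z' - u) - sqnorm P (zj - u)) + err k / (aprod t * \<alpha>)
        \<le> - ?I"
      using ck sum_k[of "\<lambda>i. coef t1 i / 2 * d i - inexactness t1 i"] by linarith
    have "gap st0 t u y - (1 - \<alpha>) * gap st0 t u x
        \<le> \<alpha> * (gap ste t1 u v - \<eta> / 2 * (sqnorm P (z' - u) - sqnorm P (zj - u)) + err k / (aprod t * \<alpha>))"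
      unfolding gap0 gape using K0 K1 K2 by (simp add: ring_distribs)
    also have "\<dots> \<le> \<alpha> * - ?I"
      using R \<alpha> by (intro mult_left_mono) auto
    finally have "(gap st0 t u y - (1 - \<alpha>) * gap st0 t u x) / \<alpha>\<^sup>2
        \<le> (\<alpha> * - ?I) / \<alpha>\<^sup>2"
      by (rule divide_right_mono) simp
    also have "\<dots> = - (\<Sum>i=k..n. (coef t1 i / \<alpha>) / 2 * d i - inexactness t1 i / \<alpha>)"
      using \<alpha> by (simp add: power2_eq_square sum_divide_distrib diff_divide_distrib mult.commute)
    also have "(\<Sum>i=k..n. (coef t1 i / \<alpha>) / 2 * d i - inexactness t1 i / \<alpha>)
        = (\<Sum>i=k..n. ?w i * d i - iter_inexactness t i / \<alpha>\<^sup>2)"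
      by (rule sum.cong[OF refl])
        (simp add: \<alpha>_def t1_def k_def coef_snoc inexactness_snoc)
    finally have step: "(gap st0 t u y - (1 - \<alpha>) * gap st0 t u x) / \<alpha>\<^sup>2
        \<le> - (\<Sum>i=k..n. ?w i * d i - iter_inexactness t i / \<alpha>\<^sup>2)" .
    (* The recursion for the step sizes makes the old average appear with its old weight. *)
    have "(gap st0 t u y - (1 - \<alpha>) * gap st0 t u x) / \<alpha>\<^sup>2
        = cum_weight (Suc j) * gap st0 t u y - cum_weight j * gap st0 t u x"
      unfolding cum_weight_Suc cum_weight_contract[of j, symmetric] \<alpha>_def
      by (simp only: diff_divide_distrib[of "gap st0 t u y"] times_divide_eq_left mult_1_left)
    with step have step': "cum_weight (Suc j) * gap st0 t u y - cum_weight j * gap st0 t u x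
        + (\<Sum>i=k..n. ?w i * d i - iter_inexactness t i / \<alpha>\<^sup>2) \<le> 0"
      by linarith
    have old: "cum_weight j * gap st0 t u x + (\<Sum>i=k..n. ?w i * dist_change st0 t st t1 u i - iter_inexactness t i * (\<Sum>s<j. 1 / (alpha s)\<^sup>2)) \<le> 0"
      using inv uZ unfolding loop_inv_def by (simp add: x_def t1_def k_def)
    have "(\<Sum>i=k..n. ?w i * dist_change st0 t st' t2 u i - iter_inexactness t i * (\<Sum>s<Suc j. 1 / (alpha s)\<^sup>2))
      = (\<Sum>i=k..n. ?w i * dist_change st0 t st t1 u i - iter_inexactness t i * (\<Sum>s<j. 1 / (alpha s)\<^sup>2))
      + (\<Sum>i=k..n. ?w i * d i - iter_inexactness t i / \<alpha>\<^sup>2)"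
      unfolding sum.distrib[symmetric] d_def dist_change_def \<alpha>_def sum.lessThan_Suc
      by (rule sum.cong[OF refl]) (simp add: right_diff_distrib distrib_left)
    then show ?thesis using old step' by linarith
  qed
  have t2': "t @ [Suc j] = t2" by (simp add: t2_def)
  show ?thesis
    unfolding loop_inv_def st'_def[symmetric] t2' k_def[symmetric] zb'
    using u yW padsW key by blast
qed

lemma loop_start:
  assumes pre: "rec_pre st t" and len: "length t < n"
  shows "loop_inv st t 0 (st\<lparr>zb := (zb st)(t @ [0] := zc st (t @ [0]))\<rparr>)"
proof -
  have pads: "pad l (t @ [0]) = pad l t" if "l \<in> {Suc (length t)..n}" for l
    using that by (intro pad_snoc_0) auto
  have "pad (Suc (length t)) t = t @ [0]" by (simp add: pad_def)
  then have "zc st (t @ [0]) \<in> W" using pre len unfolding rec_pre_def by (metis Suc_leI atLeastAtMost_iff order_refl)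
  moreover have "unchanged_outside t st (st\<lparr>zb := (zb st)(t @ [0] := zc st (t @ [0]))\<rparr>)"
    using strict_prefix_snoc[of t 0] by (auto simp: unchanged_outside_def)
  ultimately show ?thesis
    unfolding loop_inv_def using pre pads by (auto simp: rec_pre_def cum_weight_def dist_change_def)
qed

text \<open>Since the step sizes decrease, each iteration counts at most once after normalization.\<close>

lemma weighted_error_le:
  assumes "T \<ge> 1"
  shows "(alpha (T - 1))\<^sup>2 * (\<Sum>s<T. 1 / (alpha s)\<^sup>2) \<le> real T"
proof -
  have "(alpha (T - 1))\<^sup>2 * (1 / (alpha s)\<^sup>2) \<le> 1" if "s < T" for s
    using alpha_decreasing[of s "T - 1"] alpha_pos[of s] alpha_pos[of "T - 1"] that
    by (simp add: divide_le_eq_1 power_mono)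
  then have "(\<Sum>s<T. (alpha (T - 1))\<^sup>2 * (1 / (alpha s)\<^sup>2)) \<le> (\<Sum>s<T. 1)"
    by (intro sum_mono) auto
  then show ?thesis by (simp add: sum_distrib_left)
qed

lemma loop_finish:
  assumes len: "length t < n" and inv: "loop_inv st t (loops (lev (Suc (length t)))) st'"
  shows "rec_post st t (zb st' (t @ [loops (lev (Suc (length t)))])) st'"
proof -
  define k T where "k = Suc (length t)" and "T = loops (lev (Suc (length t)))"
  have T: "T \<ge> 1" unfolding T_def using len by (intro loops_ge_1) auto
  have tau: "tau k = alpha (T - 1)" by (simp add: tau_def k_def T_def)
  have "gap st t u (zb st' (t @ [T])) + (\<Sum>i=k..n. coef t i / 2 *
        dist_change st t st' (t @ [T]) u i - inexactness t i) \<le> 0"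
    if u: "u \<in> Z" for u
  proof -
    define g where "g = gap st t u (zb st' (t @ [T]))"
    define d where "d = dist_change st t st' (t @ [T]) u"
    define e where "e = iter_inexactness t"
    define X where "X = (\<Sum>s<T. 1 / (alpha s)\<^sup>2)"
    have "cum_weight T * g + (\<Sum>i=k..n. coef t i / (tau k)\<^sup>2 / 2 * d i - e i * X) \<le> 0"
      using inv u by (simp add: loop_inv_def g_def d_def e_def X_def k_def T_def)
    then have "(tau k)\<^sup>2 * (cum_weight T * g + (\<Sum>i=k..n. coef t i / (tau k)\<^sup>2 / 2 * d i - e i * X)) \<le> 0"
      by (simp add: mult_le_0_iff)
    moreover have "(tau k)\<^sup>2 * (cum_weight T * g) = g"
      using T alpha_pos[of "T - 1"] by (simp add: tau cum_weight_def)
    moreover have "(tau k)\<^sup>2 * (\<Sum>i=k..n. coef t i / (tau k)\<^sup>2 / 2 * d i - e i * X)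
        = (\<Sum>i=k..n. coef t i / 2 * d i - e i * ((tau k)\<^sup>2 * X))"
      unfolding sum_distrib_left using tau_pos[of k]
      by (intro sum.cong[OF refl]) (simp add: field_simps)
    moreover have "(\<Sum>i=k..n. coef t i / 2 * d i - inexactness t i)
        \<le> (\<Sum>i=k..n. coef t i / 2 * d i - e i * ((tau k)\<^sup>2 * X))"
    proof (rule sum_mono)
      fix i assume i: "i \<in> {k..n}"
      then have "err i \<ge> 0" by (intro err_nonneg) (auto simp: k_def)
      then have e: "e i \<ge> 0"
        unfolding e_def iter_inexactness_def using aprod_pos[of t]
        by (intro mult_nonneg_nonneg divide_nonneg_pos prod_nonneg) auto
      have "e i * ((tau k)\<^sup>2 * X) \<le> e i * real T"
        unfolding tau X_def using weighted_error_le[OF T] e by (rule mult_left_mono)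
      also have "\<dots> = inexactness t i"
        using i by (simp add: inexactness_def e_def iter_inexactness_def k_def T_def prod.atLeast_Suc_atMost)
      finally show "coef t i / 2 * d i - inexactness t i \<le> coef t i / 2 * d i - e i * ((tau k)\<^sup>2 * X)"
        by simp
    qed
    ultimately show ?thesis unfolding g_def[symmetric] d_def[symmetric] by (simp add: distrib_left)
  qed
  then show ?thesis
    using inv unfolding rec_post_def loop_inv_def k_def T_def by blast
qed

lemma rec_correct:
  assumes "length t + m = n" and "rec_pre st t"
  shows "rec_post st t (fst (slide_rec n Z P lev m t st)) (snd (slide_rec n Z P lev m t st))"
  using assms
proof (induction m arbitrary: t st)
  case 0
  then show ?case using rec_post_leaf by simp
next
  case (Suc m)
  define T where "T = loops (lev (Suc (length t)))"
  define sts where "sts = st\<lparr>zb := (zb st)(t @ [0] := zc st (t @ [0]))\<rparr>"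
  have len: "length t < n" using Suc.prems by simp
  have "loop_inv st t j (fold (advance n Z P lev (slide_rec n Z P lev m) t) [0..<j] sts)" if "j \<le> T" for j
    using that
  proof (induction j)
    case 0
    then show ?case using loop_start[OF Suc.prems(2) len] by (simp add: sts_def)
  next
    case (Suc j)
    have "loop_inv st t (Suc j) (advance n Z P lev (slide_rec n Z P lev m) t j
        (fold (advance n Z P lev (slide_rec n Z P lev m) t) [0..<j] sts))"
    proof (rule loop_step[OF \<open>rec_pre st t\<close> len])
      show "rec_post st (t @ [j]) (fst (slide_rec n Z P lev m (t @ [j]) st)) (snd (slide_rec n Z P lev m (t @ [j]) st))"
        if "rec_pre st (t @ [j])" for st
        using that \<open>length t + Suc m = n\<close> by (intro Suc.prems Suc.IH \<open>\<And>t st. length t + m = n \<Longrightarrow> rec_pre st t \<Longrightarrow> rec_post st t (fst (slide_rec n Z P lev m t st)) (snd (slide_rec n Z P lev m t st))\<close>) auto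
    qed (use Suc in \<open>auto simp: T_def\<close>)
    then show ?case by simp
  qed
  from loop_finish[OF len this[of T, unfolded T_def]] show ?case
    by (simp add: Let_def sts_def T_def)
qed

text \<open>For the whole algorithm nothing is fixed from outside, and the exit distances can be
  dropped.\<close>

theorem sliding_correct:
  assumes z: "z_in \<in> W"
  defines "v \<equiv> fst (sliding n Z P lev z_in)"
  shows "v \<in> W"
    and "u \<in> Z \<Longrightarrow> (\<Sum>i=1..n. fn i v - fn i u + opQ (lev i) u \<bullet> (v - u))
      \<le> (\<Sum>i=1..n. (const_L (lev i) * (\<Prod>l=1..i. tau l)\<^sup>2 + const_M (lev i) * (\<Prod>l=1..i. tau l)) / 2
            * sqnorm P (z_in - u) + err i * (\<Prod>l=1..i. real (loops (lev l))))"
    (is "_ \<Longrightarrow> ?gap \<le> ?bound")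
proof -
  have "rec_pre (start_run z_in) []"
    using z by (auto simp: rec_pre_def index_def start_run_def pad_def)
  then have post: "rec_post (start_run z_in) [] v (snd (sliding n Z P lev z_in))"
    unfolding v_def sliding_def by (intro rec_correct) auto
  then show "v \<in> W" by (simp add: rec_post_def)
  assume u: "u \<in> Z"
  define st' where "st' = snd (sliding n Z P lev z_in)"
  have start: "zc (start_run z_in) (pad i []) = z_in" for i
    by (cases "i = 0") (simp_all add: start_run_def pad_def)
  define d where "d = dist_change (start_run z_in) [] st' [loops (lev 1)] u"
  have "gap (start_run z_in) [] u v + (\<Sum>i=1..n. coef [] i / 2 * d i - inexactness [] i) \<le> 0"
    using post u unfolding rec_post_def st'_def d_def by simp
  moreover have "(\<Sum>i=1..n. - (coef [] i / 2 * sqnorm P (z_in - u) + inexactness [] i))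
      \<le> (\<Sum>i=1..n. coef [] i / 2 * d i - inexactness [] i)"
  proof (rule sum_mono)
    fix i assume i: "i \<in> {1..n}"
    have "(\<Prod>l=1..i. tau l) \<ge> 0" using tau_pos by (simp add: prod_nonneg less_imp_le)
    then have "coef [] i \<ge> 0"
      unfolding coef_def using L_pos[OF i] M_nonneg[OF i] by simp
    then have "coef [] i / 2 * - sqnorm P (z_in - u) \<le> coef [] i / 2 * d i"
      using sqnorm_nonneg by (intro mult_left_mono) (simp_all add: d_def dist_change_def start)
    then show "- (coef [] i / 2 * sqnorm P (z_in - u) + inexactness [] i)
        \<le> coef [] i / 2 * d i - inexactness [] i" by simp
  qed
  moreover have "gap (start_run z_in) [] u v = ?gap"
    by (simp add: gap_def outer_terms_def level_gap_def)
  moreover have "(\<Sum>i=1..n. coef [] i / 2 * sqnorm P (z_in - u) + inexactness [] i) = ?bound"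
    by (simp add: coef_def inexactness_def)
  ultimately show "?gap \<le> ?bound" unfolding sum_negf by linarith
qed

end

section \<open>Numbers of evaluations\<close>

lemma advance_counts:
  assumes "rc (t @ [j]) (evaluate lev (t @ [j]) st) = (v, st1)"
  shows "n_grad (advance n Z P lev rc t j st) = n_grad st1"
    and "n_op (advance n Z P lev rc t j st)
      = (n_op st1)(length t + 1 := n_op st1 (length t + 1) + 1)"
  using assms by (simp_all add: advance_def Let_def)

definition level_evals :: "nat \<Rightarrow> (nat \<Rightarrow> 'z level) \<Rightarrow> nat \<Rightarrow> nat \<Rightarrow> nat" where
  "level_evals n lev k i = (if i \<in> {Suc k..n} then \<Prod>l=Suc k..i. loops (lev l) else 0)"

text \<open>Each pass of the loop of level \<open>length t + 1\<close> evaluates the pair of that level once and its operator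
  a second time at the inner result, while the deeper levels are counted by the inner call.\<close>

lemma slide_rec_counts:
  assumes "length t + m = n"
  shows "n_grad (snd (slide_rec n Z P lev m t st)) i = n_grad st i + level_evals n lev (length t) i" (is ?G)
    and "n_op (snd (slide_rec n Z P lev m t st)) i = n_op st i + 2 * level_evals n lev (length t) i" (is ?O)
proof -
  have "n_grad (snd (slide_rec n Z P lev m t st)) i = n_grad st i + level_evals n lev (length t) i \<and>
        n_op (snd (slide_rec n Z P lev m t st)) i = n_op st i + 2 * level_evals n lev (length t) i"
    using assms
  proof (induction m arbitrary: t st)
    case (Suc m)
    define k where "k = length t"
    define c where "c = (if i \<in> {Suc k..n} then \<Prod>l=Suc (Suc k)..i. loops (lev l) else 0)"
    have kn: "Suc k \<le> n" using Suc.prems by (simp add: k_def)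
    have step: "n_grad (advance n Z P lev (slide_rec n Z P lev m) t j st) i = n_grad st i + c \<and>
        n_op (advance n Z P lev (slide_rec n Z P lev m) t j st) i = n_op st i + 2 * c" for j st
    proof -
      define ste where "ste = evaluate lev (t @ [j]) st"
      obtain v st1 where r: "slide_rec n Z P lev m (t @ [j]) ste = (v, st1)" by fastforce
      have IH: "n_grad st1 i = n_grad ste i + level_evals n lev (Suc k) i \<and>
         n_op st1 i = n_op ste i + 2 * level_evals n lev (Suc k) i"
        using Suc.IH[of "t @ [j]" ste] Suc.prems r by (simp add: k_def)
      have e: "n_grad ste i = n_grad st i + (if i = Suc k then 1 else 0)"
        "n_op ste i = n_op st i + (if i = Suc k then 1 else 0)"
        by (simp_all add: ste_def evaluate_def Let_def k_def)
      have a: "n_grad (advance n Z P lev (slide_rec n Z P lev m) t j st) i = n_grad st1 i"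
        "n_op (advance n Z P lev (slide_rec n Z P lev m) t j st) i = n_op st1 i + (if i = Suc k then 1 else 0)"
        using advance_counts[where rc = "slide_rec n Z P lev m", OF r[unfolded ste_def]] by (simp_all add: k_def)
      consider "i = Suc k" | "i \<in> {Suc (Suc k)..n}" | "i \<notin> {Suc k..n}"
        by fastforce
      then show ?thesis
      proof cases
        case 3
        then have f: "(i \<in> {Suc k..n}) = False" "(i \<in> {Suc (Suc k)..n}) = False" "(i = Suc k) = False"
          using kn by auto
        show ?thesis using IH unfolding a c_def e level_evals_def f if_False by simp
      qed (unfold a c_def, use IH e kn in \<open>simp_all add: level_evals_def\<close>)
    qed
    have fold: "n_grad (fold (advance n Z P lev (slide_rec n Z P lev m) t) [0..<j] st) i = n_grad st i + j * c \<and>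
        n_op (fold (advance n Z P lev (slide_rec n Z P lev m) t) [0..<j] st) i = n_op st i + 2 * (j * c)" for j st
      by (induction j) (simp_all add: step)
    have "loops (lev (Suc k)) * c = level_evals n lev k i"
      by (simp add: c_def level_evals_def prod.atLeast_Suc_atMost)
    with fold[of "loops (lev (Suc k))" "st\<lparr>zb := (zb st)(t @ [0] := zc st (t @ [0]))\<rparr>"] show ?case
      by (simp add: Let_def k_def)
  qed (simp add: level_evals_def)
  then show ?G ?O by simp_all
qed

lemma sliding_counts:
  assumes "i \<in> {1..n}"
  shows "n_grad (snd (sliding n Z P lev z_in)) i = (\<Prod>l=1..i. loops (lev l))"
    and "n_op (snd (sliding n Z P lev z_in)) i = 2 * (\<Prod>l=1..i. loops (lev l))"
  using assms by (simp_all add: sliding_def slide_rec_counts level_evals_def start_run_def)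

section \<open>Convex functions with Hoelder continuous subgradients\<close>

text \<open>Up to its normalization the sum is a Riemann sum of \<open>s powr \<nu>\<close>; each summand is bounded by the
  increment of the antiderivative over the next unit interval.\<close>

lemma powr_sum_le:
  assumes "0 \<le> \<nu>"
  shows "(1 + \<nu>) * (\<Sum>i=1..N. real i powr \<nu>) \<le> real (N + 1) powr (1 + \<nu>)"
proof (induction N)
  case (Suc N)
  define a where "a = real (Suc N)"
  have a: "a > 0" by (simp add: a_def)
  have "\<exists>z>a. z < a + 1 \<and> (a + 1) powr (1 + \<nu>) - a powr (1 + \<nu>)
      = (a + 1 - a) * ((1 + \<nu>) * z powr (1 + \<nu> - 1))"
    using a by (intro MVT2 has_real_derivative_powr) auto
  then obtain z where z: "a < z"
    and mvt: "(a + 1) powr (1 + \<nu>) - a powr (1 + \<nu>) = (1 + \<nu>) * z powr \<nu>" by auto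
  have "a powr \<nu> \<le> z powr \<nu>" using a z assms by (intro powr_mono2) auto
  then have "(1 + \<nu>) * a powr \<nu> \<le> (1 + \<nu>) * z powr \<nu>" using assms by (intro mult_left_mono) auto
  then have "(1 + \<nu>) * a powr \<nu> \<le> (a + 1) powr (1 + \<nu>) - a powr (1 + \<nu>)" using mvt by simp
  then show ?case using Suc by (simp add: a_def ring_distribs add_ac)
qed simp

definition holder_subgradients :: "'a::real_inner set \<Rightarrow> ('a \<Rightarrow> real) \<Rightarrow> real \<Rightarrow> real \<Rightarrow> bool" where
  "holder_subgradients X f \<nu> H \<longleftrightarrow> (\<forall>x\<in>X. \<forall>x'\<in>X. \<forall>v\<in>subdifferential f x. \<forall>v'\<in>subdifferential f x'.
     norm (v - v') \<le> holder_bound \<nu> H (norm (x - x')))"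

text \<open>Summing the subgradient inequalities along an equidistant subdivision of the segment bounds the
  increment by a Riemann sum of \<open>s \<mapsto> H s powr \<nu>\<close>; the bound follows as the mesh tends to zero. This
  avoids differentiating along the segment.\<close>

lemma holder_descent:
  fixes f :: "'a::real_inner \<Rightarrow> real"
  assumes X: "convex X" and sub: "\<And>x. x \<in> X \<Longrightarrow> subdifferential f x \<noteq> {}"
    and hold: "holder_subgradients X f \<nu> H" and \<nu>: "0 \<le> \<nu>" and H: "H \<ge> 0"
    and xy: "x \<in> X" "y \<in> X" and v: "v \<in> subdifferential f x"
  shows "f y \<le> f x + v \<bullet> (y - x) + H / (1 + \<nu>) * norm (y - x) powr (1 + \<nu>)"
proof (cases "y = x")
  case False
  define r where "r = norm (y - x)"
  have r: "r > 0" using False by (simp add: r_def)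
  define C where "C = H / (1 + \<nu>) * r powr (1 + \<nu>)"
  have bound: "f y - f x - v \<bullet> (y - x) \<le> C * ((real N + 1) / real N) powr (1 + \<nu>)" if N: "N \<ge> 1" for N :: nat
  proof -
    define p where "p i = x + (real i / real N) *\<^sub>R (y - x)" for i :: nat
    have pX: "p i \<in> X" if "i \<le> N" for i
    proof -
      have "p i = (1 - real i / real N) *\<^sub>R x + (real i / real N) *\<^sub>R y"
        by (simp add: p_def algebra_simps)
      then show ?thesis using that N xy convexD_alt[OF X xy, of "real i / real N"] by simp
    qed
    define g where "g i = (SOME w. w \<in> subdifferential f (p i))" for i
    have g: "g i \<in> subdifferential f (p i)" if "i \<le> N" for i
      unfolding g_def using sub[OF pX[OF that]] by (simp add: some_in_eq)
    have inc: "f (p (Suc i)) - f (p i) - (1 / real N) * (v \<bullet> (y - x))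
        \<le> H * r powr (1 + \<nu>) * real N powr (- (1 + \<nu>)) * real (Suc i) powr \<nu>" if i: "i < N" for i
    proof -
      have d: "p i - p (Suc i) = - (1 / real N) *\<^sub>R (y - x)"
        using N by (simp add: p_def algebra_simps diff_divide_distrib add_divide_distrib)
      have "f (p (Suc i)) + g (Suc i) \<bullet> (p i - p (Suc i)) \<le> f (p i)"
        using g[of "Suc i"] i by (simp add: subdifferential_def)
      then have "f (p (Suc i)) - f (p i) - (1 / real N) * (v \<bullet> (y - x))
          \<le> (1 / real N) * ((g (Suc i) - v) \<bullet> (y - x))"
        unfolding d by (simp add: inner_diff_left right_diff_distrib)
      also have "(g (Suc i) - v) \<bullet> (y - x) \<le> norm (g (Suc i) - v) * r"
        unfolding r_def by (rule norm_cauchy_schwarz)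
      also have "norm (g (Suc i) - v) \<le> H * (real (Suc i) / real N * r) powr \<nu>"
      proof -
        have "norm (p (Suc i) - x) = real (Suc i) / real N * r"
          by (simp add: p_def r_def)
        moreover have "norm (g (Suc i) - v) \<le> holder_bound \<nu> H (norm (p (Suc i) - x))"
          using hold g[of "Suc i"] v xy pX[of "Suc i"] i unfolding holder_subgradients_def by auto
        moreover have "real (Suc i) / real N * r > 0" using r N by simp
        ultimately show ?thesis by (auto simp: holder_bound_def split: if_splits)
      qed
      also have "1 / real N * (H * (real (Suc i) / real N * r) powr \<nu> * r)
          = H * r powr (1 + \<nu>) * real N powr (- (1 + \<nu>)) * real (Suc i) powr \<nu>"
      proof -
        have "(real (Suc i) / real N * r) powr \<nu> = real (Suc i) powr \<nu> * real N powr (- \<nu>) * r powr \<nu>"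
          using r N by (simp add: powr_mult powr_divide powr_minus_divide)
        moreover have "r powr (1 + \<nu>) = r * r powr \<nu>" using r by (simp add: powr_add)
        moreover have "real N powr (- (1 + \<nu>)) = real N powr (- \<nu>) / real N"
        proof -
          have "real N powr (- (1 + \<nu>)) = real N powr (- \<nu> - 1)"
            by (rule arg_cong[of _ _ "(powr) (real N)"]) simp
          also have "\<dots> = real N powr (- \<nu>) / real N" using N by (simp add: powr_diff)
          finally show ?thesis .
        qed
        ultimately show ?thesis by (simp only: times_divide_eq_left times_divide_eq_right mult_ac mult_1_left)
      qed
      finally show ?thesis using r N by (simp add: mult_right_mono mult_left_mono divide_right_mono)
    qed
    have "f y - f x - v \<bullet> (y - x) = (\<Sum>i<N. f (p (Suc i)) - f (p i)) - v \<bullet> (y - x)"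
    proof -
      have "p N = y" "p 0 = x" using N by (simp_all add: p_def)
      then show ?thesis using sum_lessThan_telescope[of "\<lambda>i. f (p i)" N] by simp
    qed
    also have "\<dots> = (\<Sum>i<N. f (p (Suc i)) - f (p i) - (1 / real N) * (v \<bullet> (y - x)))"
      unfolding sum_subtractf using N by simp
    also have "\<dots> \<le> (\<Sum>i<N. H * r powr (1 + \<nu>) * real N powr (- (1 + \<nu>)) * real (Suc i) powr \<nu>)"
      by (rule sum_mono) (use inc in auto)
    also have "\<dots> = H * r powr (1 + \<nu>) * real N powr (- (1 + \<nu>)) * (\<Sum>i=1..N. real i powr \<nu>)"
      unfolding sum_distrib_left[symmetric] by (simp add: sum.atLeast1_atMost_eq)
    also have "\<dots> \<le> H * r powr (1 + \<nu>) * real N powr (- (1 + \<nu>)) * (real (N + 1) powr (1 + \<nu>) / (1 + \<nu>))"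
      using powr_sum_le[OF \<nu>, of N] \<nu> H by (intro mult_left_mono) (auto simp: field_simps)
    also have "\<dots> = C * ((real N + 1) / real N) powr (1 + \<nu>)"
    proof -
      have "real N powr (- (1 + \<nu>)) = 1 / real N powr (1 + \<nu>)" by (rule powr_minus_divide)
      moreover have "((real N + 1) / real N) powr (1 + \<nu>) = (real N + 1) powr (1 + \<nu>) / real N powr (1 + \<nu>)"
        using N by (simp add: powr_divide)
      ultimately show ?thesis by (simp only: C_def of_nat_add of_nat_1 times_divide_eq_left
          times_divide_eq_right mult_1_right divide_divide_eq_left mult_ac)
    qed
    finally show ?thesis .
  qed
  have "(\<lambda>N. C * (1 + 1 / real N) powr (1 + \<nu>)) \<longlonglongrightarrow> C * (1 + 0) powr (1 + \<nu>)"
    by (intro tendsto_intros lim_1_over_n) auto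
  then have lim: "(\<lambda>N. C * (1 + 1 / real N) powr (1 + \<nu>)) \<longlonglongrightarrow> C" by simp
  have "f y - f x - v \<bullet> (y - x) \<le> C"
  proof (rule LIMSEQ_le_const[OF lim], intro exI allI impI)
    fix N :: nat assume "1 \<le> N"
    then show "f y - f x - v \<bullet> (y - x) \<le> C * (1 + 1 / real N) powr (1 + \<nu>)"
      using bound[of N] by (simp add: add_divide_distrib add.commute)
  qed
  then show ?thesis by (simp add: C_def r_def)
qed simp

text \<open>The Hoelder remainder is a quadratic with an additive error by weighted Young; the constant is
  the one that makes the weighted geometric mean of the two terms exactly the remainder.\<close>

lemma holder_remainder_le_quadratic:
  assumes \<nu>: "0 \<le> \<nu>" "\<nu> \<le> 1" and H: "H > 0" and tol: "\<nu> < 1 \<Longrightarrow> tol > 0" "\<nu> = 1 \<Longrightarrow> tol = 0"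
    and r: "r \<ge> 0"
  shows "H / (1 + \<nu>) * r powr (1 + \<nu>) \<le> smooth_const \<nu> H tol / 2 * r\<^sup>2 + tol"
proof (cases "\<nu> = 1")
  case True
  then show ?thesis using tol r by (simp add: smooth_const_def)
next
  case False
  then have \<nu>1: "\<nu> < 1" and tol: "tol > 0" using \<nu> tol by auto
  show ?thesis
  proof (cases "r = 0")
    case False
    then have r: "r > 0" using r by simp
    define L where "L = smooth_const \<nu> H tol"
    define c where "c = (1 - \<nu>) / (2 * (1 + \<nu>) * tol)"
    have c: "c > 0" using \<nu>1 \<nu> tol by (simp add: c_def)
    have L: "L = c powr ((1 - \<nu>) / (1 + \<nu>)) * H powr (2 / (1 + \<nu>))"
      using \<nu>1 by (simp add: L_def smooth_const_def c_def)
    have Lpos: "L > 0" unfolding L using c H by simp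
    define \<alpha> \<beta> where "\<alpha> = (1 + \<nu>) / 2" and "\<beta> = (1 - \<nu>) / 2"
    have ab: "\<alpha> > 0" "\<beta> > 0" "\<alpha> + \<beta> = 1" using \<nu> \<nu>1 by (simp_all add: \<alpha>_def \<beta>_def field_simps)
    define a b where "a = L * r\<^sup>2 / (1 + \<nu>)" and "b = 2 * tol / (1 - \<nu>)"
    have pos: "a > 0" "b > 0" using Lpos r \<nu> \<nu>1 tol by (simp_all add: a_def b_def)
    have "a powr \<alpha> * b powr \<beta> \<le> \<alpha> * a + \<beta> * b"
      using ab pos by (intro Youngs_inequality_0) auto
    also have "\<dots> = L / 2 * r\<^sup>2 + tol"
    proof -
      have "1 + \<nu> \<noteq> 0" "1 - \<nu> \<noteq> 0" using \<nu> \<nu>1 by auto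
      then have "(1 + \<nu>) / 2 * (L * r\<^sup>2 / (1 + \<nu>)) = L / 2 * r\<^sup>2" "(1 - \<nu>) / 2 * (2 * tol / (1 - \<nu>)) = tol"
        by (simp_all add: divide_simps)
      then show ?thesis by (simp only: \<alpha>_def \<beta>_def a_def b_def)
    qed
    also have "a powr \<alpha> * b powr \<beta> = H / (1 + \<nu>) * r powr (1 + \<nu>)"
    proof -
      have b: "b = inverse (c * (1 + \<nu>))"
      proof -
        have "c * (1 + \<nu>) = (1 - \<nu>) / (2 * tol)" using \<nu> tol by (simp add: c_def divide_simps)
        then show ?thesis by (simp add: b_def)
      qed
      have "ln (a powr \<alpha> * b powr \<beta>) = \<alpha> * ln a + \<beta> * ln b"
        using pos by (simp add: ln_mult ln_powr)
      also have "ln a = (1 - \<nu>) / (1 + \<nu>) * ln c + 2 / (1 + \<nu>) * ln H + 2 * ln r - ln (1 + \<nu>)"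
        unfolding a_def L using c H r \<nu> by (simp add: ln_mult ln_div ln_powr ln_realpow)
      also have "ln b = - ln c - ln (1 + \<nu>)"
        unfolding b using c \<nu> by (simp add: ln_mult ln_inverse)
      also have "\<alpha> * ((1 - \<nu>) / (1 + \<nu>) * ln c + 2 / (1 + \<nu>) * ln H + 2 * ln r - ln (1 + \<nu>)) + \<beta> * (- ln c - ln (1 + \<nu>))
          = ln H + (1 + \<nu>) * ln r - ln (1 + \<nu>)"
      proof -
        have k: "k / 2 * (m / k) = m / 2" if "k \<noteq> 0" for k m :: real
          using that by simp
        have k: "(1 + \<nu>) / 2 * (m / (1 + \<nu>)) = m / 2" for m
          using \<nu> by (intro k) simp
        have e: "\<alpha> * ((1 - \<nu>) / (1 + \<nu>)) = \<beta>" "\<alpha> * (2 / (1 + \<nu>)) = 1" "\<alpha> * 2 = 1 + \<nu>"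
          unfolding \<alpha>_def \<beta>_def k by simp_all
        have gen: "\<alpha> * (A * lc + B * lH + 2 * lr - lk) + \<beta> * (- lc - lk)
            = (\<alpha> * A) * lc + (\<alpha> * B) * lH + (\<alpha> * 2) * lr - (\<alpha> + \<beta>) * lk - \<beta> * lc"
          for A B lc lH lr lk :: real by (simp add: algebra_simps)
        show ?thesis unfolding gen e ab(3) by simp
      qed
      also have "\<dots> = ln (H / (1 + \<nu>) * r powr (1 + \<nu>))"
        using H r \<nu> by (simp add: ln_mult ln_div ln_powr)
      finally show ?thesis
using pos H r \<nu> ln_inj_iff[of "a powr \<alpha> * b powr \<beta>" "H / (1 + \<nu>) * r powr (1 + \<nu>)"]
        by (simp add: mult_pos_pos divide_pos_pos)
    qed
    finally show ?thesis unfolding L_def .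
  qed (use tol in simp)
qed

lemma inexact_descent:
  fixes f :: "'a::real_inner \<Rightarrow> real"
  assumes "convex X" and "\<And>x. x \<in> X \<Longrightarrow> subdifferential f x \<noteq> {}"
    and "holder_subgradients X f \<nu> H" and "0 \<le> \<nu>" "\<nu> \<le> 1" and "H > 0"
    and "\<nu> < 1 \<Longrightarrow> tol > 0" "\<nu> = 1 \<Longrightarrow> tol = 0"
    and "x \<in> X" "y \<in> X" and "v \<in> subdifferential f x"
  shows "f y \<le> f x + v \<bullet> (y - x) + smooth_const \<nu> H tol / 2 * (norm (y - x))\<^sup>2 + tol"
  using holder_descent[OF assms(1-4) _ assms(9-11)]
    holder_remainder_le_quadratic[OF assms(4-8), of "norm (y - x)"] assms(6) by simp

text \<open>The function minus its linear support attains its minimum at \<open>x\<close>, where its derivative vanishes.\<close>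

lemma subgradient_eq_gradient:
  assumes "GDERIV f x :> G" and "v \<in> subdifferential f x"
  shows "v = G"
proof -
  have "((\<lambda>u. f u - v \<bullet> u) has_derivative (\<lambda>h. G \<bullet> h - v \<bullet> h)) (at x)"
    using assms(1) unfolding gderiv_def by (auto intro!: derivative_eq_intros simp: inner_commute)
  moreover have "\<forall>\<^sub>F u in at x. f x - v \<bullet> x \<le> f u - v \<bullet> u"
    using assms(2) by (intro always_eventually) (auto simp: subdifferential_def inner_diff_right algebra_simps)
  ultimately have "(\<lambda>h. G \<bullet> h - v \<bullet> h) = (\<lambda>h. 0)"
    by (rule has_derivative_local_min)
  from fun_cong[OF this, of "G - v"] have "(G - v) \<bullet> (G - v) = 0"
    by (simp add: inner_diff_left)
  then show ?thesis by simp
qed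

text \<open>The Bregman distance to \<open>x\<close> has minimum zero, and a gradient step of length \<open>1 / H\<close> from \<open>y\<close>
  decreases it by the squared difference of the gradients over \<open>2 * H\<close>. The step may leave the
  feasible set, which is why the Lipschitz condition is needed on the whole space.\<close>

lemma gradient_diff_le_bregman:
  fixes f :: "'a::real_inner \<Rightarrow> real"
  assumes lip: "lipschitz_gradient f H" and H: "H > 0"
    and sub: "\<And>x. subdifferential f x \<noteq> {}"
    and v: "v \<in> subdifferential f x" and w: "w \<in> subdifferential f y"
  shows "(norm (w - v))\<^sup>2 \<le> 2 * H * bregman f v x y"
proof -
  obtain G where G: "\<And>x. GDERIV f x :> G x" and L: "H-lipschitz_on UNIV G"
    using lip by (auto simp: lipschitz_gradient_def)
  have "holder_subgradients UNIV f 1 H"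
    unfolding holder_subgradients_def
  proof (intro ballI)
    fix a b va vb assume "va \<in> subdifferential f a" "vb \<in> subdifferential f b"
    then have "va = G a" "vb = G b" using subgradient_eq_gradient[OF G] by auto
    then show "norm (va - vb) \<le> holder_bound 1 H (norm (a - b))"
      using lipschitz_onD[OF L, of a b] by (simp add: holder_bound_def dist_norm)
  qed
  note descent = inexact_descent[OF convex_UNIV sub this, of 0]
  define d where "d = w - v"
  define u where "u = y - (1 / H) *\<^sub>R d"
  have "f u \<le> f y + w \<bullet> (u - y) + H / 2 * (norm (u - y))\<^sup>2"
    using descent[OF _ _ H, of y u w] w by (simp add: smooth_const_def)
  moreover have "f x + v \<bullet> (u - x) \<le> f u"
    using v by (simp add: subdifferential_def)
  moreover have "H / 2 * (norm (u - y))\<^sup>2 = (norm d)\<^sup>2 / (2 * H)"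
    using H by (simp add: u_def power_divide power2_eq_square)
  moreover have "w \<bullet> (u - y) - v \<bullet> (u - y) = - (norm d)\<^sup>2 / H"
    by (simp add: u_def d_def power2_norm_eq_inner inner_diff_left inner_diff_right diff_divide_distrib)
  ultimately have "(norm d)\<^sup>2 / H \<le> f y - f x - v \<bullet> (y - x) + (norm d)\<^sup>2 / (2 * H)"
    by (simp add: inner_diff_right)
  then have "(norm d)\<^sup>2 / (2 * H) \<le> bregman f v x y"
    by (simp add: bregman_def field_simps)
  then show ?thesis using H by (simp add: d_def field_simps)
qed

lemma bregman_nonneg:
  assumes "v \<in> subdifferential f u"
  shows "bregman f v u x \<ge> 0"
proof -
  have "f u + v \<bullet> (x - u) \<le> f x" using assms by (simp add: subdifferential_def)
  then show ?thesis by (simp add: bregman_def)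
qed

section \<open>Rayleigh quotients\<close>

text \<open>A minimizer \<open>v\<close> of the quotient over the unit sphere of \<open>S\<close> exists by compactness. Moving from \<open>v\<close>
  in the direction of the residual \<open>A *v v - l *\<^sub>R v\<close>, which lies in \<open>S\<close>, would lower the quotient
  unless the residual is zero.\<close>

lemma rayleigh_minimizer:
  fixes A :: "real^'n^'n"
  assumes sym: "\<And>u v. (A *v u) \<bullet> v = u \<bullet> (A *v v)"
    and S: "subspace S" "\<And>u. u \<in> S \<Longrightarrow> A *v u \<in> S" and ne: "\<exists>u\<in>S. u \<noteq> 0"
  obtains l v where "v \<in> S" "v \<noteq> 0" "A *v v = l *\<^sub>R v"
    and "\<And>u. u \<in> S \<Longrightarrow> l * (norm u)\<^sup>2 \<le> (A *v u) \<bullet> u"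
proof -
  let ?q = "\<lambda>u. (A *v u) \<bullet> u"
  obtain u0 where u0: "u0 \<in> S" "u0 \<noteq> 0" using ne by blast
  have "(1 / norm u0) *\<^sub>R u0 \<in> S \<inter> sphere 0 1"
    using u0 subspace_scale[OF S(1)] by simp
  then have "S \<inter> sphere 0 1 \<noteq> {}" by blast
  moreover have "compact (S \<inter> sphere 0 1)"
    using closed_subspace[OF S(1)] by (simp add: closed_Int_compact)
  moreover have "continuous_on (S \<inter> sphere 0 1) ?q"
    by (intro continuous_intros linear_continuous_on_compose[OF continuous_on_id matrix_vector_mul_linear])
  ultimately obtain v where v: "v \<in> S \<inter> sphere 0 1" and min: "\<And>u. u \<in> S \<inter> sphere 0 1 \<Longrightarrow> ?q v \<le> ?q u"
    using continuous_attains_inf[of "S \<inter> sphere 0 1" ?q] by blast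
  define l where "l = ?q v"
  have nv: "norm v = 1" "v \<in> S" using v by auto
  have lower: "l * (norm u)\<^sup>2 \<le> ?q u" if u: "u \<in> S" for u
  proof (cases "u = 0")
    case False
    have "(1 / norm u) *\<^sub>R u \<in> S \<inter> sphere 0 1"
      using u False subspace_scale[OF S(1)] by simp
    then have "l \<le> ?q ((1 / norm u) *\<^sub>R u)" unfolding l_def by (rule min)
    also have "\<dots> = ?q u / (norm u)\<^sup>2"
      by (simp add: matrix_vector_mult_scaleR power2_eq_square)
    finally show ?thesis using False by (simp add: pos_le_divide_eq)
  qed simp
  define w where "w = A *v v - l *\<^sub>R v"
  have wS: "w \<in> S" unfolding w_def using nv S by (intro subspace_diff subspace_scale) auto
  have "w \<bullet> w = 0"
  proof (rule ccontr)
    assume "w \<bullet> w \<noteq> 0"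
    then have ww: "w \<bullet> w > 0" by simp
    define c where "c = ?q w - l * (norm w)\<^sup>2"
    have c: "c \<ge> 0" using lower[OF wS] by (simp add: c_def)
    have quad: "2 * s * (w \<bullet> w) + s\<^sup>2 * c \<ge> 0" for s
    proof -
      have "v + s *\<^sub>R w \<in> S" using nv wS S(1) by (intro subspace_add subspace_scale) auto
      from lower[OF this] have "l * ((v + s *\<^sub>R w) \<bullet> (v + s *\<^sub>R w)) \<le> ?q (v + s *\<^sub>R w)"
        by (simp add: power2_norm_eq_inner)
      moreover have "?q (v + s *\<^sub>R w) = l + 2 * s * ((A *v v) \<bullet> w) + s\<^sup>2 * ?q w"
      proof -
        have "?q (v + s *\<^sub>R w) = ?q v + s * ((A *v v) \<bullet> w) + s * ((A *v w) \<bullet> v) + s * (s * ?q w)"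
          by (simp add: matrix_vector_right_distrib matrix_vector_mult_scaleR inner_add_left
              inner_add_right distrib_left)
        moreover have "(A *v w) \<bullet> v = (A *v v) \<bullet> w" unfolding sym[of w v] by (rule inner_commute)
        ultimately show ?thesis by (simp add: l_def power2_eq_square)
      qed
      moreover have "(v + s *\<^sub>R w) \<bullet> (v + s *\<^sub>R w) = 1 + 2 * s * (v \<bullet> w) + s\<^sup>2 * (norm w)\<^sup>2"
      proof -
        have "(v + s *\<^sub>R w) \<bullet> (v + s *\<^sub>R w) = v \<bullet> v + s * (v \<bullet> w) + s * (w \<bullet> v) + s * (s * (w \<bullet> w))"
          by (simp add: inner_add_left inner_add_right distrib_left)
        moreover have "v \<bullet> v = 1" using nv by (simp add: norm_eq_1)
        ultimately show ?thesis
          by (simp add: inner_commute[of w v] power2_eq_square power2_norm_eq_inner[unfolded power2_eq_square])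
      qed
      moreover have "w \<bullet> w = (A *v v) \<bullet> w - l * (v \<bullet> w)"
        unfolding w_def by (simp add: inner_diff_left)
      ultimately have le: "l * (1 + 2 * s * (v \<bullet> w) + s\<^sup>2 * (norm w)\<^sup>2) \<le> l + 2 * s * ((A *v v) \<bullet> w) + s\<^sup>2 * ?q w"
        and ww: "w \<bullet> w = (A *v v) \<bullet> w - l * (v \<bullet> w)" by simp_all
      show ?thesis unfolding ww c_def using le by (simp add: ring_distribs mult.left_commute)
    qed
    (* A step along - w so short that the quadratic term is at most half of the linear one. *)
    define s where "s = (w \<bullet> w) / (c + 1)"
    have s: "s > 0" using ww c by (simp add: s_def)
    have "s * c \<le> w \<bullet> w" using ww c by (simp add: s_def field_simps)
    moreover have "0 \<le> 2 * (- s) * (w \<bullet> w) + (- s)\<^sup>2 * c" by (rule quad)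
    then have "s * (2 * (w \<bullet> w)) \<le> s * (s * c)" by (simp add: power2_eq_square algebra_simps)
    then have "2 * (w \<bullet> w) \<le> s * c" using s by simp
    ultimately show False using ww by linarith
  qed
  then have "A *v v = l *\<^sub>R v" by (simp add: w_def)
  moreover have "v \<noteq> 0" using nv(1) by auto
  ultimately show thesis using lower nv(2) by (intro that[of v l])
qed

text \<open>Eigenvectors for different eigenvalues are orthogonal, hence independent. Finiteness gives meaning
  to the \<open>Min\<close> and \<open>Max\<close> in the definitions of the extreme eigenvalues.\<close>

lemma finite_eigvals:
  fixes A :: "real^'n^'n"
  assumes sym: "\<And>u v. (A *v u) \<bullet> v = u \<bullet> (A *v v)"
  shows "finite (eigvals A)"
proof -
  define e where "e l = (SOME v. v \<noteq> 0 \<and> A *v v = l *\<^sub>R v)" for l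
  have e: "e l \<noteq> 0" "A *v e l = l *\<^sub>R e l" if "l \<in> eigvals A" for l
    using that someI_ex[of "\<lambda>v. v \<noteq> 0 \<and> A *v v = l *\<^sub>R v"] by (auto simp: eigvals_def e_def)
  have orth: "e l \<bullet> e m = 0" if "l \<in> eigvals A" "m \<in> eigvals A" "l \<noteq> m" for l m
  proof -
    have "l * (e l \<bullet> e m) = m * (e l \<bullet> e m)"
      using sym[of "e l" "e m"] e that by simp
    then show ?thesis using that by simp
  qed
  have inj: "inj_on e (eigvals A)"
  proof (rule inj_onI, rule ccontr)
    fix l m assume lm: "l \<in> eigvals A" "m \<in> eigvals A" "e l = e m" "l \<noteq> m"
    then have "e l \<bullet> e l = 0" using orth[of l m] by simp
    then show False using e lm by simp
  qed
  have "pairwise orthogonal (e ` eigvals A)"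
    unfolding pairwise_def orthogonal_def using orth by (auto simp: image_iff)
  moreover have "0 \<notin> e ` eigvals A" using e by auto
  ultimately have "independent (e ` eigvals A)" by (rule pairwise_orthogonal_independent)
  then have "finite (e ` eigvals A)" by (rule independent_imp_finite)
  then show ?thesis using inj by (simp add: finite_image_iff)
qed

lemma inner_transpose: "(B *v u) \<bullet> w = u \<bullet> (transpose B *v w)"
  for B :: "real^'n^'m"
  by (metis dot_lmul_matrix inner_commute transpose_matrix_vector)

lemma gram_inner:
  fixes B :: "real^'n^'m"
  shows "((transpose B ** B) *v u) \<bullet> v = (B *v u) \<bullet> (B *v v)"
  by (simp add: matrix_vector_mul_assoc[symmetric] inner_transpose[of B v, symmetric] inner_commute
      del: transpose_matrix_vector)

lemma gram_sym:
  fixes B :: "real^'n^'m"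
  shows "((transpose B ** B) *v u) \<bullet> v = u \<bullet> ((transpose B ** B) *v v)"
  by (metis gram_inner inner_commute)

text \<open>The largest eigenvalue is the negative of the smallest one of the negated matrix.\<close>

lemma gram_lambda_max:
  fixes B :: "real^'n^'m"
  shows "(norm (B *v u))\<^sup>2 \<le> lambda_max (transpose B ** B) * (norm u)\<^sup>2"
proof -
  let ?A = "transpose B ** B"
  have neg: "(- ?A) *v u = - (?A *v u)" for u by (simp add: matrix_vector_mult_def vec_eq_iff sum_negf)
  obtain v0 :: "real^'n" where v0: "v0 \<noteq> 0" using zero_neq_one by blast
  obtain l v where v: "v \<noteq> 0" "(- ?A) *v v = l *\<^sub>R v"
    and low: "\<And>u. l * (norm u)\<^sup>2 \<le> ((- ?A) *v u) \<bullet> u"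
  proof (rule rayleigh_minimizer[of "- ?A" UNIV])
    show "((- ?A) *v u) \<bullet> v = u \<bullet> ((- ?A) *v v)" for u v
      unfolding neg using gram_sym[of B u v] by simp
  qed (use v0 in auto)
  have "- l \<in> eigvals ?A" using v unfolding eigvals_def neg by (auto intro!: exI[of _ v]) (metis minus_equation_iff scaleR_left.minus)
  then have "- l \<le> lambda_max ?A"
    unfolding lambda_max_def by (intro Max_ge finite_eigvals gram_sym)
  then have "- l * (norm u)\<^sup>2 \<le> lambda_max ?A * (norm u)\<^sup>2" by (rule mult_right_mono) simp
  moreover have "(norm (B *v u))\<^sup>2 \<le> - l * (norm u)\<^sup>2"
    using low[of u] gram_inner[of B u u] unfolding neg by (simp add: power2_norm_eq_inner)
  ultimately show ?thesis by linarith
qed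

lemma gram_lambda_min:
  fixes B :: "real^'n^'m"
  shows "lambda_min (transpose B ** B) * (norm u)\<^sup>2 \<le> (norm (B *v u))\<^sup>2"
proof -
  let ?A = "transpose B ** B"
  obtain v0 :: "real^'n" where v0: "v0 \<noteq> 0" using zero_neq_one by blast
  obtain l v where v: "v \<noteq> 0" "?A *v v = l *\<^sub>R v" and low: "\<And>u. l * (norm u)\<^sup>2 \<le> (?A *v u) \<bullet> u"
    by (rule rayleigh_minimizer[of ?A UNIV, OF gram_sym]) (use v0 in auto)
  have "l \<in> eigvals ?A" using v unfolding eigvals_def by blast
  then have "lambda_min ?A \<le> l"
    unfolding lambda_min_def by (intro Min_le finite_eigvals gram_sym)
  then have "lambda_min ?A * (norm u)\<^sup>2 \<le> l * (norm u)\<^sup>2" by (rule mult_right_mono) simp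
  moreover have "l * (norm u)\<^sup>2 \<le> (norm (B *v u))\<^sup>2"
    using low[of u] gram_inner[of B u u] by (simp add: power2_norm_eq_inner)
  ultimately show ?thesis by linarith
qed

text \<open>On the range of the transpose the minimal Rayleigh quotient is attained at an eigenvector of
  the Gram matrix outside its kernel, so its value is a positive eigenvalue.\<close>

lemma gram_lambda_min_pos:
  fixes B :: "real^'n^'m"
  assumes u: "u \<in> range (\<lambda>w. transpose B *v w)"
  shows "lambda_min_pos (transpose B ** B) * (norm u)\<^sup>2 \<le> (norm (B *v u))\<^sup>2"
proof (cases "u = 0")
  case False
  let ?A = "transpose B ** B" and ?S = "range (\<lambda>w. transpose B *v w)"
  have S: "subspace ?S"
    by (rule linear_subspace_image[OF matrix_vector_mul_linear subspace_UNIV])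
  have inv: "?A *v v \<in> ?S" for v
    by (simp only: matrix_vector_mul_assoc[symmetric]) blast
  obtain l v where v: "v \<in> ?S" "v \<noteq> 0" "?A *v v = l *\<^sub>R v"
    and low: "\<And>u. u \<in> ?S \<Longrightarrow> l * (norm u)\<^sup>2 \<le> (?A *v u) \<bullet> u"
    by (rule rayleigh_minimizer[of ?A ?S, OF gram_sym S inv]) (use u False in auto)
  have Bv: "B *v v \<noteq> 0"
  proof
    assume "B *v v = 0"
    moreover obtain w where "v = transpose B *v w" using v(1) by blast
    ultimately have "v \<bullet> v = 0"
      using inner_transpose[of B v w] by (simp del: transpose_matrix_vector)
    then show False using v(2) by simp
  qed
  have "l * (norm v)\<^sup>2 = (norm (B *v v))\<^sup>2"
    using gram_inner[of B v v] v(3) by (simp add: power2_norm_eq_inner)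
  then have "l * (norm v)\<^sup>2 > 0" using Bv by simp
  then have "l > 0" using v(2) by (simp add: zero_less_mult_iff)
  then have l: "l \<in> {l \<in> eigvals ?A. l > 0}" using v unfolding eigvals_def by blast
  then have "lambda_min_pos ?A \<le> l"
    unfolding lambda_min_pos_def using finite_eigvals[of ?A, OF gram_sym]
    by (auto intro!: Min_le)
  then have "lambda_min_pos ?A * (norm u)\<^sup>2 \<le> l * (norm u)\<^sup>2" by (rule mult_right_mono) simp
  moreover have "l * (norm u)\<^sup>2 \<le> (norm (B *v u))\<^sup>2"
    using low[OF u] gram_inner[of B u u] by (simp add: power2_norm_eq_inner)
  ultimately show ?thesis by linarith
qed simp

lemma gram_lower_bound:
  fixes B :: "real^'n^'m"
  assumes "if range_only then a \<le> lambda_min_pos (transpose B ** B) else a \<le> lambda_min (transpose B ** B)"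
    and "range_only \<Longrightarrow> u \<in> range (\<lambda>w. transpose B *v w)"
  shows "a * (norm u)\<^sup>2 \<le> (norm (B *v u))\<^sup>2"
proof (cases range_only)
  case True
  then have "a * (norm u)\<^sup>2 \<le> lambda_min_pos (transpose B ** B) * (norm u)\<^sup>2"
    using assms(1) by (intro mult_right_mono) auto
  with gram_lambda_min_pos[OF assms(2)[OF True]] show ?thesis by linarith
next
  case False
  then have "a * (norm u)\<^sup>2 \<le> lambda_min (transpose B ** B) * (norm u)\<^sup>2"
    using assms(1) by (intro mult_right_mono) auto
  with gram_lambda_min[of B u] show ?thesis by linarith
qed

lemma translate_along_kernel:
  fixes B :: "real^'n^'m"
  assumes X: "X + {u. B *v u = 0} = X" and x: "x \<in> X" and w: "\<And>u. (transpose B *v u) \<bullet> w = 0"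
  shows "x - w \<in> X"
proof -
  have "(B *v w) \<bullet> (B *v w) = 0"
    using w[of "B *v w"] unfolding inner_transpose[of B w] by (simp only: inner_commute)
  then have "B *v (- w) = 0"
    using matrix_vector_mult_diff_distrib[of B 0 w] by simp
  then have "x + (- w) \<in> X + {u. B *v u = 0}"
    using x by (intro set_plus_intro) auto
  then show ?thesis using X by simp
qed

declare transpose_matrix_vector [simp del]

section \<open>The saddle-point problem\<close>

lemma smooth_const_pos:
  assumes "H > 0" "0 \<le> \<nu>" "\<nu> < 1 \<Longrightarrow> tol > 0"
  shows "smooth_const \<nu> H tol > 0"
  using assms by (auto simp: smooth_const_def intro!: mult_pos_pos divide_pos_pos)

lemma sqnorm_op_P: "sqnorm (op_P p) z = delta_x p * (norm (fst z))\<^sup>2 + delta_y p * (norm (snd z))\<^sup>2"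
  by (simp add: sqnorm_def op_P_def inner_prod_def power2_norm_eq_inner)

text \<open>By Young's inequality half of the squared norm of \<open>d\<close> survives, at the price of twice the squared
  norm of the residual \<open>a\<close>.\<close>

lemma residual_increase:
  fixes s :: "'a::real_inner" and d a :: "'b::real_inner"
  assumes \<beta>: "\<beta> > 0" and mu: "\<mu>\<^sup>2 * (norm s)\<^sup>2 \<le> (norm d)\<^sup>2" and a: "(norm a)\<^sup>2 \<le> I / (2 * \<beta>)"
  shows "4 * \<beta> * \<mu>\<^sup>2 * (norm s)\<^sup>2 / 16 - I / 2 \<le> \<beta> / 2 * ((norm (a + d))\<^sup>2 - (norm a)\<^sup>2)"
proof -
  have "0 \<le> (norm (2 *\<^sub>R a + d))\<^sup>2" by simp
  also have "(norm (2 *\<^sub>R a + d))\<^sup>2 = 4 * (norm a)\<^sup>2 + 4 * (a \<bullet> d) + (norm d)\<^sup>2"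
    by (simp add: power2_norm_eq_inner inner_add_left inner_add_right inner_commute)
  finally have "(norm d)\<^sup>2 / 2 - 2 * (norm a)\<^sup>2 \<le> (norm (a + d))\<^sup>2 - (norm a)\<^sup>2"
    by (simp add: power2_norm_eq_inner inner_add_left inner_add_right inner_commute)
  then have "\<mu>\<^sup>2 * (norm s)\<^sup>2 / 2 - I / \<beta> \<le> (norm (a + d))\<^sup>2 - (norm a)\<^sup>2"
    using mu a by simp
  then have "\<beta> / 2 * (\<mu>\<^sup>2 * (norm s)\<^sup>2 / 2 - I / \<beta>) \<le> \<beta> / 2 * ((norm (a + d))\<^sup>2 - (norm a)\<^sup>2)"
    using \<beta> by (intro mult_left_mono) auto
  also have "\<beta> / 2 * (\<mu>\<^sup>2 * (norm s)\<^sup>2 / 2 - I / \<beta>) = 4 * \<beta> * \<mu>\<^sup>2 * (norm s)\<^sup>2 / 16 - I / 2"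
    using \<beta> by (simp add: right_diff_distrib)
  finally show ?thesis .
qed

locale saddle_setting =
  fixes p :: "('n::finite, 'm::finite) saddle_problem" and r :: "('n, 'm) reference"
    and inv_x inv_y :: bool and z0 :: "(real^'n) \<times> (real^'m)"
  assumes domains: "domains_ok p" and A1: "assumption_A1 p" and A2: "assumption_A2 p"
    and A3: "assumption_A3 p inv_x inv_y" and ambient: "ambient_smoothness p"
    and reference: "reference_ok p inv_x inv_y r z0"
    and delta_x_pos: "delta_x p > 0" and delta_y_pos: "delta_y p > 0"
    and beta_delta_x: "beta_x p * delta_y p \<le> 1/4" and beta_delta_y: "beta_y p * delta_x p \<le> 1/4"
    and zeta_0: "beta_x p > 0 \<Longrightarrow> zeta r = 0" and xi_0: "beta_y p > 0 \<Longrightarrow> xi r = 0"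
    and sub_f: "subdifferential (fun_f p) x \<noteq> {}" and sub_g: "subdifferential (fun_g p) y \<noteq> {}"
begin

abbreviation "B \<equiv> mat_B p"
abbreviation "Bt \<equiv> transpose (mat_B p)"
abbreviation "z_star \<equiv> (x_star r, y_star r)"
abbreviation "D_f \<equiv> bregman (fun_f p) (f_star r) (x_star r)"
abbreviation "D_g \<equiv> bregman (fun_g p) (g_star r) (y_star r)"

lemma adjoint: "(B *v u) \<bullet> w = u \<bullet> (Bt *v w)"
  by (rule inner_transpose)

lemma f_facts: "mu_x p \<ge> 0" "0 \<le> nu_x p" "nu_x p \<le> 1" "H_x p > 0"
    "holder_subgradients (set_X p) (fun_f p) (nu_x p) (H_x p)"
    "\<And>x x' v. x \<in> set_X p \<Longrightarrow> x' \<in> set_X p \<Longrightarrow> v \<in> subdifferential (fun_f p) x \<Longrightarrow>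
       fun_f p x + v \<bullet> (x' - x) + mu_x p / 2 * (norm (x' - x))\<^sup>2 \<le> fun_f p x'"
  using A1 by (simp_all add: assumption_A1_def convex_holder_on_def holder_subgradients_def)

lemma g_facts: "mu_y p \<ge> 0" "0 \<le> nu_y p" "nu_y p \<le> 1" "H_y p > 0"
    "holder_subgradients (set_Y p) (fun_g p) (nu_y p) (H_y p)"
    "\<And>x x' v. x \<in> set_Y p \<Longrightarrow> x' \<in> set_Y p \<Longrightarrow> v \<in> subdifferential (fun_g p) x \<Longrightarrow>
       fun_g p x + v \<bullet> (x' - x) + mu_y p / 2 * (norm (x' - x))\<^sup>2 \<le> fun_g p x'"
  using A2 by (simp_all add: assumption_A2_def convex_holder_on_def holder_subgradients_def)

lemma L_xy_pos: "L_xy p > 0"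
  using A3 by (simp add: assumption_A3_def)

lemma norm_B_le: "norm (B *v u) \<le> L_xy p * norm u"
proof -
  have "(norm (B *v u))\<^sup>2 \<le> lambda_max (Bt ** B) * (norm u)\<^sup>2" by (rule gram_lambda_max)
  also have "\<dots> \<le> (L_xy p)\<^sup>2 * (norm u)\<^sup>2"
    using A3 by (intro mult_right_mono) (auto simp: assumption_A3_def)
  finally have "(norm (B *v u))\<^sup>2 \<le> (L_xy p * norm u)\<^sup>2" by (simp add: power_mult_distrib)
  moreover have "0 \<le> L_xy p * norm u" using L_xy_pos by simp
  ultimately show ?thesis by (rule power2_le_imp_le)
qed

lemma norm_Bt_le: "norm (Bt *v w) \<le> L_xy p * norm w"
proof (cases "Bt *v w = 0")
  case False
  have "norm (Bt *v w) * norm (Bt *v w) = (B *v (Bt *v w)) \<bullet> w"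
    unfolding adjoint by (simp add: dot_square_norm power2_eq_square)
  also have "\<dots> \<le> norm (B *v (Bt *v w)) * norm w" by (rule norm_cauchy_schwarz)
  also have "\<dots> \<le> (L_xy p * norm (Bt *v w)) * norm w"
    by (intro mult_right_mono norm_B_le) simp
  finally have "norm (Bt *v w) * norm (Bt *v w) \<le> (L_xy p * norm w) * norm (Bt *v w)"
    by (simp add: mult_ac)
  then show ?thesis using False by (simp only: mult_le_cancel_right) simp
qed (use L_xy_pos in simp)

text \<open>The directions orthogonal to the kernels, in the blocks where a range condition is invoked.\<close>

definition V :: "((real^'n) \<times> (real^'m)) set" where
  "V = {z. (inv_x \<longrightarrow> fst z \<in> range (\<lambda>u. Bt *v u)) \<and> (inv_y \<longrightarrow> snd z \<in> range (\<lambda>u. B *v u))}"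

lemma subspace_V: "subspace V"
proof -
  have "subspace (range (\<lambda>u. Bt *v u))" "subspace (range (\<lambda>u. B *v u))"
    by (rule linear_subspace_image[OF matrix_vector_mul_linear subspace_UNIV])+
  then show ?thesis
    unfolding V_def subspace_def by auto
qed

lemma norm_B_ge:
  assumes "z \<in> V"
  shows "(mu_xy p)\<^sup>2 * (norm (fst z))\<^sup>2 \<le> (norm (B *v fst z))\<^sup>2"
proof (rule gram_lower_bound[where range_only = inv_x])
  show "inv_x \<Longrightarrow> fst z \<in> range (\<lambda>u. Bt *v u)" using assms unfolding V_def by blast
qed (use A3 in \<open>simp add: assumption_A3_def split: if_splits\<close>)

lemma norm_Bt_ge:
  assumes "z \<in> V"
  shows "(mu_yx p)\<^sup>2 * (norm (snd z))\<^sup>2 \<le> (norm (Bt *v snd z))\<^sup>2"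
proof (rule gram_lower_bound[where range_only = inv_y])
  show "inv_y \<Longrightarrow> snd z \<in> range (\<lambda>u. transpose Bt *v u)"
    using assms unfolding V_def transpose_transpose by blast
qed (use A3 in \<open>simp add: assumption_A3_def split: if_splits\<close>)

lemma translate_set_Z:
  assumes z: "z \<in> set_Z p" and w: "\<And>v. v \<in> V \<Longrightarrow> v \<bullet> w = 0"
  shows "z - w \<in> set_Z p"
proof -
  have z: "fst z \<in> set_X p" "snd z \<in> set_Y p" using z by (auto simp: set_Z_def)
  have zero: "0 \<in> range (\<lambda>u. Bt *v u)" "0 \<in> range (\<lambda>u. B *v u)"
    by (auto intro!: image_eqI[of 0 _ 0])
  have wx: "a \<bullet> fst w = 0" if "inv_x \<Longrightarrow> a \<in> range (\<lambda>u. Bt *v u)" for a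
    using w[of "(a, 0)"] that zero by (simp add: V_def inner_prod_def)
  have wy: "a \<bullet> snd w = 0" if "inv_y \<Longrightarrow> a \<in> range (\<lambda>u. B *v u)" for a
    using w[of "(0, a)"] that zero by (simp add: V_def inner_prod_def)
  have "fst z - fst w \<in> set_X p"
  proof (cases inv_x)
    case True
    then have "set_X p + {u. B *v u = 0} = set_X p" using A3 by (simp add: assumption_A3_def)
    then show ?thesis using z(1) wx by (rule translate_along_kernel) simp
  qed (use wx[of "fst w"] z in simp)
  moreover have "snd z - snd w \<in> set_Y p"
  proof (cases inv_y)
    case True
    then have "set_Y p + {u. Bt *v u = 0} = set_Y p" using A3 by (simp add: assumption_A3_def)
    then show ?thesis using z(2) wy by (rule translate_along_kernel) simp
  qed (use wy[of "snd w"] z in simp)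
  ultimately show ?thesis by (auto simp: set_Z_def mem_Times_iff)
qed

sublocale metric_operator "op_P p"
proof (rule metric_operator.intro)
  show "linear (op_P p)"
    unfolding op_P_def by (rule linearI) (simp_all add: scaleR_add_right)
  show "op_P p a \<bullet> b = a \<bullet> op_P p b" for a b
    by (simp add: op_P_def inner_prod_def)
  show "\<exists>d>0. \<forall>a. d * (norm a)\<^sup>2 \<le> sqnorm (op_P p) a"
  proof (intro exI[of _ "min (delta_x p) (delta_y p)"] conjI allI)
    fix a :: "(real^'n) \<times> (real^'m)"
    have "(norm a)\<^sup>2 = (norm (fst a))\<^sup>2 + (norm (snd a))\<^sup>2"
      by (simp add: norm_prod_def)
    then have "min (delta_x p) (delta_y p) * (norm a)\<^sup>2
        = min (delta_x p) (delta_y p) * (norm (fst a))\<^sup>2 + min (delta_x p) (delta_y p) * (norm (snd a))\<^sup>2"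
      by (simp add: distrib_left)
    also have "\<dots> \<le> sqnorm (op_P p) a"
      unfolding sqnorm_op_P by (intro add_mono mult_right_mono) auto
    finally show "min (delta_x p) (delta_y p) * (norm a)\<^sup>2 \<le> sqnorm (op_P p) a" .
  qed (use delta_x_pos delta_y_pos in simp)
qed

lemma beta_nonneg: "beta_x p \<ge> 0" "beta_y p \<ge> 0"
  using f_facts(4) g_facts(4) by (auto simp: beta_x_def beta_y_def smooth_const_def)

lemma comp_p3_expansion:
  "comp_p3 p v w y = comp_p3 p v w x + grad_p3 p v w x \<bullet> (y - x)
     + beta_x p / 2 * (norm (B *v fst (y - x)))\<^sup>2 + beta_y p / 2 * (norm (Bt *v snd (y - x)))\<^sup>2"
proof -
  have sq: "(norm (a + b))\<^sup>2 = (norm a)\<^sup>2 + 2 * (a \<bullet> b) + (norm b)\<^sup>2" for a b :: "'c::real_inner"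
    by (simp add: power2_norm_eq_inner inner_add_left inner_add_right inner_commute)
  have 1: "B *v fst y - w = (B *v fst x - w) + B *v fst (y - x)"
    by (simp add: matrix_vector_mult_diff_distrib)
  have 2: "Bt *v snd y + v = (Bt *v snd x + v) + Bt *v snd (y - x)"
    by (simp add: matrix_vector_mult_diff_distrib)
  have 3: "grad_p3 p v w x \<bullet> (y - x) = beta_x p * ((B *v fst x - w) \<bullet> (B *v fst (y - x)))
      + beta_y p * ((Bt *v snd x + v) \<bullet> (Bt *v snd (y - x)))"
    unfolding grad_p3_def inner_prod_def using adjoint[of "fst (y - x)" "B *v fst x - w"]
      adjoint[of "Bt *v snd x + v" "snd (y - x)"]
    by (simp add: inner_commute)
  show ?thesis unfolding 3 unfolding comp_p3_def 1 2 sq by (simp add: algebra_simps)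
qed

text \<open>The curvature in \<open>x\<close> is at most \<open>beta_x p * (L_xy p)\<^sup>2\<close>. In the metric of \<open>op_P\<close> the constant
  \<open>kappa_xy p\<close> allows \<open>(L_xy p)\<^sup>2 / delta_y p\<close> there, which the bound on \<open>beta_x p * delta_y p\<close>
  ensures.\<close>

lemma p3_curvature_le:
  "beta_x p / 2 * (norm (B *v fst d))\<^sup>2 + beta_y p / 2 * (norm (Bt *v snd d))\<^sup>2
     \<le> kappa_xy p / 2 * sqnorm (op_P p) d"
proof -
  have b: "beta * (norm q)\<^sup>2 \<le> (L_xy p)\<^sup>2 / d * (norm s)\<^sup>2"
    if "norm q \<le> L_xy p * norm s" "beta * d \<le> 1/4" "beta \<ge> 0" "d > 0" for beta d :: real and q :: "'a::real_normed_vector" and s :: "'b::real_normed_vector"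
  proof -
    have "(norm q)\<^sup>2 \<le> (L_xy p)\<^sup>2 * (norm s)\<^sup>2"
      using power_mono[OF that(1), of 2] by (simp add: power_mult_distrib)
    then have "beta * (norm q)\<^sup>2 \<le> beta * ((L_xy p)\<^sup>2 * (norm s)\<^sup>2)"
      using that(3) by (rule mult_left_mono)
    also have "\<dots> \<le> 1 / d * ((L_xy p)\<^sup>2 * (norm s)\<^sup>2)"
      using that(2,4) by (intro mult_right_mono) (simp_all add: pos_le_divide_eq)
    finally show ?thesis by simp
  qed
  have "kappa_xy p / 2 * sqnorm (op_P p) d
      = ((L_xy p)\<^sup>2 / delta_y p * (norm (fst d))\<^sup>2 + (L_xy p)\<^sup>2 / delta_x p * (norm (snd d))\<^sup>2) / 2"
    using delta_x_pos delta_y_pos by (simp add: kappa_xy_def sqnorm_op_P field_simps)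
  then show ?thesis
    using b[OF norm_B_le[of "fst d"] beta_delta_x beta_nonneg(1) delta_y_pos]
      b[OF norm_Bt_le[of "snd d"] beta_delta_y beta_nonneg(2) delta_x_pos]
    by simp
qed

text \<open>The coupling exchanges the two blocks, so the two weights of the metric enter through their product;
  the cross terms are combined by the Cauchy-Schwarz inequality in the plane.\<close>

lemma coupling_lipschitz:
  "(Bt *v snd d, - (B *v fst d)) \<bullet> w
     \<le> sqrt (kappa_xy p) * sqrt (sqnorm (op_P p) d) * sqrt (sqnorm (op_P p) w)"
proof -
  define a b c e where "a = norm (fst d)" and "b = norm (snd d)" and "c = norm (fst w)" and "e = norm (snd w)"
  define X Y where "X = delta_x p" and "Y = delta_y p"
  have X: "X > 0" and Y: "Y > 0" using delta_x_pos delta_y_pos by (simp_all add: X_def Y_def)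
  have "(Bt *v snd d) \<bullet> fst w \<le> norm (Bt *v snd d) * c" unfolding c_def by (rule norm_cauchy_schwarz)
  also have "\<dots> \<le> L_xy p * b * c" unfolding b_def c_def by (intro mult_right_mono norm_Bt_le) simp
  finally have 1: "(Bt *v snd d) \<bullet> fst w \<le> L_xy p * b * c" .
  have "- ((B *v fst d) \<bullet> snd w) \<le> norm (B *v fst d) * e"
    unfolding e_def using Cauchy_Schwarz_ineq2[of "B *v fst d" "snd w"] by linarith
  also have "\<dots> \<le> L_xy p * a * e" unfolding a_def e_def by (intro mult_right_mono norm_B_le) simp
  finally have 2: "- ((B *v fst d) \<bullet> snd w) \<le> L_xy p * a * e" .
  have "(Bt *v snd d, - (B *v fst d)) \<bullet> w \<le> L_xy p * (b * c + a * e)"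
    using 1 2 by (simp add: inner_prod_def algebra_simps)
  also have "\<dots> \<le> sqrt (kappa_xy p * sqnorm (op_P p) d * sqnorm (op_P p) w)"
  proof (rule real_le_rsqrt)
    have "X * Y * (b * c + a * e)\<^sup>2 = (X * a\<^sup>2 + Y * b\<^sup>2) * (X * c\<^sup>2 + Y * e\<^sup>2) - (X * a * c - Y * b * e)\<^sup>2"
      by (simp add: power2_eq_square algebra_simps)
    also have "\<dots> \<le> (X * a\<^sup>2 + Y * b\<^sup>2) * (X * c\<^sup>2 + Y * e\<^sup>2)" by simp
    finally have "(b * c + a * e)\<^sup>2 \<le> (X * a\<^sup>2 + Y * b\<^sup>2) * (X * c\<^sup>2 + Y * e\<^sup>2) / (X * Y)"
      using X Y by (simp add: pos_le_divide_eq mult.commute)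
    then have "(L_xy p)\<^sup>2 * (b * c + a * e)\<^sup>2 \<le> (L_xy p)\<^sup>2 * ((X * a\<^sup>2 + Y * b\<^sup>2) * (X * c\<^sup>2 + Y * e\<^sup>2) / (X * Y))"
      by (rule mult_left_mono) simp
    then show "(L_xy p * (b * c + a * e))\<^sup>2 \<le> kappa_xy p * sqnorm (op_P p) d * sqnorm (op_P p) w"
      unfolding sqnorm_op_P kappa_xy_def X_def[symmetric] Y_def[symmetric] a_def[symmetric]
        b_def[symmetric] c_def[symmetric] e_def[symmetric] by (simp add: power_mult_distrib mult_ac)
  qed
  also have "\<dots> = sqrt (kappa_xy p) * sqrt (sqnorm (op_P p) d) * sqrt (sqnorm (op_P p) w)"
    by (simp only: real_sqrt_mult)
  finally show ?thesis .
qed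

lemma kappa_xy_pos: "kappa_xy p > 0"
  using L_xy_pos delta_x_pos delta_y_pos by (simp add: kappa_xy_def)

text \<open>At the reference point the residuals of the third component are differences of gradients, because
  the normal vectors vanish whenever the corresponding weight is positive. Cocoercivity bounds them
  by Bregman distances at the stage input.\<close>

lemma p3_increase:
  assumes z: "z - z_star \<in> V" and v: "v \<in> subdifferential (fun_f p) x'" and w: "w \<in> subdifferential (fun_g p) y'"
  shows "comp_p3 p v w z - comp_p3 p v w z_star
    \<ge> (4 * beta_x p * (mu_xy p)\<^sup>2 * (norm (fst z - x_star r))\<^sup>2
        + 4 * beta_y p * (mu_yx p)\<^sup>2 * (norm (snd z - y_star r))\<^sup>2) / 16
     - (if nu_y p = 1 then D_g y' / 2 else 0)
     - (if nu_x p = 1 then D_f x' / 2 else 0)"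
proof -
  have star: "f_star r \<in> subdifferential (fun_f p) (x_star r)" "g_star r \<in> subdifferential (fun_g p) (y_star r)"
    "f_star r + Bt *v y_star r + xi r = 0" "g_star r - B *v x_star r + zeta r = 0"
    using reference by (auto simp: reference_ok_def)
  have x: "beta_x p / 2 * ((norm (B *v fst z - w))\<^sup>2 - (norm (B *v x_star r - w))\<^sup>2)
      \<ge> 4 * beta_x p * (mu_xy p)\<^sup>2 * (norm (fst z - x_star r))\<^sup>2 / 16
        - (if nu_y p = 1 then D_g y' / 2 else 0)"
  proof (cases "nu_y p = 1")
    case True
    have beta: "beta_x p = 1 / (4 * H_y p)" using True by (simp add: beta_x_def smooth_const_def)
    then have bpos: "beta_x p > 0" using g_facts(4) by simp
    have star_eq: "B *v x_star r = g_star r" using star(4) zeta_0[OF bpos] by simp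
    have "(norm (B *v x_star r - w))\<^sup>2 \<le> 2 * H_y p * D_g y'"
      unfolding star_eq norm_minus_commute[of "g_star r"] using ambient True
      by (intro gradient_diff_le_bregman[OF _ g_facts(4) sub_g star(2) w]) (simp add: ambient_smoothness_def)
    then show ?thesis
      using residual_increase[OF bpos, of "mu_xy p" "fst z - x_star r" "B *v fst (z - z_star)" "B *v x_star r - w"
          "D_g y'"]
        norm_B_ge[OF z] g_facts(4) True unfolding beta
      by (simp add: matrix_vector_mult_diff_distrib mult.commute)
  qed (simp add: beta_x_def)
  have y: "beta_y p / 2 * ((norm (Bt *v snd z + v))\<^sup>2 - (norm (Bt *v y_star r + v))\<^sup>2)
      \<ge> 4 * beta_y p * (mu_yx p)\<^sup>2 * (norm (snd z - y_star r))\<^sup>2 / 16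
        - (if nu_x p = 1 then D_f x' / 2 else 0)"
  proof (cases "nu_x p = 1")
    case True
    have beta: "beta_y p = 1 / (4 * H_x p)" using True by (simp add: beta_y_def smooth_const_def)
    then have bpos: "beta_y p > 0" using f_facts(4) by simp
    have "Bt *v y_star r = - f_star r"
      using star(3) xi_0[OF bpos] by (simp add: eq_neg_iff_add_eq_0 add.commute)
    then have star_eq: "Bt *v y_star r + v = v - f_star r" by simp
    have "(norm (Bt *v y_star r + v))\<^sup>2 \<le> 2 * H_x p * D_f x'"
      unfolding star_eq using ambient True
      by (intro gradient_diff_le_bregman[OF _ f_facts(4) sub_f star(1) v]) (simp add: ambient_smoothness_def)
    then show ?thesis
      using residual_increase[OF bpos, of "mu_yx p" "snd z - y_star r" "Bt *v snd (z - z_star)" "Bt *v y_star r + v"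
          "D_f x'"]
        norm_Bt_ge[OF z] f_facts(4) True unfolding beta
      by (simp add: matrix_vector_mult_diff_distrib mult.commute add.commute[of v])
  qed (simp add: beta_y_def)
  have "comp_p3 p v w z - comp_p3 p v w z_star
      = beta_x p / 2 * ((norm (B *v fst z - w))\<^sup>2 - (norm (B *v x_star r - w))\<^sup>2)
      + beta_y p / 2 * ((norm (Bt *v snd z + v))\<^sup>2 - (norm (Bt *v y_star r + v))\<^sup>2)"
    by (simp add: comp_p3_def algebra_simps)
  with x y show ?thesis by (simp add: add_divide_distrib)
qed

text \<open>Adding the stationarity conditions turns the gap into Bregman distances; the normal vectors
  contribute with the favourable sign.\<close>

lemma optimality_gap:
  assumes z: "z \<in> set_Z p"
  shows "D_f (fst z) + D_g (snd z)
    \<le> fun_f p (fst z) - fun_f p (x_star r) + (fun_g p (snd z) - fun_g p (y_star r))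
      + (Bt *v y_star r, - (B *v x_star r)) \<bullet> (z - z_star)"
proof -
  have xi: "xi r \<bullet> (fst z - x_star r) \<le> 0" and zeta: "zeta r \<bullet> (snd z - y_star r) \<le> 0"
    using reference z by (auto simp: reference_ok_def normal_cone_def set_Z_def)
  have "f_star r + Bt *v y_star r + xi r = 0" "g_star r - B *v x_star r + zeta r = 0"
    using reference by (auto simp: reference_ok_def)
  then have "xi r = - (f_star r + Bt *v y_star r)" "zeta r = - (g_star r - B *v x_star r)"
    by (metis add_eq_0_iff)+
  with xi zeta show ?thesis
    by (simp add: bregman_def inner_prod_def inner_add_left inner_diff_left)
qed

end

section \<open>One stage\<close>

text \<open>The budgets are chosen so that the condition number, which itself grows with the loop count
  through the tolerance, is a small multiple of the squared loop count.\<close>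

lemma smooth_ratio_le:
  assumes H: "H > 0" and \<delta>: "\<delta> > 0" and \<nu>: "0 \<le> \<nu>" "\<nu> \<le> 1" and \<Omega>: "\<Omega> > 0" and c: "c \<ge> 1"
    and a: "real a \<ge> c * max ((H * \<delta> powr (- (1 + \<nu>) / 2)) powr (2 / (1 + 3 * \<nu>))
              * \<Omega> powr ((\<nu> - 1) / (1 + 3 * \<nu>))) 1"
  shows "smooth_const \<nu> H (tolerance \<nu> \<Omega> a) / \<delta> \<le> 192 / c * (real a)\<^sup>2"
proof -
  define Ht e s where "Ht = H * \<delta> powr (- (1 + \<nu>) / 2)" and "e = (1 - \<nu>) / (1 + \<nu>)"
    and "s = (1 + 3 * \<nu>) / (1 + \<nu>)"
  define X where "X = Ht powr (2 / (1 + 3 * \<nu>)) * \<Omega> powr ((\<nu> - 1) / (1 + 3 * \<nu>))"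
  define G where "G = Ht powr (2 / (1 + \<nu>))"
  have n0: "1 + \<nu> > 0" "1 + 3 * \<nu> > 0" using \<nu> by auto
  have Ht: "Ht > 0" using H \<delta> by (simp add: Ht_def)
  have X: "X > 0" using Ht \<Omega> by (simp add: X_def)
  have e: "0 \<le> e" "e \<le> 1" using \<nu> by (simp_all add: e_def)
  have s: "s \<ge> 1" using \<nu> by (simp add: s_def)
  (* The ratio grows like the power e of a, while the budget is solved for the power s. *)
  have es: "e + s = 2"
  proof -
    have "e + s = 2 * (1 + \<nu>) / (1 + \<nu>)"
      unfolding e_def s_def add_divide_distrib[symmetric] by (simp add: algebra_simps)
    also have "\<dots> = 2" by (rule nonzero_mult_div_cancel_right) (use n0 in simp)
    finally show ?thesis .
  qed
  have a1: "real a \<ge> c * X" "real a \<ge> c"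
  proof -
    have "c * X \<le> c * max X 1" "c * 1 \<le> c * max X 1" using c by (auto intro!: mult_left_mono)
    then show "real a \<ge> c * X" "real a \<ge> c" using a unfolding X_def Ht_def by linarith+
  qed
  then have a0: "real a > 0" using c by linarith
  have G: "G = H powr (2 / (1 + \<nu>)) / \<delta>"
  proof -
    have "(- k / 2) * (2 / k) = - 1" if "k > 0" for k :: real using that by simp
    from this[OF n0(1)] have "(- (1 + \<nu>) / 2) * (2 / (1 + \<nu>)) = - 1" .
    then have "(\<delta> powr (- (1 + \<nu>) / 2)) powr (2 / (1 + \<nu>)) = \<delta> powr (- 1)"
      by (simp only: powr_powr)
    then show ?thesis using H \<delta> unfolding G_def Ht_def by (simp add: powr_mult powr_minus_divide)
  qed
  have 1: "smooth_const \<nu> H (tolerance \<nu> \<Omega> a) / \<delta> \<le> 192 * (real a / \<Omega>) powr e * G"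
  proof (cases "\<nu> = 1")
    case True
    have "H / \<delta> > 0" using H \<delta> by simp
    then show ?thesis using True a0 \<Omega> H unfolding G by (simp add: smooth_const_def e_def)
  next
    case False
    then have \<nu>1: "\<nu> < 1" using \<nu> by simp
    have "(1 - \<nu>) / (2 * (1 + \<nu>) * tolerance \<nu> \<Omega> a) = 192 * (e * (real a / \<Omega>))"
    proof -
      have "m / (2 * k * (\<Omega> / (384 * b))) = 192 * (m / k * (b / \<Omega>))" if "k > 0" "b > 0" for k m b :: real
        using that \<Omega> by (simp add: field_simps)
      from this[OF n0(1) a0] show ?thesis using \<nu>1 by (simp add: tolerance_def e_def)
    qed
    then have "smooth_const \<nu> H (tolerance \<nu> \<Omega> a) / \<delta> = (192 * (e * (real a / \<Omega>))) powr e * G"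
      using \<nu>1 by (simp add: smooth_const_def G e_def)
    also have "\<dots> \<le> (192 * (1 * (real a / \<Omega>))) powr e * G"
      using e a0 \<Omega> Ht by (intro mult_right_mono powr_mono2 mult_left_mono) (auto simp: G_def)
    also have "\<dots> = 192 powr e * (real a / \<Omega>) powr e * G"
      by (subst mult_1_left, subst powr_mult) (use a0 \<Omega> in auto)
    also have "\<dots> \<le> 192 powr 1 * (real a / \<Omega>) powr e * G"
      using e by (intro mult_right_mono powr_mono) (auto simp: G_def)
    finally show ?thesis by simp
  qed
  have "c * (\<Omega> powr (- e) * G) \<le> (real a) powr s"
  proof -
    have cancel: "m / (1 + 3 * \<nu>) * ((1 + 3 * \<nu>) / l) = m / l" for m l
    proof -
      have "m / k * (k / l) = m / l" if "k > 0" for k using that by simp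
      from this[OF n0(2)] show ?thesis .
    qed
    have "X powr s = Ht powr (2 / (1 + 3 * \<nu>) * s) * \<Omega> powr ((\<nu> - 1) / (1 + 3 * \<nu>) * s)"
      using Ht \<Omega> by (simp add: X_def powr_mult powr_powr)
    also have "2 / (1 + 3 * \<nu>) * s = 2 / (1 + \<nu>)"
      unfolding s_def by (rule cancel)
    also have "(\<nu> - 1) / (1 + 3 * \<nu>) * s = - e"
      unfolding s_def e_def minus_divide_left minus_diff_eq by (rule cancel)
    finally have Xs: "X powr s = \<Omega> powr (- e) * G" by (simp add: G_def mult.commute)
    have "c powr 1 * X powr s \<le> c powr s * X powr s"
      using c s by (intro mult_right_mono powr_mono) auto
    also have "\<dots> = (c * X) powr s" using c X by (simp add: powr_mult)
    also have "\<dots> \<le> (real a) powr s" using a1 c X s by (intro powr_mono2) auto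
    finally show ?thesis using c by (simp add: Xs)
  qed
  then have 2: "\<Omega> powr (- e) * G \<le> (real a) powr s / c" using c by (simp add: pos_le_divide_eq mult.commute)
  have "(real a / \<Omega>) powr e * G = (real a) powr e * (\<Omega> powr (- e) * G)"
    using a0 \<Omega> by (simp add: powr_divide powr_minus_divide)
  also have "\<dots> \<le> (real a) powr e * ((real a) powr s / c)"
    using 2 by (intro mult_left_mono) auto
  also have "\<dots> = (real a)\<^sup>2 / c"
    using a0 es by (simp add: powr_add[symmetric])
  finally have "192 * ((real a / \<Omega>) powr e * G) \<le> 192 * ((real a)\<^sup>2 / c)" by simp
  with 1 show ?thesis by (simp add: mult.assoc)
qed

lemma loop_count_ge_1: "loop_count c R a \<ge> 1"
  by (simp add: loop_count_def)

lemma cum_loops_pos: "cum_loops c R \<pi> i \<ge> 1"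
  by (induction i) (use loop_count_ge_1 in \<open>auto simp: Suc_le_eq\<close>)

lemma cum_loops_lower: "real (cum_loops c R \<pi> (Suc i)) \<ge> c * R (\<pi> (Suc i))"
proof -
  define a where "a = cum_loops c R \<pi> i"
  have a: "real a > 0" using cum_loops_pos[of c R \<pi> i] by (simp add: a_def)
  have "c * R (\<pi> (Suc i)) / real a \<le> real (loop_count c (R (\<pi> (Suc i))) a)"
    unfolding loop_count_def by (simp add: of_nat_max le_max_iff_disj) linarith
  then show ?thesis using a by (simp add: a_def[symmetric] pos_divide_le_eq mult.commute)
qed

lemma cum_loops_upper:
  assumes "c * R (\<pi> (Suc i)) \<ge> 0"
  shows "real (cum_loops c R \<pi> (Suc i)) \<le> real (cum_loops c R \<pi> i) + c * R (\<pi> (Suc i))"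
proof -
  define a where "a = cum_loops c R \<pi> i"
  have a: "real a > 0" using cum_loops_pos[of c R \<pi> i] by (simp add: a_def)
  define x where "x = c * R (\<pi> (Suc i)) / real a"
  have x: "x \<ge> 0" using assms a by (simp add: x_def)
  have "real (loop_count c (R (\<pi> (Suc i))) a) \<le> 1 + x"
    unfolding loop_count_def x_def[symmetric] using x by (simp add: of_nat_max) linarith
  then have "real a * real (loop_count c (R (\<pi> (Suc i))) a) \<le> real a * (1 + x)"
    using a by (intro mult_left_mono) auto
  also have "\<dots> = real a + c * R (\<pi> (Suc i))" using a by (simp add: x_def distrib_left)
  finally show ?thesis by (simp add: a_def)
qed

locale saddle_stage = saddle_setting p r inv_x inv_y z0
  for p :: "('n::finite, 'm::finite) saddle_problem" and r :: "('n, 'm) reference"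
    and inv_x inv_y :: bool and z0 :: "(real^'n) \<times> (real^'m)" +
  fixes c \<Omega> :: real and \<pi> :: "nat \<Rightarrow> nat"
    and fo :: "nat list \<Rightarrow> real^'n \<Rightarrow> real^'n" and go :: "nat list \<Rightarrow> real^'m \<Rightarrow> real^'m"
    and z_in :: "(real^'n) \<times> (real^'m)"
  assumes c: "c \<ge> c_min" and \<Omega>: "\<Omega> > 0" and perm: "sorting_perm (budget p \<Omega>) \<pi>"
    and fo: "fo t x \<in> subdifferential (fun_f p) x" and go: "go t y \<in> subdifferential (fun_g p) y"
    and z_in_Z: "z_in \<in> set_Z p" and z_in_V: "z_in - (x_star r, y_star r) \<in> V"
    and Psi_in: "Psi p r z_in \<le> \<Omega>"
begin

definition A :: "nat \<Rightarrow> nat" where "A = cum_loops c (budget p \<Omega>) \<pi>"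
definition tol_f :: real where "tol_f = tolerance (nu_x p) \<Omega> (A (inv \<pi> 1))"
definition tol_g :: real where "tol_g = tolerance (nu_y p) \<Omega> (A (inv \<pi> 2))"
definition lev :: "nat \<Rightarrow> ((real^'n) \<times> (real^'m)) level" where
  "lev i = component p tol_f tol_g fo go z_in (loop_count c (budget p \<Omega> (\<pi> i)) (A (i - 1))) (\<pi> i)"
definition cfun :: "nat \<Rightarrow> (real^'n) \<times> (real^'m) \<Rightarrow> real" where
  "cfun j = (if j = 1 then comp_p1 p else if j = 2 then comp_p2 p
     else comp_p3 p (fo [] (fst z_in)) (go [] (snd z_in)))"
definition cerr :: "nat \<Rightarrow> real" where
  "cerr j = (if j = 1 then tol_f else if j = 2 then tol_g else 0)"

lemma stage_eq: "stage p c \<pi> \<Omega> fo go z_in = sliding 3 (set_Z p) (op_P p) lev z_in"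
  by (simp add: stage_def Let_def lev_def[abs_def] tol_f_def tol_g_def A_def)

lemma c_ge: "c \<ge> 10 ^ 9" and c_ge_1: "c \<ge> 1"
  using c by (simp_all add: c_min_def)

lemma perm_facts: "\<pi> permutes {1, 2, 3}"
  using perm by (simp add: sorting_perm_def)

lemma perm_cases:
  assumes "i \<in> {1..3}"
  obtains "\<pi> i = 1" | "\<pi> i = 2" | "\<pi> i = 3"
proof -
  have "i \<in> {1, 2, 3}" using assms by auto
  then have "\<pi> i \<in> {1, 2, 3}" using permutes_in_image[OF perm_facts] by blast
  then show thesis using that by blast
qed

lemma A_inv_lower: "j \<in> {1, 2, 3} \<Longrightarrow> real (A (inv \<pi> j)) \<ge> c * budget p \<Omega> j"
proof -
  assume j: "j \<in> {1, 2, 3}"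
  define i where "i = inv \<pi> j"
  have "i \<in> {1, 2, 3}" unfolding i_def using j permutes_in_image[OF permutes_inv[OF perm_facts]] by blast
  then obtain k where "i = Suc k" by (cases i) auto
  moreover have "\<pi> i = j" unfolding i_def using permutes_inverses(1)[OF perm_facts] .
  ultimately show ?thesis
    using cum_loops_lower[where c = c and R = "budget p \<Omega>" and \<pi> = \<pi> and i = k]
    unfolding A_def i_def[symmetric] by simp
qed

lemma A_pos: "A i \<ge> 1"
  unfolding A_def by (rule cum_loops_pos)

lemma loops_lev: "loops (lev i) = loop_count c (budget p \<Omega> (\<pi> i)) (A (i - 1))"
  by (simp add: lev_def component_def)

lemma prod_loops: "(\<Prod>l=1..i. loops (lev l)) = A i"
proof (induction i)
  case (Suc i)
  then show ?case by (simp add: loops_lev A_def)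
qed (simp add: A_def)

lemma tol_pos: "nu_x p < 1 \<Longrightarrow> tol_f > 0" "nu_x p = 1 \<Longrightarrow> tol_f = 0"
    "nu_y p < 1 \<Longrightarrow> tol_g > 0" "nu_y p = 1 \<Longrightarrow> tol_g = 0"
  using \<Omega> A_pos[of "inv \<pi> 1"] A_pos[of "inv \<pi> 2"] by (simp_all add: tol_f_def tol_g_def tolerance_def)

lemma tol_nonneg: "tol_f \<ge> 0" "tol_g \<ge> 0"
  using tol_pos f_facts(3) g_facts(3) by (metis less_eq_real_def order.order_iff_strict)+

text \<open>The Hoelder components enter with their tolerances as errors. The third pair is exact: its curvature
  and its coupling are bounded in the metric of \<open>op_P\<close>.\<close>

lemma sliding_stage: "sliding_problem (op_P p) 3 (set_Z p) V lev (\<lambda>i. cfun (\<pi> i)) (\<lambda>i. cerr (\<pi> i))"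
proof (rule sliding_problem.intro[OF metric_operator_axioms], rule sliding_problem_axioms.intro)
  show "(3::nat) \<ge> 1" by simp
  show "closed (set_Z p)" "convex (set_Z p)"
    using domains unfolding domains_ok_def set_Z_def by (simp_all add: closed_Times convex_Times)
  show "subspace V" by (rule subspace_V)
  show "op_P p v \<in> V" if "v \<in> V" for v
  proof -
    have "subspace (range (\<lambda>u. Bt *v u))" "subspace (range (\<lambda>u. B *v u))"
      by (rule linear_subspace_image[OF matrix_vector_mul_linear subspace_UNIV])+
    then show ?thesis using that unfolding V_def op_P_def by (auto intro: subspace_scale)
  qed
  show "z - w \<in> set_Z p" if "z \<in> set_Z p" "\<And>v. v \<in> V \<Longrightarrow> v \<bullet> w = 0" for z w
    using that by (rule translate_set_Z)
  fix i assume i: "i \<in> {1..3::nat}"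
  have metric_le: "l / 2 * b \<le> l / d / 2 * S" if "l > 0" "d > 0" "d * b \<le> S" for l d b S :: real
    using mult_left_mono[OF that(3), of "l / d / 2"] that(1,2) by simp
  show "loops (lev i) \<ge> 1" unfolding loops_lev by (rule loop_count_ge_1)
  have Lx: "kappa_x p tol_f > 0" and Ly: "kappa_y p tol_g > 0"
    using smooth_const_pos[OF f_facts(4,2) tol_pos(1)] smooth_const_pos[OF g_facts(4,2) tol_pos(3)]
      delta_x_pos delta_y_pos by (simp_all add: kappa_x_def kappa_y_def)
  show "const_L (lev i) > 0"
    using Lx Ly kappa_xy_pos by (simp add: lev_def component_def)
  show "const_M (lev i) \<ge> 0"
    using kappa_xy_pos by (simp add: lev_def component_def)
  show "cerr (\<pi> i) \<ge> 0"
    using tol_nonneg by (simp add: cerr_def)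
  show "cfun (\<pi> i) x + grad (lev i) t x \<bullet> (y - x) \<le> cfun (\<pi> i) y"
    if "x \<in> set_Z p" "y \<in> set_Z p" for x y t
    using perm_cases[OF i]
  proof cases
    case 1
    then show ?thesis using fo[of t "fst x"]
      by (simp add: lev_def component_def cfun_def comp_p1_def inner_prod_def subdifferential_def)
  next
    case 2
    then show ?thesis using go[of t "snd x"]
      by (simp add: lev_def component_def cfun_def comp_p2_def inner_prod_def subdifferential_def)
  next
    case 3
    have "0 \<le> beta_x p / 2 * (norm (B *v fst (y - x)))\<^sup>2 + beta_y p / 2 * (norm (Bt *v snd (y - x)))\<^sup>2"
      using beta_nonneg by simp
    then show ?thesis using 3
        comp_p3_expansion[of "fo [] (fst z_in)" "go [] (snd z_in)" y x]
      by (simp add: lev_def component_def cfun_def)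
  qed
  show "cfun (\<pi> i) y \<le> cfun (\<pi> i) x + grad (lev i) t x \<bullet> (y - x)
      + const_L (lev i) / 2 * sqnorm (op_P p) (y - x) + cerr (\<pi> i)"
    if xy: "x \<in> set_Z p" "y \<in> set_Z p" for x y t
    using perm_cases[OF i]
  proof cases
    case 1
    have "fun_f p (fst y) \<le> fun_f p (fst x) + fo t (fst x) \<bullet> (fst y - fst x)
        + smooth_const (nu_x p) (H_x p) tol_f / 2 * (norm (fst y - fst x))\<^sup>2 + tol_f"
      using xy domains fo unfolding set_Z_def domains_ok_def
      by (intro inexact_descent[OF _ sub_f f_facts(5,2,3,4) tol_pos(1,2)]) auto
    also have "smooth_const (nu_x p) (H_x p) tol_f / 2 * (norm (fst y - fst x))\<^sup>2
        \<le> kappa_x p tol_f / 2 * sqnorm (op_P p) (y - x)"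
      unfolding kappa_x_def using Lx delta_x_pos delta_y_pos
      by (intro metric_le) (simp_all add: kappa_x_def zero_less_divide_iff sqnorm_op_P)
    finally show ?thesis using 1
      by (simp add: lev_def component_def cfun_def cerr_def comp_p1_def inner_prod_def)
  next
    case 2
    have "fun_g p (snd y) \<le> fun_g p (snd x) + go t (snd x) \<bullet> (snd y - snd x)
        + smooth_const (nu_y p) (H_y p) tol_g / 2 * (norm (snd y - snd x))\<^sup>2 + tol_g"
      using xy domains go unfolding set_Z_def domains_ok_def
      by (intro inexact_descent[OF _ sub_g g_facts(5,2,3,4) tol_pos(3,4)]) auto
    also have "smooth_const (nu_y p) (H_y p) tol_g / 2 * (norm (snd y - snd x))\<^sup>2
        \<le> kappa_y p tol_g / 2 * sqnorm (op_P p) (y - x)"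
      unfolding kappa_y_def using Ly delta_y_pos delta_x_pos
      by (intro metric_le) (simp_all add: kappa_y_def zero_less_divide_iff sqnorm_op_P)
    finally show ?thesis using 2
      by (simp add: lev_def component_def cfun_def cerr_def comp_p2_def inner_prod_def)
  next
    case 3
    then show ?thesis using p3_curvature_le[of "y - x"]
        comp_p3_expansion[of "fo [] (fst z_in)" "go [] (snd z_in)" y x]
      by (simp add: lev_def component_def cfun_def cerr_def)
  qed
  have zero: "0 \<in> range (\<lambda>u. Bt *v u)" "0 \<in> range (\<lambda>u. B *v u)"
    by (auto intro!: image_eqI[of 0 _ 0])
  show "grad (lev i) t x \<in> V" if x: "x \<in> set_Z p" for x t
    using perm_cases[OF i]
  proof cases
    case 1
    have "inv_x \<Longrightarrow> fo t (fst x) \<in> range (\<lambda>u. Bt *v u)"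
      using A3 x fo[of t "fst x"] by (auto simp: assumption_A3_def range_cond_x_def set_Z_def)
    then show ?thesis using 1 zero by (simp add: lev_def component_def V_def)
  next
    case 2
    have "inv_y \<Longrightarrow> go t (snd x) \<in> range (\<lambda>u. B *v u)"
      using A3 x go[of t "snd x"] by (auto simp: assumption_A3_def range_cond_y_def set_Z_def)
    then show ?thesis using 2 zero by (simp add: lev_def component_def V_def)
  next
    case 3
    then show ?thesis
      by (simp add: lev_def component_def V_def grad_p3_def matrix_vector_mult_scaleR[symmetric])
  qed
  show "opQ (lev i) x \<in> V" for x
  proof -
    have "- (B *v fst x) = B *v (- fst x)"
      using matrix_vector_mult_diff_distrib[of B 0 "fst x"] by simp
    then show ?thesis using zero by (simp add: lev_def component_def V_def)
  qed
  have Q3: "opQ (lev i) x - opQ (lev i) y = (Bt *v snd (x - y), - (B *v fst (x - y)))" if "\<pi> i = 3" for x y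
    using that by (simp add: lev_def component_def matrix_vector_mult_diff_distrib)
  have Q0: "opQ (lev i) = (\<lambda>z. 0)" if "\<pi> i \<noteq> 3"
    using perm_cases[OF i] that by cases (simp_all add: lev_def component_def)
  show "0 \<le> (opQ (lev i) x - opQ (lev i) y) \<bullet> (x - y)" for x y
  proof (cases "\<pi> i = 3")
    case True
    have "(Bt *v snd (x - y)) \<bullet> fst (x - y) = (B *v fst (x - y)) \<bullet> snd (x - y)"
      unfolding adjoint by (rule inner_commute)
    then show ?thesis unfolding Q3[OF True] by (simp add: inner_prod_def)
  qed (simp add: Q0)
  show "(opQ (lev i) x - opQ (lev i) y) \<bullet> w
      \<le> const_M (lev i) * sqrt (sqnorm (op_P p) (x - y)) * sqrt (sqnorm (op_P p) w)" for x y w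
  proof (cases "\<pi> i = 3")
    case True
    then have "const_M (lev i) = sqrt (kappa_xy p)" by (simp add: lev_def component_def)
    then show ?thesis unfolding Q3[OF True] using coupling_lipschitz[of "x - y" w] by simp
  next
    case False
    then have "const_M (lev i) \<ge> 0" using kappa_xy_pos by (simp add: lev_def component_def)
    then show ?thesis using Q0[OF False] sqnorm_nonneg by simp
  qed
qed

interpretation sliding: sliding_problem "op_P p" 3 "set_Z p" V z_star lev "\<lambda>i. cfun (\<pi> i)" "\<lambda>i. cerr (\<pi> i)"
  by (rule sliding_stage)

text \<open>The inequality of the sliding algorithm at the reference point. The loop counts make the weight of
  the distance small, and the tolerances were divided by the loop counts so that the accumulated
  inexactness is \<open>\<Omega> / 384\<close> per component with exponent below 1.\<close>

lemma stage_gap: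
  defines "v \<equiv> fst (stage p c \<pi> \<Omega> fo go z_in)"
  shows "v \<in> set_Z p" and "v - z_star \<in> V"
    and "fun_f p (fst v) - fun_f p (x_star r) + (fun_g p (snd v) - fun_g p (y_star r))
        + (comp_p3 p (fo [] (fst z_in)) (go [] (snd z_in)) v - comp_p3 p (fo [] (fst z_in)) (go [] (snd z_in)) z_star)
        + (Bt *v y_star r, - (B *v x_star r)) \<bullet> (v - z_star)
      \<le> sqnorm (op_P p) (z_in - z_star) / 1000
        + (if nu_x p < 1 then \<Omega> / 384 else 0) + (if nu_y p < 1 then \<Omega> / 384 else 0)"
    (is "?gap \<le> ?bound")
proof -
  have W: "z_in \<in> sliding.W" using z_in_Z z_in_V by (simp add: sliding.W_def)
  have v: "v = fst (sliding 3 (set_Z p) (op_P p) lev z_in)" by (simp add: v_def stage_eq)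
  have "v \<in> sliding.W" unfolding v by (rule sliding.sliding_correct(1)[OF W])
  then show "v \<in> set_Z p" "v - z_star \<in> V" by (auto simp: sliding.W_def)
  define D where "D = sqnorm (op_P p) (z_in - z_star)"
  have D: "D \<ge> 0" by (simp add: D_def sqnorm_nonneg)
  have star: "z_star \<in> set_Z p"
    using reference by (auto simp: reference_ok_def saddle_points_def set_Z_def)
  define Q where "Q j = (if j = (3::nat) then (Bt *v y_star r, - (B *v x_star r)) else 0)" for j
  define a where "a j = real (A (inv \<pi> j))" for j
  define L where "L j = (if j = 1 then kappa_x p tol_f else if j = 2 then kappa_y p tol_g else kappa_xy p)" for j :: nat
  define M where "M j = (if j = 3 then sqrt (kappa_xy p) else 0)" for j :: nat
  have a_pos: "a j > 0" for j using A_pos[of "inv \<pi> j"] by (simp add: a_def)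
  have reindex: "(\<Sum>i=1..3. h (\<pi> i)) = h 1 + h 2 + h 3" for h :: "nat \<Rightarrow> real"
  proof -
    have "{1..3} = {1, 2, 3::nat}" by auto
    then have "(\<Sum>i=1..3. h (\<pi> i)) = (\<Sum>i\<in>{1, 2, 3}. h (\<pi> i))" by simp
    also have "\<dots> = sum h {1, 2, 3}"
      using sum.permute[OF perm_facts, of h] by (simp add: comp_def)
    finally show ?thesis by simp
  qed
  let ?S = "\<Sum>i=1..3. cfun (\<pi> i) v - cfun (\<pi> i) z_star + opQ (lev i) z_star \<bullet> (v - z_star)"
  have "?S \<le> (\<Sum>i=1..3. (const_L (lev i) * (\<Prod>l=1..i. sliding.tau l)\<^sup>2 + const_M (lev i) * (\<Prod>l=1..i. sliding.tau l)) / 2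
            * D + cerr (\<pi> i) * (\<Prod>l=1..i. real (loops (lev l))))"
    unfolding D_def v by (rule sliding.sliding_correct(2)[OF W star])
  also have "\<dots> \<le> (\<Sum>i=1..3. (L (\<pi> i) * (8 / a (\<pi> i))\<^sup>2 + M (\<pi> i) * (8 / a (\<pi> i))) / 2
            * D + cerr (\<pi> i) * a (\<pi> i))"
  proof (rule sum_mono)
    fix i assume i: "i \<in> {1..3::nat}"
    have ai: "a (\<pi> i) = real (A i)" by (simp add: a_def permutes_inverses(2)[OF perm_facts])
    have loops: "(\<Prod>l=1..i. real (loops (lev l))) = real (A i)"
      using prod_loops[of i] by (metis of_nat_prod)
    have tau_nonneg: "(\<Prod>l=1..i. sliding.tau l) \<ge> 0"
      using sliding.tau_pos by (simp add: prod_nonneg less_imp_le)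
    have "(\<Prod>l=1..i. sliding.tau l) \<le> (\<Prod>l=1..i. 2 / real (loops (lev l)))"
    proof (rule prod_mono, safe)
      fix l
      show "sliding.tau l \<ge> 0" using sliding.tau_pos[of l] by simp
      have "loops (lev l) \<ge> 1" unfolding loops_lev by (rule loop_count_ge_1)
      then show "sliding.tau l \<le> 2 / real (loops (lev l))"
        unfolding sliding.tau_def by (rule alpha_last_le)
    qed
    also have "\<dots> = 2 ^ i / real (A i)" by (simp only: prod_dividef loops) simp
    also have "\<dots> \<le> 8 / real (A i)"
      using i power_increasing[of i 3 "2::real"] by (intro divide_right_mono) auto
    (* There are three levels, and each step size is at most 2 over its loop count. *)
    finally have tau: "(\<Prod>l=1..i. sliding.tau l) \<le> 8 / a (\<pi> i)" by (simp add: ai)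
    have LM: "const_L (lev i) = L (\<pi> i)" "const_M (lev i) = M (\<pi> i)" "const_L (lev i) > 0" "const_M (lev i) \<ge> 0"
      using perm_cases[OF i] sliding.L_pos[OF i] sliding.M_nonneg[OF i]
      by (auto simp: lev_def component_def L_def M_def)
    have "const_L (lev i) * (\<Prod>l=1..i. sliding.tau l)\<^sup>2 + const_M (lev i) * (\<Prod>l=1..i. sliding.tau l)
        \<le> const_L (lev i) * (8 / a (\<pi> i))\<^sup>2 + const_M (lev i) * (8 / a (\<pi> i))"
      using LM(3,4) tau tau_nonneg by (intro add_mono mult_left_mono power_mono) auto
    then show "(const_L (lev i) * (\<Prod>l=1..i. sliding.tau l)\<^sup>2 + const_M (lev i) * (\<Prod>l=1..i. sliding.tau l)) / 2
            * D + cerr (\<pi> i) * (\<Prod>l=1..i. real (loops (lev l)))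
        \<le> (L (\<pi> i) * (8 / a (\<pi> i))\<^sup>2 + M (\<pi> i) * (8 / a (\<pi> i))) / 2 * D + cerr (\<pi> i) * a (\<pi> i)"
      unfolding loops ai[symmetric] LM(1,2)[symmetric] using D
      by (intro add_right_mono mult_right_mono divide_right_mono) auto
  qed
  also have "\<dots> = (L 1 * (8 / a 1)\<^sup>2 + M 1 * (8 / a 1)) / 2 * D + cerr 1 * a 1
      + ((L 2 * (8 / a 2)\<^sup>2 + M 2 * (8 / a 2)) / 2 * D + cerr 2 * a 2)
      + ((L 3 * (8 / a 3)\<^sup>2 + M 3 * (8 / a 3)) / 2 * D + cerr 3 * a 3)"
    by (rule reindex[of "\<lambda>j. (L j * (8 / a j)\<^sup>2 + M j * (8 / a j)) / 2 * D + cerr j * a j"])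
  also have "\<dots> \<le> 1/4000 * D + (if nu_x p < 1 then \<Omega> / 384 else 0)
      + (1/4000 * D + (if nu_y p < 1 then \<Omega> / 384 else 0)) + 1/4000 * D"
  proof -
    (* Each pair contributes at most 1/4000: the factor 192 is that of smooth_ratio_le. *)
    have c9: "192 / c \<le> 192 / 10 ^ 9" using c_ge by (intro divide_left_mono) auto
    have small: "(l * (8 / b)\<^sup>2 + 0 * (8 / b)) / 2 * D \<le> 1/4000 * D"
      if l: "l \<le> 192 / c * b\<^sup>2" and b: "b > 0" for l b :: real
    proof -
      have "l * (8 / b)\<^sup>2 \<le> 192 / c * b\<^sup>2 * (8 / b)\<^sup>2"
        using l by (rule mult_right_mono) simp
      also have "\<dots> = 64 * (192 / c)" using b by (simp add: power2_eq_square)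
      also have "\<dots> \<le> 64 * (192 / 10 ^ 9)" using c9 by simp
      finally show ?thesis using D by (intro mult_right_mono) auto
    qed
    have 1: "L 1 \<le> 192 / c * (a 1)\<^sup>2"
    proof -
      have low: "c * budget p \<Omega> 1 \<le> real (A (inv \<pi> 1))" by (rule A_inv_lower) simp
      show ?thesis
        unfolding L_def a_def using low
          smooth_ratio_le[OF f_facts(4) delta_x_pos f_facts(2,3) \<Omega> c_ge_1, of "A (inv \<pi> 1)"]
        by (simp add: kappa_x_def tol_f_def budget_def Htilde_x_def)
    qed
    have 2: "L 2 \<le> 192 / c * (a 2)\<^sup>2"
    proof -
      have low: "c * budget p \<Omega> 2 \<le> real (A (inv \<pi> 2))" by (rule A_inv_lower) simp
      show ?thesis
        unfolding L_def a_def using low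
          smooth_ratio_le[OF g_facts(4) delta_y_pos g_facts(2,3) \<Omega> c_ge_1, of "A (inv \<pi> 2)"]
        by (simp add: kappa_y_def tol_g_def budget_def Htilde_y_def)
    qed
    have 3: "(L 3 * (8 / a 3)\<^sup>2 + M 3 * (8 / a 3)) / 2 * D \<le> 1/4000 * D"
    proof -
      define k where "k = sqrt (kappa_xy p)"
      have k: "k > 0" "k\<^sup>2 = kappa_xy p" using kappa_xy_pos by (simp_all add: k_def)
      have "c * max k 1 \<le> a 3" unfolding a_def k_def using A_inv_lower[of 3] by (simp add: budget_def)
      moreover have "c * k \<le> c * max k 1" using c_ge_1 by (intro mult_left_mono) auto
      moreover have "10 ^ 9 * k \<le> c * k" using c_ge k by (intro mult_right_mono) auto
      ultimately have q: "k / a 3 \<le> 1 / 10 ^ 9"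
        using a_pos[of 3] by (simp add: field_simps)
      have q0: "k / a 3 \<ge> 0" using k a_pos[of 3] by simp
      have q2: "(k / a 3)\<^sup>2 \<le> (1 / 10 ^ 9)\<^sup>2" using q q0 by (rule power_mono)
      have LM: "L 3 * (8 / a 3)\<^sup>2 = 64 * (k / a 3)\<^sup>2" "M 3 * (8 / a 3) = 8 * (k / a 3)"
        using k(1) by (simp_all add: L_def M_def k(2)[symmetric] power_divide)
      have "(64 * x\<^sup>2 + 8 * x) / 2 \<le> 1/4000" if "x \<le> 1 / 10 ^ 9" "x\<^sup>2 \<le> (1 / 10 ^ 9)\<^sup>2" for x :: real
        using that by (simp add: power_divide)
      from this[OF q q2] have "(L 3 * (8 / a 3)\<^sup>2 + M 3 * (8 / a 3)) / 2 \<le> 1/4000"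
        unfolding LM .
      then show ?thesis using D by (rule mult_right_mono)
    qed
    have e1: "cerr 1 * a 1 = (if nu_x p < 1 then \<Omega> / 384 else 0)"
      using a_pos[of 1] by (simp add: cerr_def tol_f_def tolerance_def a_def)
    have e2: "cerr 2 * a 2 = (if nu_y p < 1 then \<Omega> / 384 else 0)"
      using a_pos[of 2] by (simp add: cerr_def tol_g_def tolerance_def a_def)
    have e3: "cerr 3 * a 3 = 0" by (simp add: cerr_def)
    have M12: "M 1 = 0" "M 2 = 0" by (simp_all add: M_def)
    show ?thesis unfolding e1 e2 e3 M12
      using small[OF 1 a_pos] small[OF 2 a_pos] 3 by linarith
  qed
  also have "\<dots> \<le> D / 1000 + (if nu_x p < 1 then \<Omega> / 384 else 0) + (if nu_y p < 1 then \<Omega> / 384 else 0)"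
    using D by simp
  finally have main: "?S
     \<le> D / 1000 + (if nu_x p < 1 then \<Omega> / 384 else 0) + (if nu_y p < 1 then \<Omega> / 384 else 0)" .
  have "?S
      = (\<Sum>i=1..3. cfun (\<pi> i) v - cfun (\<pi> i) z_star + Q (\<pi> i) \<bullet> (v - z_star))"
  proof (rule sum.cong[OF refl])
    fix i assume "i \<in> {1..3::nat}"
    from perm_cases[OF this] have "opQ (lev i) z_star = Q (\<pi> i)"
      by cases (simp_all add: lev_def component_def Q_def)
    then show "cfun (\<pi> i) v - cfun (\<pi> i) z_star + opQ (lev i) z_star \<bullet> (v - z_star)
        = cfun (\<pi> i) v - cfun (\<pi> i) z_star + Q (\<pi> i) \<bullet> (v - z_star)" by simp
  qed
  also have "\<dots> = ?gap"
    by (subst reindex[of "\<lambda>j. cfun j v - cfun j z_star + Q j \<bullet> (v - z_star)"])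
      (simp add: cfun_def Q_def comp_p1_def comp_p2_def)
  finally show "?gap \<le> ?bound" using main unfolding D_def by simp
qed

text \<open>The inexactness occurs only for exponents below 1 and the Bregman term of the input only for
  exponent 1, so that the contraction survives in each of the four cases.\<close>

lemma stage_contraction: "Psi p r (fst (stage p c \<pi> \<Omega> fo go z_in)) \<le> 3/4 * \<Omega>"
proof -
  define v where "v = fst (stage p c \<pi> \<Omega> fo go z_in)"
  have vZ: "v \<in> set_Z p" and vV: "v - z_star \<in> V" unfolding v_def by (rule stage_gap)+
  define Ef Eg where "Ef = D_f (fst v)"
    and "Eg = D_g (snd v)"
  define If Ig where "If = D_f (fst z_in)"
    and "Ig = D_g (snd z_in)"
  define X Y where "X = (norm (fst v - x_star r))\<^sup>2" and "Y = (norm (snd v - y_star r))\<^sup>2"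
  define D where "D = sqnorm (op_P p) (z_in - z_star)"
  define W where "W = 4 * beta_x p * (mu_xy p)\<^sup>2 * X + 4 * beta_y p * (mu_yx p)\<^sup>2 * Y"
  have star: "f_star r \<in> subdifferential (fun_f p) (x_star r)" "g_star r \<in> subdifferential (fun_g p) (y_star r)"
    "x_star r \<in> set_X p" "y_star r \<in> set_Y p"
    using reference by (auto simp: reference_ok_def saddle_points_def)
  have nonneg: "If \<ge> 0" "Ig \<ge> 0" "D \<ge> 0"
    using star(1,2) by (simp_all add: If_def Ig_def D_def bregman_nonneg sqnorm_nonneg)
  have inp: "D + 12 * If + 12 * Ig \<le> \<Omega>"
    using Psi_in by (simp add: Psi_def D_def If_def Ig_def)
  have strong: "mu_x p * X + mu_y p * Y \<le> 2 * (Ef + Eg)"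
    using f_facts(6)[OF star(3) _ star(1), of "fst v"] g_facts(6)[OF star(4) _ star(2), of "snd v"] vZ
    by (simp add: Ef_def Eg_def X_def Y_def bregman_def set_Z_def mem_Times_iff)
  have "Ef + Eg + (W / 16 - (if nu_y p = 1 then Ig / 2 else 0) - (if nu_x p = 1 then If / 2 else 0))
      \<le> D / 1000 + (if nu_x p < 1 then \<Omega> / 384 else 0) + (if nu_y p < 1 then \<Omega> / 384 else 0)"
    using stage_gap(3) optimality_gap[OF vZ] p3_increase[OF vV fo[of "[]" "fst z_in"] go[of "[]" "snd z_in"]]
    unfolding v_def[symmetric] Ef_def[symmetric] Eg_def[symmetric] If_def[symmetric] Ig_def[symmetric]
      X_def[symmetric] Y_def[symmetric] D_def[symmetric] W_def[symmetric] by linarith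
  then have gap: "16 * (Ef + Eg) + W \<le> 16 * (D / 1000 + (if nu_x p < 1 then \<Omega> / 384 else If / 2)
      + (if nu_y p < 1 then \<Omega> / 384 else Ig / 2))"
    using f_facts(3) g_facts(3) by (auto split: if_splits)
  have "Psi p r v = mu_x p * X + mu_y p * Y + W + 12 * (Ef + Eg)"
    by (simp add: Psi_def sqnorm_op_P X_def Y_def W_def Ef_def Eg_def delta_x_def delta_y_def algebra_simps)
  (* Strong convexity bounds the remaining part of the distance by 2 * (Ef + Eg), and 12 + 2 \<le> 16. *)
  also have "\<dots> \<le> 16 * (Ef + Eg) + W"
  proof -
    have "0 \<le> Ef + Eg" using star(1,2) by (simp add: Ef_def Eg_def bregman_nonneg)
    moreover have "s + w + 12 * e \<le> 16 * e + w" if "s \<le> 2 * e" "0 \<le> e" for s w e :: real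
      using that by linarith
    ultimately show ?thesis using strong by blast
  qed
  also have "\<dots> \<le> 3/4 * \<Omega>"
    using gap inp nonneg \<Omega> by (auto split: if_splits)
  finally show ?thesis by (simp add: v_def)
qed

lemma stage_counts:
  assumes "j \<in> {1, 2, 3}"
  shows "n_grad (snd (stage p c \<pi> \<Omega> fo go z_in)) (inv \<pi> j) = A (inv \<pi> j)"
    and "n_op (snd (stage p c \<pi> \<Omega> fo go z_in)) (inv \<pi> j) = 2 * A (inv \<pi> j)"
proof -
  have "inv \<pi> j \<in> {1, 2, 3}"
    using assms permutes_in_image[OF permutes_inv[OF perm_facts]] by blast
  then have "inv \<pi> j \<in> {1..3}" by auto
  then show "n_grad (snd (stage p c \<pi> \<Omega> fo go z_in)) (inv \<pi> j) = A (inv \<pi> j)"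
    "n_op (snd (stage p c \<pi> \<Omega> fo go z_in)) (inv \<pi> j) = 2 * A (inv \<pi> j)"
    unfolding stage_eq by (simp_all add: sliding_counts prod_loops[simplified])
qed

text \<open>Each level adds at most its scaled budget to the count of the previous one. In increasing order the
  largest budget dominates, and 1, the initial count, is below all of them.\<close>

lemma A_inv_upper:
  assumes j: "j \<in> {1, 2, 3}"
  shows "real (A (inv \<pi> j)) \<le> 4 * c * budget p \<Omega> j"
proof -
  let ?R = "\<lambda>i. budget p \<Omega> (\<pi> i)"
  have R1: "?R i \<ge> 1" for i by (simp add: budget_def)
  have mono: "?R 1 \<le> ?R 2" "?R 2 \<le> ?R 3" using perm by (simp_all add: sorting_perm_def)
  have cR: "c * ?R i \<ge> 0" for i using c_ge_1 R1[of i] by simp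
  note up = cum_loops_upper[where c = c and R = "budget p \<Omega>" and \<pi> = \<pi>, OF cR]
  have A1: "real (A 1) \<le> 1 + c * ?R 1" and A2: "real (A 2) \<le> real (A 1) + c * ?R 2"
    and A3: "real (A 3) \<le> real (A 2) + c * ?R 3"
    using up[of 0] up[of 1] up[of 2] by (simp_all add: A_def numeral_2_eq_2 numeral_3_eq_3)
  have "1 * 1 \<le> c * ?R 1" using c_ge_1 R1[of 1] by (intro mult_mono) auto
  moreover have "c * ?R 1 \<le> c * ?R 2" "c * ?R 2 \<le> c * ?R 3"
    using mono c_ge_1 by (auto intro!: mult_left_mono)
  ultimately have bound: "real (A i) \<le> 4 * (c * ?R i)" if "i \<in> {1, 2, 3}" for i
    using A1 A2 A3 that cR by auto
  have "inv \<pi> j \<in> {1, 2, 3}"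
    using j permutes_in_image[OF permutes_inv[OF perm_facts]] by blast
  from bound[OF this] show ?thesis by (simp add: permutes_inverses(1)[OF perm_facts])
qed

end

section \<open>Restarts and total cost\<close>

lemma num_restarts_bounds:
  assumes e: "0 < \<epsilon>" "\<epsilon> \<le> \<Psi>0"
  shows "Omega \<Psi>0 (num_restarts \<Psi>0 \<epsilon>) \<le> \<epsilon>"
    and "(4/3) ^ num_restarts \<Psi>0 \<epsilon> \<le> 4/3 * (\<Psi>0 / \<epsilon>)"
    and "real (num_restarts \<Psi>0 \<epsilon>) \<le> ln (\<Psi>0 / \<epsilon>) / ln (4/3) + 1"
proof -
  define x S where "x = ln (\<Psi>0 / \<epsilon>) / ln (4/3)" and "S = num_restarts \<Psi>0 \<epsilon>"
  have q: "\<Psi>0 / \<epsilon> \<ge> 1" using e by simp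
  have l: "ln (4/3 :: real) > 0" by simp
  have x0: "x \<ge> 0" using q l unfolding x_def by (intro divide_nonneg_pos ln_ge_zero) auto
  have S: "x \<le> real S" "real S \<le> x + 1"
    unfolding S_def num_restarts_def x_def[symmetric] using x0 by linarith+
  have px: "(4/3) powr x = \<Psi>0 / \<epsilon>"
    using l q by (simp add: powr_def x_def)
  have "\<Psi>0 / \<epsilon> \<le> (4/3) powr (real S)" unfolding px[symmetric] using S by (intro powr_mono) auto
  then have "\<Psi>0 / \<epsilon> \<le> (4/3) ^ S" by (simp add: powr_realpow)
  then have "\<Psi>0 \<le> (4/3) ^ S * \<epsilon>" using e by (simp add: pos_divide_le_eq)
  then have "(3/4) ^ S * \<Psi>0 \<le> (3/4) ^ S * ((4/3) ^ S * \<epsilon>)" by (intro mult_left_mono) auto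
  also have "\<dots> = ((3/4) * (4/3)) ^ S * \<epsilon>" by (simp only: power_mult_distrib mult.assoc)
  finally show "Omega \<Psi>0 (num_restarts \<Psi>0 \<epsilon>) \<le> \<epsilon>" by (simp add: Omega_def S_def)
  have "(4/3) powr (real S) \<le> (4/3) powr (x + 1)" using S by (intro powr_mono) auto
  also have "\<dots> = 4/3 * (\<Psi>0 / \<epsilon>)" by (simp add: powr_add px)
  finally show "(4/3) ^ num_restarts \<Psi>0 \<epsilon> \<le> 4/3 * (\<Psi>0 / \<epsilon>)"
    by (simp add: powr_realpow S_def)
  show "real (num_restarts \<Psi>0 \<epsilon>) \<le> ln (\<Psi>0 / \<epsilon>) / ln (4/3) + 1"
    using S by (simp add: S_def x_def)
qed

text \<open>If the cost of a stage is bounded, the total is proportional to the number of restarts.\<close>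

lemma total_soft_bigo:
  fixes N :: "nat \<Rightarrow> real"
  assumes \<Psi>: "\<Psi>0 > 0" and N: "\<And>s. 0 \<le> N s" "\<And>s. N s \<le> K" and h: "h > 0"
  shows "(\<lambda>\<epsilon>. \<Sum>s<num_restarts \<Psi>0 \<epsilon>. N s) \<in> soft_bigo \<Psi>0 (\<lambda>\<epsilon>. h)"
proof -
  have K: "K \<ge> 0" using N[of 0] by linarith
  have l: "ln (4/3 :: real) > 0" by simp
  have "\<forall>\<^sub>F \<epsilon> in at_right 0. norm (\<Sum>s<num_restarts \<Psi>0 \<epsilon>. N s)
      \<le> ((1 / ln (4/3) + 1) * K / h) * norm (h * ln (\<Psi>0 / \<epsilon>) ^ 1)"
    unfolding eventually_at_right_field
  (* Below this threshold the logarithm is at least 1 and absorbs the rounding in num_restarts. *)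
  proof (intro exI[of _ "\<Psi>0 / exp 1"] conjI allI impI)
    fix \<epsilon> :: real assume e: "0 < \<epsilon>" "\<epsilon> < \<Psi>0 / exp 1"
    have ex: "exp 1 < \<Psi>0 / \<epsilon>" using e by (simp add: field_simps)
    then have "ln (exp 1) < ln (\<Psi>0 / \<epsilon>)" using e \<Psi> by (subst ln_less_cancel_iff) auto
    then have ln1: "1 \<le> ln (\<Psi>0 / \<epsilon>)" by simp
    have "(1::real) < exp 1" by simp
    then have "1 < \<Psi>0 / \<epsilon>" using ex by linarith
    then have le: "\<epsilon> \<le> \<Psi>0" using e by (simp add: field_simps)
    have "(\<Sum>s<num_restarts \<Psi>0 \<epsilon>. N s) \<le> (\<Sum>s<num_restarts \<Psi>0 \<epsilon>. K)" by (intro sum_mono N)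
    also have "\<dots> = real (num_restarts \<Psi>0 \<epsilon>) * K" by simp
    also have "\<dots> \<le> (ln (\<Psi>0 / \<epsilon>) / ln (4/3) + 1) * K"
      using num_restarts_bounds(3)[OF e(1) le] K by (rule mult_right_mono)
    also have "\<dots> \<le> (ln (\<Psi>0 / \<epsilon>) / ln (4/3) + ln (\<Psi>0 / \<epsilon>)) * K"
      using ln1 K by (intro mult_right_mono add_left_mono) auto
    also have "\<dots> = ((1 / ln (4/3) + 1) * K) * ln (\<Psi>0 / \<epsilon>)"
      by (simp add: algebra_simps)
    also have "\<dots> = ((1 / ln (4/3) + 1) * K / h) * (h * ln (\<Psi>0 / \<epsilon>))"
      using h by simp
    finally show "norm (\<Sum>s<num_restarts \<Psi>0 \<epsilon>. N s)
        \<le> ((1 / ln (4/3) + 1) * K / h) * norm (h * ln (\<Psi>0 / \<epsilon>) ^ 1)"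
      using h ln1 N(1) by (simp add: sum_nonneg abs_mult)
  qed (use \<Psi> in simp)
  then have "(\<lambda>\<epsilon>. \<Sum>s<num_restarts \<Psi>0 \<epsilon>. N s) \<in> O[at_right 0](\<lambda>\<epsilon>. h * ln (\<Psi>0 / \<epsilon>) ^ 1)"
    by (rule bigoI)
  then show ?thesis unfolding soft_bigo_def by blast
qed

text \<open>For a cost that grows geometrically with the stage, the last stage dominates and no logarithm
  appears.\<close>

lemma total_bigo:
  fixes N :: "nat \<Rightarrow> real"
  assumes \<Psi>: "\<Psi>0 > 0" and a: "a > 0"
    and N: "\<And>s. 0 \<le> N s" "\<And>s. N s \<le> K * Omega \<Psi>0 s powr (- a)" and h: "h > 0"
  shows "(\<lambda>\<epsilon>. \<Sum>s<num_restarts \<Psi>0 \<epsilon>. N s) \<in> O[at_right 0](\<lambda>\<epsilon>. h * \<epsilon> powr (- a))"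
proof -
  define q :: real where "q = (4/3) powr a"
  have q: "q > 1" unfolding q_def using a by simp
  have Om: "Omega \<Psi>0 s powr (- a) = \<Psi>0 powr (- a) * q ^ s" for s
  proof -
    have "((3/4) ^ s) powr (- a) = ((3/4) powr (- a)) ^ s"
      by (simp add: powr_realpow[symmetric] powr_powr mult.commute)
    also have "(3/4) powr (- a) = q"
      by (simp add: q_def powr_minus powr_divide)
    finally show ?thesis using \<Psi> by (simp add: Omega_def powr_mult)
  qed
  have "0 \<le> K * Omega \<Psi>0 0 powr (- a)" using N[of 0] by linarith
  then have K: "K \<ge> 0" using \<Psi> by (simp add: Omega_def zero_le_mult_iff)
  define C where "C = K * \<Psi>0 powr (- a) / (q - 1) * (4/3 * \<Psi>0) powr a"
  have "\<forall>\<^sub>F \<epsilon> in at_right 0. norm (\<Sum>s<num_restarts \<Psi>0 \<epsilon>. N s) \<le> (C / h) * norm (h * \<epsilon> powr (- a))"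
    unfolding eventually_at_right_field
  proof (intro exI[of _ \<Psi>0] conjI allI impI)
    fix \<epsilon> :: real assume e: "0 < \<epsilon>" "\<epsilon> < \<Psi>0"
    define S where "S = num_restarts \<Psi>0 \<epsilon>"
    have "(\<Sum>s<S. N s) \<le> (\<Sum>s<S. K * \<Psi>0 powr (- a) * q ^ s)"
      using N(2) by (intro sum_mono) (simp add: Om mult.assoc)
    also have "\<dots> = K * \<Psi>0 powr (- a) * ((q ^ S - 1) / (q - 1))"
      using q by (simp add: sum_distrib_left[symmetric] geometric_sum)
    also have "\<dots> \<le> K * \<Psi>0 powr (- a) * (q ^ S / (q - 1))"
      using K q by (intro mult_left_mono divide_right_mono) auto
    also have "\<dots> \<le> K * \<Psi>0 powr (- a) * (((4/3 * \<Psi>0) powr a * \<epsilon> powr (- a)) / (q - 1))"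
    proof (intro mult_left_mono divide_right_mono)
      have "q ^ S = ((4/3) ^ S) powr a"
        by (simp add: q_def powr_realpow[symmetric] powr_powr mult.commute)
      also have "\<dots> \<le> (4/3 * (\<Psi>0 / \<epsilon>)) powr a"
        using num_restarts_bounds(2)[of \<epsilon> \<Psi>0] e a unfolding S_def by (intro powr_mono2) auto
      also have "4/3 * (\<Psi>0 / \<epsilon>) = (4/3 * \<Psi>0) / \<epsilon>" by simp
      also have "\<dots> powr a = (4/3 * \<Psi>0) powr a * \<epsilon> powr (- a)"
        using e \<Psi> powr_divide[of "4/3 * \<Psi>0" \<epsilon> a]
        by (simp only: powr_minus_divide times_divide_eq_right mult_1_right)
      finally show "q ^ S \<le> (4/3 * \<Psi>0) powr a * \<epsilon> powr (- a)" .
    qed (use K q in auto)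
    also have "\<dots> = (C / h) * (h * \<epsilon> powr (- a))"
      using h by (simp add: C_def)
    finally show "norm (\<Sum>s<num_restarts \<Psi>0 \<epsilon>. N s) \<le> (C / h) * norm (h * \<epsilon> powr (- a))"
      using h N(1) by (simp add: S_def sum_nonneg abs_mult)
  qed (use \<Psi> in simp)
  then show ?thesis by (rule bigoI)
qed

text \<open>The accuracies \<open>Omega \<Psi>0 s\<close> do not exceed \<open>\<Psi>0\<close>, so the constant 1 in the budget and the additional
  evaluation per stage are dominated by a multiple of the same negative power.\<close>

lemma holder_budget_total:
  fixes N :: "nat \<Rightarrow> real"
  assumes \<Psi>: "\<Psi>0 > 0" and \<nu>: "0 \<le> \<nu>" "\<nu> < 1" and X: "X > 0" and c: "c \<ge> 0"
    and N: "\<And>s. 0 \<le> N s"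
      "\<And>s. N s \<le> 4 * c * max (X * Omega \<Psi>0 s powr ((\<nu> - 1) / (1 + 3 * \<nu>))) 1 + 1"
  shows "(\<lambda>\<epsilon>. \<Sum>s<num_restarts \<Psi>0 \<epsilon>. N s) \<in> O[at_right 0](\<lambda>\<epsilon>. X * \<epsilon> powr ((\<nu> - 1) / (1 + 3 * \<nu>)))"
proof -
  define a where "a = (1 - \<nu>) / (1 + 3 * \<nu>)"
  have a: "a > 0" using \<nu> by (simp add: a_def)
  have ma: "(\<nu> - 1) / (1 + 3 * \<nu>) = - a" by (simp add: a_def minus_divide_left)
  have "N s \<le> (4 * c * (X + \<Psi>0 powr a) + \<Psi>0 powr a) * Omega \<Psi>0 s powr (- a)" for s
  proof -
    define w where "w = Omega \<Psi>0 s powr (- a)"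
    have pos: "Omega \<Psi>0 s > 0" using \<Psi> by (simp add: Omega_def)
    have "(3/4 :: real) ^ s \<le> 1" by (simp add: power_le_one)
    then have "Omega \<Psi>0 s \<le> \<Psi>0" using \<Psi> by (simp add: Omega_def)
    then have "Omega \<Psi>0 s powr a \<le> \<Psi>0 powr a" using pos a by (intro powr_mono2) auto
    then have "Omega \<Psi>0 s powr a * w \<le> \<Psi>0 powr a * w"
      by (rule mult_right_mono) (simp add: w_def)
    then have 1: "1 \<le> \<Psi>0 powr a * w" using pos by (simp add: w_def powr_add[symmetric])
    have "max (X * w) 1 \<le> X * w + \<Psi>0 powr a * w"
    proof -
      have "X * w \<ge> 0" using X by (simp add: w_def)
      with 1 show ?thesis by simp
    qed
    then have "4 * c * max (X * w) 1 \<le> 4 * c * (X * w + \<Psi>0 powr a * w)"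
      using c by (intro mult_left_mono) auto
    moreover have "N s \<le> 4 * c * max (X * w) 1 + 1" using N(2)[of s] by (simp add: ma w_def)
    ultimately have "N s \<le> 4 * c * (X * w + \<Psi>0 powr a * w) + \<Psi>0 powr a * w" using 1 by linarith
    also have "\<dots> = (4 * c * (X + \<Psi>0 powr a) + \<Psi>0 powr a) * w" by (simp add: algebra_simps)
    finally show ?thesis by (simp add: w_def)
  qed
  then show ?thesis unfolding ma by (rule total_bigo[OF \<Psi> a N(1) _ X])
qed

context saddle_setting
begin

lemma Psi_nonneg: "Psi p r z \<ge> 0"
proof -
  have "D_f (fst z) \<ge> 0" "D_g (snd z) \<ge> 0"
    using reference by (auto simp: reference_ok_def intro!: bregman_nonneg)
  then show ?thesis using sqnorm_nonneg[of "z - z_star"] unfolding Psi_def by linarith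
qed

text \<open>The hypotheses on the input of a stage are its conclusions on the output, with the next bound.\<close>

lemma restart_stage:
  assumes c: "c \<ge> c_min" and \<Psi>: "Psi p r z0 > 0"
    and perm: "\<And>s. sorting_perm (budget p (Omega (Psi p r z0) s)) (\<pi> s)"
    and fo: "\<And>s t x. fo s t x \<in> subdifferential (fun_f p) x"
    and go: "\<And>s t y. go s t y \<in> subdifferential (fun_g p) y"
    and z0: "z0 \<in> set_Z p"
  shows "saddle_stage p r inv_x inv_y z0 c (Omega (Psi p r z0) s) (\<pi> s) (fo s) (go s)
    (restart_iter p c \<pi> fo go (Psi p r z0) z0 s)"
proof (induction s)
  have Om: "Omega (Psi p r z0) s > 0" for s using \<Psi> by (simp add: Omega_def)
  note stage = saddle_stage.intro[OF saddle_setting_axioms saddle_stage_axioms.intro]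
  case 0
  have "z0 - z_star \<in> V"
    using reference by (auto simp: V_def reference_ok_def)
  then show ?case
    by (intro stage c Om perm fo go) (simp_all add: z0 Omega_def)
next
  case (Suc s)
  have Om: "Omega (Psi p r z0) s > 0" for s using \<Psi> by (simp add: Omega_def)
  note stage = saddle_stage.intro[OF saddle_setting_axioms saddle_stage_axioms.intro]
  show ?case
    using saddle_stage.stage_gap(1,2)[OF Suc] saddle_stage.stage_contraction[OF Suc]
    by (intro stage c Om perm fo go) (simp_all add: Omega_def)
qed

end

theorem corollary4p5:
  fixes p :: "('n::finite, 'm::finite) saddle_problem"
    and r :: "('n, 'm) reference"
    and inv_x inv_y :: bool
    and z0 :: "(real^'n) \<times> (real^'m)"
    and c :: real
    and \<pi> :: "nat \<Rightarrow> nat \<Rightarrow> nat"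
    and fo :: "nat \<Rightarrow> nat list \<Rightarrow> real^'n \<Rightarrow> real^'n"
    and go :: "nat \<Rightarrow> nat list \<Rightarrow> real^'m \<Rightarrow> real^'m"
  assumes "domains_ok p"
    and "assumption_A1 p" and "assumption_A2 p" and "assumption_A3 p inv_x inv_y"
    and "ambient_smoothness p"
    and "reference_ok p inv_x inv_y r z0"
    and "min (delta_x p) (delta_y p) > 0"
    and "beta_x p * delta_y p \<le> 1/4" and "beta_y p * delta_x p \<le> 1/4"
    and "beta_x p > 0 \<Longrightarrow> zeta r = 0" and "beta_y p > 0 \<Longrightarrow> xi r = 0"
    and "z0 \<in> set_Z p"
    and "c \<ge> c_min"
    and "\<And>s. sorting_perm (budget p (Omega (Psi p r z0) s)) (\<pi> s)"
    and "\<And>s t x. fo s t x \<in> subdifferential (fun_f p) x"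
    and "\<And>s t y. go s t y \<in> subdifferential (fun_g p) y"
  shows
    "(\<forall>\<epsilon>. 0 < \<epsilon> \<and> \<epsilon> \<le> Psi p r z0 \<longrightarrow>
        Psi p r (restart_iter p c \<pi> fo go (Psi p r z0) z0 (num_restarts (Psi p r z0) \<epsilon>)) \<le> \<epsilon>) \<and>
     (nu_x p < 1 \<longrightarrow>
        (\<lambda>\<epsilon>. real (f_evals p c \<pi> fo go (Psi p r z0) z0 \<epsilon>)) \<in>
          O[at_right 0](\<lambda>\<epsilon>. Htilde_x p powr (2 / (1 + 3 * nu_x p)) * \<epsilon> powr ((nu_x p - 1) / (1 + 3 * nu_x p)))) \<and>
     (nu_x p = 1 \<longrightarrow>
        (\<lambda>\<epsilon>. real (f_evals p c \<pi> fo go (Psi p r z0) z0 \<epsilon>)) \<in>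
          soft_bigo (Psi p r z0) (\<lambda>\<epsilon>. sqrt (kappa_x p 0))) \<and>
     (nu_y p < 1 \<longrightarrow>
        (\<lambda>\<epsilon>. real (g_evals p c \<pi> fo go (Psi p r z0) z0 \<epsilon>)) \<in>
          O[at_right 0](\<lambda>\<epsilon>. Htilde_y p powr (2 / (1 + 3 * nu_y p)) * \<epsilon> powr ((nu_y p - 1) / (1 + 3 * nu_y p)))) \<and>
     (nu_y p = 1 \<longrightarrow>
        (\<lambda>\<epsilon>. real (g_evals p c \<pi> fo go (Psi p r z0) z0 \<epsilon>)) \<in>
          soft_bigo (Psi p r z0) (\<lambda>\<epsilon>. sqrt (kappa_y p 0))) \<and>
     (\<lambda>\<epsilon>. real (B_products p c \<pi> fo go (Psi p r z0) z0 \<epsilon>)) \<in>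
       soft_bigo (Psi p r z0) (\<lambda>\<epsilon>. sqrt (kappa_xy p))"
proof -
  have delta: "delta_x p > 0" "delta_y p > 0" using assms(7) by auto
  have sub: "subdifferential (fun_f p) x \<noteq> {}" "subdifferential (fun_g p) y \<noteq> {}" for x y
    using assms(15)[of 0 "[]" x] assms(16)[of 0 "[]" y] by auto
  interpret saddle_setting p r inv_x inv_y z0
    by (rule saddle_setting.intro) (fact assms delta sub)+
  define \<Psi>0 where "\<Psi>0 = Psi p r z0"
  show ?thesis
  proof (cases "\<Psi>0 > 0")
    case False
    then have "\<Psi>0 = 0" using Psi_nonneg[of z0] by (simp add: \<Psi>0_def)
    (* Without an initial error no stage is run, and all counts are zero. *)
    then have none: "num_restarts \<Psi>0 \<epsilon> = 0" for \<epsilon> by (simp add: num_restarts_def)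
    show ?thesis
      unfolding \<Psi>0_def[symmetric] f_evals_def g_evals_def B_products_def none soft_bigo_def
      using False by auto
  next
    case True
    define N where "N j s = n_grad (stage_run p c \<pi> fo go \<Psi>0 z0 s) (inv (\<pi> s) j)" for j s
    note stage = restart_stage[where \<pi> = \<pi> and fo = fo and go = go, OF assms(13) True[unfolded \<Psi>0_def] assms(14-16) assms(12), folded \<Psi>0_def]
    have c: "c \<ge> 0" using assms(13) by (simp add: c_min_def)
    have Om: "Omega \<Psi>0 s > 0" for s using True by (simp add: Omega_def)
    have N: "real (N j s) \<le> 4 * c * budget p (Omega \<Psi>0 s) j" if "j \<in> {1, 2, 3}" for j s
      unfolding N_def stage_run_def saddle_stage.stage_counts(1)[OF stage that]
      by (rule saddle_stage.A_inv_upper[OF stage that])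
    have N3: "n_op (stage_run p c \<pi> fo go \<Psi>0 z0 s) (inv (\<pi> s) 3) = 2 * N 3 s" for s
      unfolding N_def stage_run_def using saddle_stage.stage_counts[OF stage, of 3] by simp
    have fe: "(\<lambda>\<epsilon>. real (f_evals p c \<pi> fo go \<Psi>0 z0 \<epsilon>)) = (\<lambda>\<epsilon>. \<Sum>s<num_restarts \<Psi>0 \<epsilon>. real (N 1 s) + 1)"
      by (simp add: f_evals_def N_def add.commute)
    have ge: "(\<lambda>\<epsilon>. real (g_evals p c \<pi> fo go \<Psi>0 z0 \<epsilon>)) = (\<lambda>\<epsilon>. \<Sum>s<num_restarts \<Psi>0 \<epsilon>. real (N 2 s) + 1)"
      by (simp add: g_evals_def N_def add.commute)
    have Be: "(\<lambda>\<epsilon>. real (B_products p c \<pi> fo go \<Psi>0 z0 \<epsilon>)) = (\<lambda>\<epsilon>. \<Sum>s<num_restarts \<Psi>0 \<epsilon>. 8 * real (N 3 s))"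
      unfolding B_products_def N3 by (simp add: N_def[symmetric])
    have Hx: "Htilde_x p > 0" and Hy: "Htilde_y p > 0"
      using f_facts(4) g_facts(4) delta by (simp_all add: Htilde_x_def Htilde_y_def)
    show ?thesis
      unfolding \<Psi>0_def[symmetric]
    proof (intro conjI allI impI, goal_cases)
      case (1 \<epsilon>)
      then have "Omega \<Psi>0 (num_restarts \<Psi>0 \<epsilon>) \<le> \<epsilon>" by (intro num_restarts_bounds) auto
      with saddle_stage.Psi_in[OF stage] show ?case by (rule order.trans)
    next
      case 2
      then show ?case
        unfolding fe using N[of 1] Hx
        by (intro holder_budget_total[OF True f_facts(2) _ _ c]) (auto simp: budget_def)
    next
      case nu: 3
      show ?case
        unfolding fe
      proof (rule total_soft_bigo[OF True])
        show "real (N 1 s) + 1 \<le> 4 * c * max (Htilde_x p powr (1/2)) 1 + 1" for s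
          using N[of 1 s] Om[of s] by (simp add: budget_def nu)
        show "sqrt (kappa_x p 0) > 0"
          using f_facts(4) delta by (simp add: kappa_x_def smooth_const_def nu)
      qed simp
    next
      case 4
      then show ?case
        unfolding ge using N[of 2] Hy
        by (intro holder_budget_total[OF True g_facts(2) _ _ c]) (auto simp: budget_def)
    next
      case nu: 5
      show ?case
        unfolding ge
      proof (rule total_soft_bigo[OF True])
        show "real (N 2 s) + 1 \<le> 4 * c * max (Htilde_y p powr (1/2)) 1 + 1" for s
          using N[of 2 s] Om[of s] by (simp add: budget_def nu)
        show "sqrt (kappa_y p 0) > 0"
          using g_facts(4) delta by (simp add: kappa_y_def smooth_const_def nu)
      qed simp
    next
      case 6
      show ?case
        unfolding Be
      proof (rule total_soft_bigo[OF True])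
        show "8 * real (N 3 s) \<le> 8 * (4 * c * max (sqrt (kappa_xy p)) 1)" for s
          using N[of 3 s] by (simp add: budget_def)
        show "sqrt (kappa_xy p) > 0" using kappa_xy_pos by simp
      qed simp
    qed
  qed
qed

end
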